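(* Let $1<p<2$, let $\Omega\subset\mathbb{R}^N$ be a bounded domain and let $f\in C(\overline\Omega)$. Let $\{u_\varepsilon\}$ be a family of uniformly bounded Borel measurable functions $u_\varepsilon:\Omega_\varepsilon\to\mathbb{R}$, indexed by small $\varepsilon>0$, that are solutions to the dynamic programming principle $$u_\varepsilon(x)=\frac12\Big(\sup_{|z|=1}\mathcal{I}^z_\varepsilon u_\varepsilon(x)+\inf_{|z|=1}\mathcal{I}^z_\varepsilon u_\varepsilon(x)\Big)+\varepsilon^2 f(x)\quad\text{for all }x\in\Omega .$$ Then there is a subsequence (that is, a sequence of values $\varepsilon\to0$) and a Hölder continuous function $u:\Omega\to\mathbb{R}$ such that, along this subsequence, $u_\varepsilon\to u$ locally uniformly. Moreover, $u$ is a viscosity solution to $\Delta_p^N u=-2(N+p)f$ in $\Omega$.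
   Context: $B_1$ is the open unit ball of $\mathbb{R}^N$ centered at the origin, $|B_1|$ its Lebesgue measure. For $\varepsilon>0$, $\Omega_\varepsilon=\{x\in\mathbb{R}^N:\operatorname{dist}(x,\Omega)<\varepsilon\}$. Write $(t)_+^{p-2}=t^{p-2}$ if $t>0$ and $(t)_+^{p-2}=0$ if $t\le 0$. Let $\gamma_{N,p}=\frac{1}{|B_1|}\int_{B_1}(z\cdot h)_+^{p-2}\,dh$, which is finite and independent of the unit vector $z$. For a bounded Borel measurable function $u:\Omega_\varepsilon\to\mathbb{R}$, $x\in\Omega$ and $z\in\mathbb{R}^N$ with $|z|=1$, $$\mathcal{I}^z_\varepsilon u(x)=\frac{1}{\gamma_{N,p}}\cdot\frac{1}{|B_1|}\int_{B_1}u(x+\varepsilon h)\,(z\cdot h)_+^{p-2}\,dh .$$ The normalized $p$-Laplacian is $\Delta_p^N\phi=\Delta\phi+(p-2)\frac{\langle D^2\phi\nabla\phi,\nabla\phi\rangle}{|\nabla\phi|^2}$ where $\nabla\phi\ne0$. For a symmetric matrix $M$, $\lambda_{\min}(M)$ and $\lambda_{\max}(M)$ denote its smallest and largest eigenvalues. Viscosity solutions (for $1<p<2$ and $F\in C(\overline\Omega)$): a lower semicontinuous function $u$ is a viscosity supersolution of $\Delta_p^Nu=-F$ in $\Omega$ if for all $x_0\in\Omega$ and $\phi\in C^2(\Omega)$ such that $u-\phi$ attains a local minimum at $x_0$, one has $\Delta_p^N\phi(x_0)\le -F(x_0)$ if $\nabla\phi(x_0)\neq0$, and $\Delta\phi(x_0)+(p-2)\lambda_{\max}(D^2\phi(x_0))\le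 -F(x_0)$ if $\nabla\phi(x_0)=0$. An upper semicontinuous function $u$ is a viscosity subsolution of $\Delta_p^Nu=-F$ if $-u$ is a viscosity supersolution of $\Delta_p^Nv=F$; equivalently, whenever $u-\phi$ attains a local maximum at $x_0\in\Omega$ with $\phi\in C^2(\Omega)$, one has $\Delta_p^N\phi(x_0)\ge -F(x_0)$ if $\nabla\phi(x_0)\neq0$, and $\Delta\phi(x_0)+(p-2)\lambda_{\min}(D^2\phi(x_0))\ge -F(x_0)$ if $\nabla\phi(x_0)=0$. A viscosity solution is a function that is both a viscosity sub- and supersolution. Here $F=2(N+p)f$.
   Formalization: Hölder continuity of u is proved in the interior sense: one exponent on all of Ω, with a constant depending on the compact subset; a global Hölder bound on Ω fails in general, since u_ε may have discontinuous values on the boundary strip. *)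

theory Defs
  imports "HOL-Analysis.Analysis"
begin

section \<open>The averaging operator\<close>

definition eps_nbhd :: "real \<Rightarrow> (real^'n) set \<Rightarrow> (real^'n) set" where
  "eps_nbhd \<epsilon> \<Omega> = {x. infdist x \<Omega> < \<epsilon>}"

text \<open>\<open>pos_powr t a\<close> is $(t)_+^a$. It vanishes for $t \le 0$ for every exponent, whereas
  \<open>powr\<close> is not zero at negative bases.\<close>

definition pos_powr :: "real \<Rightarrow> real \<Rightarrow> real" where
  "pos_powr t a = (if t > 0 then t powr a else 0)"

text \<open>The constant $\gamma_{N,p}$, computed from a unit vector \<open>z\<close>. By rotation invariance its value
  does not depend on the choice of \<open>z\<close>; the dimension $N$ is \<open>CARD('n)\<close>.\<close>

definition gamma_const :: "real \<Rightarrow> real^'n \<Rightarrow> real" where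
  "gamma_const p z =
     1 / measure lborel (ball (0::real^'n) 1) *
     (LINT h:ball 0 1|lborel. pos_powr (z \<bullet> h) (p - 2))"

definition avg_op :: "real \<Rightarrow> real \<Rightarrow> real^'n \<Rightarrow> (real^'n \<Rightarrow> real) \<Rightarrow> real^'n \<Rightarrow> real" where
  "avg_op p \<epsilon> z u x =
     1 / gamma_const p z * (1 / measure lborel (ball (0::real^'n) 1)) *
     (LINT h:ball 0 1|lborel. u (x + \<epsilon> *\<^sub>R h) * pos_powr (z \<bullet> h) (p - 2))"

definition solves_DPP ::
  "real \<Rightarrow> real \<Rightarrow> (real^'n) set \<Rightarrow> (real^'n \<Rightarrow> real) \<Rightarrow> (real^'n \<Rightarrow> real) \<Rightarrow> bool" where
  "solves_DPP p \<epsilon> \<Omega> f u \<longleftrightarrow>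
     (\<forall>x\<in>\<Omega>. u x = 1/2 * ((SUP z\<in>sphere 0 1. avg_op p \<epsilon> z u x) +
                          (INF z\<in>sphere 0 1. avg_op p \<epsilon> z u x)) + \<epsilon>\<^sup>2 * f x)"

section \<open>Viscosity solutions of the normalized p-Laplace equation\<close>

definition grad :: "(real^'n \<Rightarrow> real) \<Rightarrow> real^'n \<Rightarrow> real^'n" where
  "grad \<phi> x = (\<chi> i. frechet_derivative \<phi> (at x) (axis i 1))"

definition hess :: "(real^'n \<Rightarrow> real) \<Rightarrow> real^'n \<Rightarrow> real^'n^'n" where
  "hess \<phi> x = jacobian (grad \<phi>) (at x)"

text \<open>Meant for open \<open>\<Omega>\<close>. The gradient is continuous since it is differentiable.\<close>

definition C2_on :: "(real^'n) set \<Rightarrow> (real^'n \<Rightarrow> real) \<Rightarrow> bool" where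
  "C2_on \<Omega> \<phi> \<longleftrightarrow>
     (\<forall>x\<in>\<Omega>. \<phi> differentiable (at x)) \<and>
     (\<forall>x\<in>\<Omega>. grad \<phi> differentiable (at x)) \<and>
     continuous_on \<Omega> (hess \<phi>)"

definition laplacian :: "(real^'n \<Rightarrow> real) \<Rightarrow> real^'n \<Rightarrow> real" where
  "laplacian \<phi> x = trace (hess \<phi> x)"

definition normalized_p_laplacian :: "real \<Rightarrow> (real^'n \<Rightarrow> real) \<Rightarrow> real^'n \<Rightarrow> real" where
  "normalized_p_laplacian p \<phi> x =
     laplacian \<phi> x + (p - 2) * (((hess \<phi> x *v grad \<phi> x) \<bullet> grad \<phi> x) / (norm (grad \<phi> x))\<^sup>2)"

definition eigenvalues :: "real^'n^'n \<Rightarrow> real set" where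
  "eigenvalues M = {l. \<exists>v. v \<noteq> 0 \<and> M *v v = l *\<^sub>R v}"

text \<open>Only used for symmetric matrices, whose (finite) set of real eigenvalues is nonempty.\<close>

definition lambda_min :: "real^'n^'n \<Rightarrow> real" where
  "lambda_min M = Min (eigenvalues M)"

definition lambda_max :: "real^'n^'n \<Rightarrow> real" where
  "lambda_max M = Max (eigenvalues M)"

definition lsc_on :: "'a::topological_space set \<Rightarrow> ('a \<Rightarrow> real) \<Rightarrow> bool" where
  "lsc_on S u \<longleftrightarrow> (\<forall>x\<in>S. \<forall>a. a < u x \<longrightarrow> (\<forall>\<^sub>F y in at x within S. a < u y))"

definition usc_on :: "'a::topological_space set \<Rightarrow> ('a \<Rightarrow> real) \<Rightarrow> bool" where
  "usc_on S u \<longleftrightarrow> (\<forall>x\<in>S. \<forall>a. u x < a \<longrightarrow> (\<forall>\<^sub>F y in at x within S. u y < a))"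

definition local_min_at :: "'a::topological_space set \<Rightarrow> ('a \<Rightarrow> real) \<Rightarrow> 'a \<Rightarrow> bool" where
  "local_min_at S g x0 \<longleftrightarrow> x0 \<in> S \<and> (\<forall>\<^sub>F y in at x0 within S. g x0 \<le> g y)"

definition local_max_at :: "'a::topological_space set \<Rightarrow> ('a \<Rightarrow> real) \<Rightarrow> 'a \<Rightarrow> bool" where
  "local_max_at S g x0 \<longleftrightarrow> x0 \<in> S \<and> (\<forall>\<^sub>F y in at x0 within S. g y \<le> g x0)"

text \<open>Sub- and supersolutions of $\Delta_p^N u = -F$ in \<open>\<Omega>\<close>, for $1 < p < 2$. Since $p - 2 < 0$, the
  roles of the extreme eigenvalues at critical points of the test function are swapped compared
  with the case $p \ge 2$.\<close>

definition viscosity_supersolution ::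
  "real \<Rightarrow> (real^'n \<Rightarrow> real) \<Rightarrow> (real^'n) set \<Rightarrow> (real^'n \<Rightarrow> real) \<Rightarrow> bool" where
  "viscosity_supersolution p F \<Omega> u \<longleftrightarrow>
     lsc_on \<Omega> u \<and>
     (\<forall>x0\<in>\<Omega>. \<forall>\<phi>. C2_on \<Omega> \<phi> \<longrightarrow> local_min_at \<Omega> (\<lambda>x. u x - \<phi> x) x0 \<longrightarrow>
        (grad \<phi> x0 \<noteq> 0 \<longrightarrow> normalized_p_laplacian p \<phi> x0 \<le> - F x0) \<and>
        (grad \<phi> x0 = 0 \<longrightarrow> laplacian \<phi> x0 + (p - 2) * lambda_max (hess \<phi> x0) \<le> - F x0))"

definition viscosity_subsolution ::
  "real \<Rightarrow> (real^'n \<Rightarrow> real) \<Rightarrow> (real^'n) set \<Rightarrow> (real^'n \<Rightarrow> real) \<Rightarrow> bool" where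
  "viscosity_subsolution p F \<Omega> u \<longleftrightarrow>
     usc_on \<Omega> u \<and>
     (\<forall>x0\<in>\<Omega>. \<forall>\<phi>. C2_on \<Omega> \<phi> \<longrightarrow> local_max_at \<Omega> (\<lambda>x. u x - \<phi> x) x0 \<longrightarrow>
        (grad \<phi> x0 \<noteq> 0 \<longrightarrow> normalized_p_laplacian p \<phi> x0 \<ge> - F x0) \<and>
        (grad \<phi> x0 = 0 \<longrightarrow> laplacian \<phi> x0 + (p - 2) * lambda_min (hess \<phi> x0) \<ge> - F x0))"

definition viscosity_solution ::
  "real \<Rightarrow> (real^'n \<Rightarrow> real) \<Rightarrow> (real^'n) set \<Rightarrow> (real^'n \<Rightarrow> real) \<Rightarrow> bool" where
  "viscosity_solution p F \<Omega> u \<longleftrightarrow>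
     viscosity_subsolution p F \<Omega> u \<and> viscosity_supersolution p F \<Omega> u"

section \<open>Interior Hoelder continuity and locally uniform convergence\<close>

text \<open>One exponent for all of \<open>\<Omega>\<close>, but a constant for each compact subset: no boundary values are
  prescribed in a regular way, so a Hoelder estimate up to the boundary cannot be expected.\<close>

definition Hoelder_continuous_in :: "(real^'n) set \<Rightarrow> (real^'n \<Rightarrow> real) \<Rightarrow> bool" where
  "Hoelder_continuous_in \<Omega> u \<longleftrightarrow>
     (\<exists>\<alpha>. 0 < \<alpha> \<and> \<alpha> \<le> 1 \<and>
        (\<forall>K. compact K \<and> K \<subseteq> \<Omega> \<longrightarrow>
           (\<exists>C. \<forall>x\<in>K. \<forall>y\<in>K. \<bar>u x - u y\<bar> \<le> C * dist x y powr \<alpha>)))"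

definition locally_uniform_limit ::
  "(real^'n) set \<Rightarrow> (nat \<Rightarrow> real^'n \<Rightarrow> real) \<Rightarrow> (real^'n \<Rightarrow> real) \<Rightarrow> bool" where
  "locally_uniform_limit \<Omega> v u \<longleftrightarrow>
     (\<forall>K. compact K \<and> K \<subseteq> \<Omega> \<longrightarrow> uniform_limit K v u sequentially)"

end

theory Submission
  imports Defs "HOL-Complex_Analysis.Great_Picard"
begin

text \<open>The regularity step is a coupling argument in the spirit of Ishii and Lions. Comparing \<open>u\<close> at two
  points \<open>x\<close> and \<open>y\<close> with a concave function of \<open>r = norm (x - y)\<close>, the adversary's directions
  are \<open>z1\<close> (at \<open>x\<close>) and \<open>z2\<close> (at \<open>y\<close>), and we answer at both points. Let \<open>e\<close> be the direction of
  \<open>x - y\<close>. Unless \<open>z1\<close> is close to \<open>e\<close> and \<open>z2\<close> close to \<open>-e\<close>, answering \<open>-e\<close> and \<open>e\<close> produces a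
  drift of order \<open>\<epsilon>\<close> that brings the points together. Otherwise we answer \<open>-z1\<close> and \<open>-z2\<close>, which
  cancels all drift, and couple the two steps by the reflection that exchanges \<open>z1\<close> and \<open>z2\<close>: then
  \<open>x - y\<close> only moves along a direction close to \<open>e\<close>, and the strict concavity of the square root
  gives a gain of order \<open>\<epsilon>^2\<close>. This yields Hoelder continuity with exponent 1/2 up to an error
  of order \<open>sqrt \<epsilon>\<close>, hence a locally uniform limit along a subsequence.

  For the equation, let a test function touch the limit from below. At an almost minimum of the
  difference, the nearly minimizing direction \<open>z\<close> paired with \<open>-z\<close> gives the second order inequality,
  and paired with the normalized gradient it must tend to the opposite of the gradient.\<close>

text \<open>Two obstacles shape the regularity step. A tilted average lives on a half ball and has a
  drift of order \<open>eps\<close>, while the equation is visible only at order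
  \<open>eps^2\<close>. The localizing term therefore costs order \<open>eps\<close> unless both
  halves of the average cancel to first order: hence one answer whose drift pays for everything, and
  one that is free of drift and may live on a gain of order \<open>eps^2\<close>. Secondly,
  \<open>u\<close> is only measurable. Suprema over points and directions are merely approached, and
  a modulus of continuity can be expected only up to an error vanishing with \<open>eps\<close>,
  which compactness tolerates.

  As nothing is prescribed near the boundary of the ball, the comparison runs over all pairs of
  points, and the quadratic term forces every almost maximum with a positive value into the ball.

  The factor \<open>2 * (N + p)\<close>, with \<open>N\<close> the dimension, is the denominator
  \<open>N + p\<close> of the second moments of the kernel times the 2 of the Taylor formula. These
  moments and the direction of the drift come from reflections, rotations and a scaling
  argument.\<close>

lemma borel_measurable_orthogonal_transformation:
  fixes T :: "real^'n \<Rightarrow> real^'n"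
  assumes "orthogonal_transformation T"
  shows "T \<in> borel_measurable borel"
  using assms orthogonal_transformation_linear linear_conv_bounded_linear linear_continuous_on
    borel_measurable_continuous_onI by blast

section \<open>Lebesgue measure under isometries and coordinate scalings\<close>

lemma nn_integral_lborel_translate:
  fixes f :: "'a::euclidean_space \<Rightarrow> ennreal"
  assumes "f \<in> borel_measurable borel"
  shows "(\<integral>\<^sup>+h. f (c + h) \<partial>lborel) = (\<integral>\<^sup>+h. f h \<partial>lborel)"
  using nn_integral_distr[of "(+) c" lborel borel f] assms by (simp add: lborel_distr_plus)

text \<open>A rotated Lebesgue measure is translation invariant, and the usual Fubini argument for the
  uniqueness of Haar measure compares it with \<open>lborel\<close>; the unit ball fixes the constant.
  (\<open>measure_orthogonal_image\<close> is only available for well-ordered index types.)\<close>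

lemma nn_integral_orthogonal_transformation:
  fixes T :: "real^'n \<Rightarrow> real^'n" and g :: "real^'n \<Rightarrow> ennreal"
  assumes T: "orthogonal_transformation T" and [measurable]: "g \<in> borel_measurable borel"
  shows "(\<integral>\<^sup>+h. g (T h) \<partial>lborel) = (\<integral>\<^sup>+h. g h \<partial>lborel)"
proof -
  define f :: "real^'n \<Rightarrow> ennreal" where "f = indicator (ball 0 1)"
  have [measurable]: "f \<in> borel_measurable borel"
    unfolding f_def by (rule borel_measurable_indicator) simp
  have [measurable]: "T \<in> borel_measurable borel"
    using T by (rule borel_measurable_orthogonal_transformation)
  have lin: "linear T" using T by (rule orthogonal_transformation_linear)
  have surj: "surj T" using T by (rule orthogonal_transformation_surj)
  have ft: "f (- T y) = f y" for y
    using T by (simp add: f_def indicator_def orthogonal_transformation_norm)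
  have "(\<integral>\<^sup>+x. f x \<partial>lborel) * (\<integral>\<^sup>+y. g (T y) \<partial>lborel)
      = (\<integral>\<^sup>+x. (\<integral>\<^sup>+y. f x * g (x + T y) \<partial>lborel) \<partial>lborel)"
  proof -
    have "(\<integral>\<^sup>+y. g (T y) \<partial>lborel) = (\<integral>\<^sup>+y. g (x + T y) \<partial>lborel)" for x
    proof -
      obtain c where "T c = x" using surj by (metis surj_def)
      then show ?thesis
        using nn_integral_lborel_translate[of "\<lambda>y. g (T y)" c] lin by (simp add: linear_add)
    qed
    then show ?thesis
      by (subst nn_integral_multc[symmetric]) (auto simp: nn_integral_cmult intro!: nn_integral_cong)
  qed
  also have "\<dots> = (\<integral>\<^sup>+y. (\<integral>\<^sup>+x. f x * g (x + T y) \<partial>lborel) \<partial>lborel)"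
    by (rule lborel_pair.Fubini'[symmetric]) measurable
  also have "\<dots> = (\<integral>\<^sup>+y. (\<integral>\<^sup>+x. f (x - T y) * g x \<partial>lborel) \<partial>lborel)"
  proof (rule nn_integral_cong)
    fix y
    show "(\<integral>\<^sup>+x. f x * g (x + T y) \<partial>lborel) = (\<integral>\<^sup>+x. f (x - T y) * g x \<partial>lborel)"
      using nn_integral_lborel_translate[of "\<lambda>x. f (x - T y) * g x" "T y"] by (simp add: add.commute)
  qed
  also have "\<dots> = (\<integral>\<^sup>+x. (\<integral>\<^sup>+y. f (x - T y) * g x \<partial>lborel) \<partial>lborel)"
    by (rule lborel_pair.Fubini') measurable
  also have "\<dots> = (\<integral>\<^sup>+x. f x \<partial>lborel) * (\<integral>\<^sup>+x. g x \<partial>lborel)"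
  proof -
    have "(\<integral>\<^sup>+y. f (x - T y) \<partial>lborel) = (\<integral>\<^sup>+x. f x \<partial>lborel)" for x
    proof -
      obtain c where "T c = x" using surj by (metis surj_def)
      then show ?thesis
        using nn_integral_lborel_translate[of "\<lambda>y. f (x - T y)" c] lin
        by (simp add: linear_add ft)
    qed
    then show ?thesis by (simp add: nn_integral_multc nn_integral_cmult)
  qed
  finally have *: "(\<integral>\<^sup>+x. f x \<partial>lborel) * (\<integral>\<^sup>+y. g (T y) \<partial>lborel)
    = (\<integral>\<^sup>+x. f x \<partial>lborel) * (\<integral>\<^sup>+x. g x \<partial>lborel)" .
  have "(\<integral>\<^sup>+x. f x \<partial>lborel) = emeasure lborel (ball (0::real^'n) 1)"
    by (simp add: f_def)
  moreover have "emeasure lborel (ball (0::real^'n) 1) \<noteq> \<infinity>"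
    using emeasure_lborel_ball_finite[of "0::real^'n" 1] by simp
  moreover have "emeasure lborel (ball (0::real^'n) 1) \<noteq> 0"
    using content_ball_pos[of 1 "0::real^'n"] by (auto simp: measure_def)
  ultimately show ?thesis using * by (simp add: ennreal_mult_cancel_left)
qed

lemma distr_orthogonal_transformation:
  fixes T :: "real^'n \<Rightarrow> real^'n"
  assumes T: "orthogonal_transformation T"
  shows "distr lborel borel T = lborel"
proof (rule measure_eqI)
  have [measurable]: "T \<in> borel_measurable borel"
    using T by (rule borel_measurable_orthogonal_transformation)
  fix A assume "A \<in> sets (distr lborel borel T)"
  then have [measurable]: "A \<in> sets borel" by simp
  have "emeasure (distr lborel borel T) A = (\<integral>\<^sup>+h. indicator A h \<partial>distr lborel borel T)" by simp
  also have "\<dots> = (\<integral>\<^sup>+h. indicator A (T h) \<partial>lborel)" by (rule nn_integral_distr) auto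
  also have "\<dots> = (\<integral>\<^sup>+h. indicator A h \<partial>lborel)"
    using T by (rule nn_integral_orthogonal_transformation) simp
  finally show "emeasure (distr lborel borel T) A = emeasure lborel A" by simp
qed simp

lemma integral_orthogonal_transformation:
  fixes T :: "real^'n \<Rightarrow> real^'n" and f :: "real^'n \<Rightarrow> real"
  assumes "orthogonal_transformation T" and "f \<in> borel_measurable borel"
  shows "(\<integral>h. f (T h) \<partial>lborel) = (\<integral>h. f h \<partial>lborel)"
  using integral_distr[of T lborel borel f] assms
  by (simp add: distr_orthogonal_transformation borel_measurable_orthogonal_transformation)

text \<open>The diagonal map stretching coordinate \<open>i\<close> by \<open>l\<close> has Jacobian
  \<open>l\<close>. These dilations are the one-parameter variation from which the second moments
  are read off.\<close>

lemma
  fixes f :: "real^'n \<Rightarrow> real"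
  assumes [measurable]: "f \<in> borel_measurable borel" and l: "0 < l"
  shows integral_scale_coordinate:
      "(\<integral>h. f h \<partial>lborel) = l * (\<integral>h. f (\<chi> j. if j = i then l * h $ j else h $ j) \<partial>lborel)"
    and integrable_scale_coordinate:
      "integrable lborel f \<Longrightarrow> integrable lborel (\<lambda>h. f (\<chi> j. if j = i then l * h $ j else h $ j))"
proof -
  define c :: "real^'n \<Rightarrow> real" where "c b = (if b = axis i 1 then l else 1)" for b
  define T :: "real^'n \<Rightarrow> real^'n" where "T x = 0 + (\<Sum>j\<in>Basis. (c j * (x \<bullet> j)) *\<^sub>R j)" for x
  have T: "T h = (\<chi> j. if j = i then l * h $ j else h $ j)" for h
  proof (rule vec_eq_iff[THEN iffD2], rule allI)
    fix j :: 'n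
    have "T h $ j = T h \<bullet> axis j 1" by (simp add: inner_axis)
    also have "\<dots> = c (axis j 1) * (h \<bullet> axis j 1)"
      unfolding T_def by (simp add: inner_sum_left_Basis axis_in_Basis_iff)
    also have "\<dots> = (if j = i then l * h $ j else h $ j)"
      by (simp add: c_def inner_axis axis_eq_axis)
    finally show "T h $ j = (\<chi> j. if j = i then l * h $ j else h $ j) $ j" by simp
  qed
  have [measurable]: "T \<in> borel \<rightarrow>\<^sub>M borel" by (simp add: T_def[abs_def])
  have i: "axis i 1 \<in> (Basis :: (real^'n) set)" by (simp add: axis_in_Basis_iff)
  have "(\<Prod>j\<in>Basis. \<bar>c j\<bar>) = (\<Prod>j\<in>Basis. if axis i 1 = (j::real^'n) then l else 1)"
    using l by (intro prod.cong) (auto simp: c_def)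
  also have "\<dots> = l" using i by (simp add: prod.delta')
  finally have p: "(\<Prod>j\<in>Basis. \<bar>c j\<bar>) = l" .
  have "lborel = density (distr lborel borel T) (\<lambda>_. (\<Prod>j\<in>Basis. \<bar>c j\<bar>))"
    unfolding T_def by (rule lborel_affine_euclidean) (use l in \<open>auto simp: c_def\<close>)
  then have D: "lborel = density (distr lborel borel T) (\<lambda>_. ennreal l)"
    using p by simp
  then have "(\<integral>h. f h \<partial>lborel) = (\<integral>h. f h \<partial>density (distr lborel borel T) (\<lambda>_. ennreal l))"
    by simp
  also have "\<dots> = l * (\<integral>h. f (T h) \<partial>lborel)"
    using l by (subst integral_density) (auto simp: integral_distr)
  finally show "(\<integral>h. f h \<partial>lborel) = l * (\<integral>h. f (\<chi> j. if j = i then l * h $ j else h $ j) \<partial>lborel)"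
    by (simp add: T)
  assume "integrable lborel f"
  then have "integrable (density (distr lborel borel T) (\<lambda>_. ennreal l)) f" using D by simp
  then have "integrable (distr lborel borel T) (\<lambda>x. l * f x)"
    using l by (subst (asm) integrable_density) auto
  then have "integrable (distr lborel borel T) f"
    using l by simp
  then have "integrable lborel (\<lambda>h. f (T h))"
    by (subst (asm) integrable_distr_eq) auto
  then show "integrable lborel (\<lambda>h. f (\<chi> j. if j = i then l * h $ j else h $ j))"
    by (simp add: T)
qed

section \<open>The tilted averages\<close>

text \<open>The indicator of the ball is part of the weight, so that all integrals run over the
  whole space and an orthogonal change of variables touches the integrand alone. For
  \<open>p < 2\<close> the weight is unbounded near the hyperplane orthogonal to
  \<open>z\<close>.\<close>

definition weight :: "real \<Rightarrow> real^'n \<Rightarrow> real^'n \<Rightarrow> real" where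
  "weight p z h = indicator (ball 0 1) h * pos_powr (z \<bullet> h) (p - 2)"

definition mass :: "real \<Rightarrow> real^'n \<Rightarrow> real" where
  "mass p z = (\<integral>h. weight p z h \<partial>lborel)"

definition mean :: "real \<Rightarrow> real^'n \<Rightarrow> (real^'n \<Rightarrow> real) \<Rightarrow> real" where
  "mean p z \<psi> = (\<integral>h. weight p z h * \<psi> h \<partial>lborel) / mass p z"

text \<open>Boundedness is asked on the unit ball only, because the weight vanishes outside; this
  admits linear and quadratic functions. Measurability is global, so that rotations can act.\<close>

definition tame :: "(real^'n \<Rightarrow> real) \<Rightarrow> bool" where
  "tame \<psi> \<longleftrightarrow> \<psi> \<in> borel_measurable borel \<and> (\<exists>B. \<forall>h\<in>ball 0 1. \<bar>\<psi> h\<bar> \<le> B)"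

lemma pos_powr_nonneg: "0 \<le> pos_powr t a"
  by (simp add: pos_powr_def)

lemma weight_nonneg: "0 \<le> weight p z h"
  by (simp add: weight_def pos_powr_nonneg)

lemma pos_powr_measurable [measurable]:
  "f \<in> borel_measurable M \<Longrightarrow> (\<lambda>x. pos_powr (f x) a) \<in> borel_measurable M"
  unfolding pos_powr_def by simp

lemma weight_measurable [measurable]: "weight p z \<in> borel_measurable borel"
  unfolding weight_def by (intro borel_measurable_times borel_measurable_indicator) auto

lemma weight_orthogonal:
  assumes "orthogonal_transformation T"
  shows "weight p (T z) (T h) = weight p z h"
  using assms by (simp add: weight_def orthogonal_transformation_def indicator_def orthogonal_transformation_norm)

lemma weight_eq_0: "norm h \<ge> 1 \<Longrightarrow> weight p z h = 0"
  by (simp add: weight_def)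

context
  fixes p :: real
  assumes p1: "1 < p" and p2: "p < 2"
begin

lemma weight_ge_1: "norm z = 1 \<Longrightarrow> norm h < 1 \<Longrightarrow> 0 < z \<bullet> h \<Longrightarrow> 1 \<le> weight p z h"
proof -
  assume a: "norm z = 1" "norm h < 1" "0 < z \<bullet> h"
  have "z \<bullet> h \<le> norm z * norm h" by (rule norm_cauchy_schwarz)
  then have "z \<bullet> h \<le> 1" using a by simp
  moreover have "1 powr (p - 2) \<le> (z \<bullet> h) powr (p - 2)"
    using a p2 calculation by (intro powr_mono2') auto
  ultimately show ?thesis using a by (simp add: weight_def pos_powr_def)
qed

text \<open>The condition \<open>p > 1\<close> is what keeps the exponent \<open>p - 2\<close> above
  \<open>-1\<close>, hence the singularity at 0 integrable.\<close>

lemma nn_integral_pos_powr_finite: "(\<integral>\<^sup>+t. ennreal (indicator {0..1} t * pos_powr t (p - 2)) \<partial>lborel) < \<infinity>"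
proof -
  have "((\<lambda>x. x powr (p - 2)) has_integral (1 powr (p - 2 + 1) / (p - 2 + 1))) {0..1}"
    using p1 by (intro has_integral_powr_from_0) auto
  then have "set_integrable lebesgue {0..1} (\<lambda>x. x powr (p - 2))"
    by (intro nonnegative_absolutely_integrable_1) (auto simp: has_integral_integrable_integral)
  then have "(\<integral>\<^sup>+t. ennreal (norm (indicator {0..1} t *\<^sub>R (t powr (p - 2)))) \<partial>lebesgue) < \<infinity>"
    unfolding set_integrable_def integrable_iff_bounded by auto
  then have "(\<integral>\<^sup>+t. ennreal (indicator {0..1} t * t powr (p - 2)) \<partial>lborel) < \<infinity>"
    by (subst (asm) nn_integral_completion) (auto simp: abs_mult)
  moreover have "indicator {0..1} t * t powr (p - 2) = indicator {0..1} t * pos_powr t (p - 2)" for t :: real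
    by (auto simp: pos_powr_def indicator_def)
  ultimately show ?thesis by simp
qed

lemma integrable_weight:
  fixes z :: "real^'n"
  assumes z: "norm z = 1"
  shows "integrable lborel (weight p z)"
proof -
  obtain k :: 'n where True by simp
  obtain T :: "real^'n \<Rightarrow> real^'n" where T: "orthogonal_transformation T" "T (axis k 1) = z"
    by (rule orthogonal_transformation_exists_1[of "axis k (1::real)" z]) (use z in auto)
  \<comment> \<open>Tonelli is applied to a product majorant: after a rotation taking coordinate
    direction \<open>k\<close> to \<open>z\<close>, only the factor of that coordinate is singular,
    and every other one is the indicator of \<open>{-1..1}\<close>.\<close>
  define g :: "real^'n \<Rightarrow> real \<Rightarrow> real" where
    "g b t = (if b = axis k 1 then indicator {0..1} t * pos_powr t (p - 2) else indicator {-1..1} t)" for b t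
  have [measurable]: "g b \<in> borel_measurable borel" for b
    unfolding g_def by measurable
  have gn: "0 \<le> g b t" for b t by (simp add: g_def pos_powr_nonneg)
  have "weight p (axis k 1) h \<le> (\<Prod>b\<in>Basis. g b (h \<bullet> b))" for h
  proof (cases "norm h < 1 \<and> 0 < h $ k")
    case True
    have *: "\<bar>h \<bullet> b\<bar> \<le> 1" if "b \<in> Basis" for b
      using Basis_le_norm[OF that, of h] True by simp
    have k: "axis k 1 \<in> (Basis :: (real^'n) set)" by (simp add: axis_in_Basis_iff)
    have "(\<Prod>b\<in>Basis. g b (h \<bullet> b)) = (\<Prod>b\<in>Basis. if axis k 1 = (b::real^'n) then pos_powr (h $ k) (p - 2) else 1)"
    proof (rule prod.cong)
      fix b :: "real^'n" assume b: "b \<in> Basis"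
      show "g b (h \<bullet> b) = (if axis k 1 = b then pos_powr (h $ k) (p - 2) else 1)"
        using *[OF b] True by (auto simp: g_def inner_axis indicator_def abs_le_iff)
    qed simp
    also have "\<dots> = pos_powr (h $ k) (p - 2)" using k by (simp add: prod.delta')
    finally show ?thesis using True by (simp add: weight_def inner_axis')
  next
    case False
    then have "weight p (axis k 1) h = 0"
      by (auto simp: weight_def pos_powr_def inner_axis' indicator_def)
    then show ?thesis by (simp add: prod_nonneg gn)
  qed
  then have "(\<integral>\<^sup>+h. ennreal (weight p (axis k 1) h) \<partial>lborel)
      \<le> (\<integral>\<^sup>+h. (\<Prod>b\<in>Basis. ennreal (g b (h \<bullet> b))) \<partial>lborel)"
    by (intro nn_integral_mono) (simp add: prod_ennreal gn ennreal_leI)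
  also have "\<dots> = (\<Prod>b\<in>Basis. (\<integral>\<^sup>+t. ennreal (g b t) \<partial>lborel))"
    by (rule nn_integral_lborel_prod) (auto simp: gn)
  also have "\<dots> < \<infinity>"
  proof -
    have fin: "(\<integral>\<^sup>+t. ennreal (g b t) \<partial>lborel) < \<infinity>" for b
    proof (cases "b = axis k 1")
      case True
      then show ?thesis using nn_integral_pos_powr_finite by (simp add: g_def)
    next
      case False
      then have "(\<integral>\<^sup>+t. ennreal (g b t) \<partial>lborel) = emeasure lborel {-1..1::real}"
        by (simp add: g_def ennreal_indicator)
      then show ?thesis by simp
    qed
    have "(\<Prod>b\<in>B. (\<integral>\<^sup>+t. ennreal (g b t) \<partial>lborel)) < \<infinity>" if "finite B" for B :: "(real^'n) set"
      using that by (induction rule: finite_induct) (use fin in \<open>auto simp: ennreal_mult_less_top\<close>)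
    then show ?thesis by simp
  qed
  finally have "(\<integral>\<^sup>+h. ennreal (weight p (axis k 1) h) \<partial>lborel) < \<infinity>" .
  moreover have "(\<integral>\<^sup>+h. ennreal (weight p z h) \<partial>lborel) = (\<integral>\<^sup>+h. ennreal (weight p z (T h)) \<partial>lborel)"
    using T by (intro nn_integral_orthogonal_transformation[symmetric]) auto
  moreover have "weight p z (T h) = weight p (axis k 1) h" for h
    using weight_orthogonal[OF T(1), of p "axis k 1"] T(2) by simp
  ultimately show ?thesis
    by (intro integrableI_bounded) (auto simp: weight_nonneg)
qed

end

text \<open>The volume of the unit ball occurs both in front of the integral and, through
  \<open>gamma_const\<close>, in the denominator, and cancels.\<close>

lemma avg_op_eq_mean:
  fixes u :: "real^'n \<Rightarrow> real"
  shows "avg_op p eps z u x = mean p z (\<lambda>h. u (x + eps *\<^sub>R h))"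
proof -
  have "measure lborel (ball (0::real^'n) 1) \<noteq> 0"
    using content_ball_pos[of 1 "0::real^'n"] by simp
  moreover have "(LINT h:ball 0 1|lborel. u (x + eps *\<^sub>R h) * pos_powr (z \<bullet> h) (p - 2))
      = (\<integral>h. weight p z h * u (x + eps *\<^sub>R h) \<partial>lborel)"
    unfolding set_lebesgue_integral_def by (rule Bochner_Integration.integral_cong) (auto simp: weight_def)
  moreover have "(LINT h:ball 0 1|lborel. pos_powr (z \<bullet> h) (p - 2)) = mass p z"
    unfolding set_lebesgue_integral_def mass_def
    by (rule Bochner_Integration.integral_cong) (auto simp: weight_def)
  ultimately show ?thesis
    by (simp add: avg_op_def gamma_const_def mean_def)
qed

lemma tameI: "\<psi> \<in> borel_measurable borel \<Longrightarrow> (\<And>h. norm h < 1 \<Longrightarrow> \<bar>\<psi> h\<bar> \<le> B) \<Longrightarrow> tame \<psi>"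
  unfolding tame_def by (auto intro!: exI[of _ B])

lemma tame_continuous:
  assumes "continuous_on UNIV \<psi>"
  shows "tame \<psi>"
proof -
  have "bounded (\<psi> ` cball 0 1)"
    by (intro compact_imp_bounded compact_continuous_image continuous_on_subset[OF assms]) auto
  then obtain B where "\<And>h. h \<in> cball 0 1 \<Longrightarrow> norm (\<psi> h) \<le> B"
    unfolding bounded_iff by blast
  then show ?thesis
    using borel_measurable_continuous_onI[OF assms] by (intro tameI[of _ B]) auto
qed

lemma tame_const [simp]: "tame (\<lambda>h. c)"
  by (rule tame_continuous) simp

lemma tame_add [intro]: "tame \<phi> \<Longrightarrow> tame \<psi> \<Longrightarrow> tame (\<lambda>h. \<phi> h + \<psi> h)"
proof -
  assume "tame \<phi>" "tame \<psi>"
  then obtain B C where *: "\<phi> \<in> borel_measurable borel" "\<psi> \<in> borel_measurable borel"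
    "\<forall>h\<in>ball 0 1. \<bar>\<phi> h\<bar> \<le> B" "\<forall>h\<in>ball 0 1. \<bar>\<psi> h\<bar> \<le> C"
    by (auto simp: tame_def)
  then have "\<bar>\<phi> h + \<psi> h\<bar> \<le> B + C" if "norm h < 1" for h
    using that by (smt (verit) mem_ball_0)
  then show ?thesis using * by (intro tameI[of _ "B + C"]) auto
qed

lemma tame_mult [intro]: "tame \<phi> \<Longrightarrow> tame \<psi> \<Longrightarrow> tame (\<lambda>h. \<phi> h * \<psi> h)"
proof -
  assume "tame \<phi>" "tame \<psi>"
  then obtain B C where *: "\<phi> \<in> borel_measurable borel" "\<psi> \<in> borel_measurable borel"
    "\<forall>h\<in>ball 0 1. \<bar>\<phi> h\<bar> \<le> B" "\<forall>h\<in>ball 0 1. \<bar>\<psi> h\<bar> \<le> C"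
    by (auto simp: tame_def)
  then have "\<bar>\<phi> h * \<psi> h\<bar> \<le> B * C" if "norm h < 1" for h
    using that unfolding abs_mult by (intro mult_mono) (auto intro: order_trans[OF abs_ge_zero])
  then show ?thesis using * by (intro tameI[of _ "B * C"]) auto
qed

lemma tame_cmult [intro]: "tame \<psi> \<Longrightarrow> tame (\<lambda>h. c * \<psi> h)"
  by (rule tame_mult) simp_all

lemma tame_diff [intro]: "tame \<phi> \<Longrightarrow> tame \<psi> \<Longrightarrow> tame (\<lambda>h. \<phi> h - \<psi> h)"
  using tame_add[of \<phi> "\<lambda>h. -1 * \<psi> h"] tame_cmult[of \<psi> "-1"] by simp

lemma tame_sum [intro]: "(\<And>i. i \<in> I \<Longrightarrow> tame (\<psi> i)) \<Longrightarrow> tame (\<lambda>h. \<Sum>i\<in>I. \<psi> i h)"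
  by (induction I rule: infinite_finite_induct) auto

lemma tame_orthogonal:
  fixes T :: "real^'n \<Rightarrow> real^'n"
  assumes "tame \<psi>" and T: "orthogonal_transformation T"
  shows "tame (\<lambda>h. \<psi> (T h))"
proof -
  obtain B where B: "\<psi> \<in> borel_measurable borel" "\<And>h. norm h < 1 \<Longrightarrow> \<bar>\<psi> h\<bar> \<le> B"
    using assms(1) unfolding tame_def by (metis mem_ball_0)
  show ?thesis
  proof (rule tameI[of _ B])
    show "(\<lambda>h. \<psi> (T h)) \<in> borel_measurable borel"
      by (rule measurable_compose[OF borel_measurable_orthogonal_transformation[OF T] B(1)])
    show "\<bar>\<psi> (T h)\<bar> \<le> B" if "norm h < 1" for h
      using that B(2)[of "T h"] orthogonal_transformation_norm[OF T] by simp
  qed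
qed

section \<open>Reflections, and the calculus of tilted averages\<close>

definition reflection :: "'a::real_inner \<Rightarrow> 'a \<Rightarrow> 'a" where
  "reflection v h = h - (2 * (v \<bullet> h)) *\<^sub>R v"

lemma orthogonal_transformation_reflection:
  assumes "norm v = 1"
  shows "orthogonal_transformation (reflection v)"
proof -
  have vv: "v \<bullet> v = 1" using assms by (simp add: norm_eq_1)
  have "linear (reflection v)"
    by (rule linearI) (auto simp: reflection_def algebra_simps inner_add_right)
  moreover have "reflection v x \<bullet> reflection v y = x \<bullet> y" for x y
    by (simp add: reflection_def inner_diff_left inner_diff_right vv inner_commute[of x v])
  ultimately show ?thesis by (simp add: orthogonal_transformation_def)
qed

lemma orthogonal_transformation_minus:
  "orthogonal_transformation T \<Longrightarrow> orthogonal_transformation (\<lambda>h. - T h)"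
  by (simp add: orthogonal_transformation_def linear_compose_neg)

context
  fixes p :: real
  assumes p1: "1 < p" and p2: "p < 2"
begin

text \<open>Since the exponent is negative, the weight is at least 1 on the open half ball, and the
  ball of radius 1/8 about \<open>z /\<^sub>R 2\<close> lies in it.\<close>

lemma mass_pos:
  fixes z :: "real^'n"
  assumes z: "norm z = 1"
  shows "0 < mass p z"
proof -
  have "measure lborel (ball (z /\<^sub>R 2) (1/8)) = (\<integral>h. indicator (ball (z /\<^sub>R 2) (1/8)) h \<partial>lborel)"
    by simp
  also have "\<dots> \<le> mass p z" unfolding mass_def
  proof (rule integral_mono)
    show "integrable lborel (weight p z)" using integrable_weight[OF p1 p2 z] .
    show "integrable lborel (indicat_real (ball (z /\<^sub>R 2) (1/8)))"
      by (intro integrable_real_indicator emeasure_lborel_ball_finite) simp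
  next
    fix h :: "real^'n"
    show "indicator (ball (z /\<^sub>R 2) (1/8)) h \<le> weight p z h"
    proof (cases "h \<in> ball (z /\<^sub>R 2) (1/8)")
      case True
      then have d: "norm (h - z /\<^sub>R 2) < 1/8" by (simp add: dist_norm norm_minus_commute)
      have "norm h \<le> norm (h - z /\<^sub>R 2) + norm (z /\<^sub>R 2)" by (metis diff_add_cancel norm_triangle_ineq)
      moreover have "- (z \<bullet> (h - z /\<^sub>R 2)) \<le> norm z * norm (h - z /\<^sub>R 2)"
        using Cauchy_Schwarz_ineq2[of z "h - z /\<^sub>R 2"] by simp
      moreover have "z \<bullet> z = 1" using z by (simp add: norm_eq_1)
      ultimately have "norm h < 1" "0 < z \<bullet> h" using d z by (auto simp: inner_diff_right)
      then show ?thesis using weight_ge_1[OF p1 p2 z] True by simp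
    qed (simp add: weight_nonneg)
  qed
  finally have "measure lborel (ball (z /\<^sub>R 2) (1/8)) \<le> mass p z" .
  moreover have "0 < measure lborel (ball (z /\<^sub>R 2) (1/8))" by (rule content_ball_pos) simp
  ultimately show ?thesis by linarith
qed

lemma integrable_weight_mult:
  assumes z: "norm z = 1" and "tame \<psi>"
  shows "integrable lborel (\<lambda>h. weight p z h * \<psi> h)"
proof -
  obtain B where B: "\<psi> \<in> borel_measurable borel" "\<And>h. norm h < 1 \<Longrightarrow> \<bar>\<psi> h\<bar> \<le> B"
    using assms(2) unfolding tame_def by (metis mem_ball_0)
  show ?thesis
  proof (rule Bochner_Integration.integrable_bound)
    show "integrable lborel (\<lambda>h. B * weight p z h)"
      using integrable_weight[OF p1 p2 z] by simp
    have "\<bar>weight p z h * \<psi> h\<bar> \<le> \<bar>B * weight p z h\<bar>" for h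
    proof (cases "norm h < 1")
      case True
      then have "\<bar>\<psi> h\<bar> \<le> \<bar>B\<bar>" using B(2) by fastforce
      then show ?thesis
        by (simp add: abs_mult weight_nonneg mult.commute mult_right_mono)
    qed (simp add: weight_eq_0)
    then show "AE h in lborel. norm (weight p z h * \<psi> h) \<le> norm (B * weight p z h)" by simp
  qed (use B in simp)
qed

lemma mean_const [simp]: "norm z = 1 \<Longrightarrow> mean p z (\<lambda>h. c) = c"
  using mass_pos[of z] by (simp add: mean_def mass_def)

lemma mean_add: "norm z = 1 \<Longrightarrow> tame \<phi> \<Longrightarrow> tame \<psi> \<Longrightarrow>
    mean p z (\<lambda>h. \<phi> h + \<psi> h) = mean p z \<phi> + mean p z \<psi>"
  by (simp add: mean_def distrib_left integrable_weight_mult add_divide_distrib)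

lemma mean_diff: "norm z = 1 \<Longrightarrow> tame \<phi> \<Longrightarrow> tame \<psi> \<Longrightarrow>
    mean p z (\<lambda>h. \<phi> h - \<psi> h) = mean p z \<phi> - mean p z \<psi>"
  by (simp add: mean_def right_diff_distrib integrable_weight_mult diff_divide_distrib)

lemma mean_cmult: "mean p z (\<lambda>h. c * \<psi> h) = c * mean p z \<psi>"
  by (simp add: mean_def mult.left_commute[of _ c])

lemma mean_uminus: "mean p z (\<lambda>h. - \<psi> h) = - mean p z \<psi>"
  by (simp add: mean_def)

lemma mean_sum: "norm z = 1 \<Longrightarrow> (\<And>i. i \<in> I \<Longrightarrow> tame (\<psi> i)) \<Longrightarrow>
    mean p z (\<lambda>h. \<Sum>i\<in>I. \<psi> i h) = (\<Sum>i\<in>I. mean p z (\<psi> i))"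
  by (induction I rule: infinite_finite_induct) (auto simp: mean_add tame_sum)

text \<open>Only points of positive weight matter. \<open>drift_ge\<close> relies on this, as it
  compares \<open>(z \<bullet> h)^2\<close> with \<open>z \<bullet> h\<close>, which is valid on the
  half ball alone.\<close>

lemma mean_mono_supp:
  assumes "norm z = 1" "tame \<phi>" "tame \<psi>"
    and "\<And>h. norm h < 1 \<Longrightarrow> 0 < z \<bullet> h \<Longrightarrow> \<phi> h \<le> \<psi> h"
  shows "mean p z \<phi> \<le> mean p z \<psi>"
proof -
  have "weight p z h * \<phi> h \<le> weight p z h * \<psi> h" for h
  proof (cases "norm h < 1 \<and> 0 < z \<bullet> h")
    case True then show ?thesis using assms(4) by (simp add: mult_left_mono weight_nonneg)
  next
    case False
    then have "weight p z h = 0" by (auto simp: weight_def pos_powr_def)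
    then show ?thesis by simp
  qed
  then show ?thesis unfolding mean_def
    using assms mass_pos[of z] by (intro divide_right_mono integral_mono integrable_weight_mult) auto
qed

lemma mean_mono:
  assumes "norm z = 1" "tame \<phi>" "tame \<psi>" "\<And>h. norm h < 1 \<Longrightarrow> \<phi> h \<le> \<psi> h"
  shows "mean p z \<phi> \<le> mean p z \<psi>"
  using assms by (intro mean_mono_supp) auto

lemma mean_cong: "(\<And>h. norm h < 1 \<Longrightarrow> \<phi> h = \<psi> h) \<Longrightarrow> mean p z \<phi> = mean p z \<psi>"
proof -
  assume *: "\<And>h. norm h < 1 \<Longrightarrow> \<phi> h = \<psi> h"
  have "weight p z h * \<phi> h = weight p z h * \<psi> h" for h
    using * weight_eq_0[of h p z] by (cases "norm h < 1") auto
  then show ?thesis by (simp only: mean_def)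
qed

lemma mean_bounded:
  assumes "norm z = 1" "tame \<phi>" "\<And>h. norm h < 1 \<Longrightarrow> \<bar>\<phi> h\<bar> \<le> B"
  shows "\<bar>mean p z \<phi>\<bar> \<le> B"
proof -
  have *: "\<phi> h \<le> B" "- B \<le> \<phi> h" if "norm h < 1" for h
    using assms(3)[OF that] by auto
  show ?thesis
    using mean_mono[OF assms(1,2) tame_const *(1)] mean_mono[OF assms(1) tame_const assms(2) *(2)]
      mean_const[OF assms(1)] by (simp add: abs_le_iff)
qed

lemma mass_eq:
  fixes z z' :: "real^'n"
  assumes "norm z = 1" "norm z' = 1"
  shows "mass p z = mass p z'"
proof -
  obtain T :: "real^'n \<Rightarrow> real^'n" where T: "orthogonal_transformation T" "T z' = z"
    by (rule orthogonal_transformation_exists_1[OF assms(2,1)])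
  have "weight p z (T h) = weight p z' h" for h
    using weight_orthogonal[OF T(1), of p z' h] unfolding T(2) .
  then have "mass p z' = (\<integral>h. weight p z (T h) \<partial>lborel)"
    by (simp only: mass_def)
  also have "\<dots> = mass p z"
    unfolding mass_def by (rule integral_orthogonal_transformation[OF T(1) weight_measurable])
  finally show ?thesis by (rule sym)
qed

lemma mean_orthogonal:
  fixes T :: "real^'n \<Rightarrow> real^'n"
  assumes T: "orthogonal_transformation T" and z: "norm z = 1" and [measurable]: "\<psi> \<in> borel_measurable borel"
  shows "mean p (T z) \<psi> = mean p z (\<lambda>h. \<psi> (T h))"
proof -
  have "(\<integral>h. weight p (T z) h * \<psi> h \<partial>lborel) = (\<integral>h. weight p (T z) (T h) * \<psi> (T h) \<partial>lborel)"
    by (rule integral_orthogonal_transformation[OF T, symmetric]) simp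
  moreover have "mass p (T z) = mass p z"
    using T z by (intro mass_eq) (auto simp: orthogonal_transformation_norm)
  ultimately show ?thesis by (simp add: mean_def weight_orthogonal[OF T])
qed

lemma mean_uminus_direction:
  fixes z :: "real^'n"
  assumes "norm z = 1" "\<psi> \<in> borel_measurable borel"
  shows "mean p (- z) \<psi> = mean p z (\<lambda>h. \<psi> (- h))"
  using mean_orthogonal[of uminus z \<psi>] orthogonal_transformation_minus[of "\<lambda>x. x"] assms
  by (simp add: orthogonal_transformation_id)

abbreviation ball_integral :: "real^'n \<Rightarrow> (real^'n \<Rightarrow> real) \<Rightarrow> real" where
  "ball_integral c \<psi> \<equiv> (\<integral>h. indicator (ball c (1/8)) h * \<psi> h \<partial>lborel)"

text \<open>The conditions on \<open>c\<close> place the ball of radius 1/8 inside the half ball,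
  where the weight is at least 1. A tilted average is thus bounded below by an unweighted integral,
  and unweighted integrals belonging to different directions or centers can be compared.\<close>

lemma mean_ge_ball:
  fixes z :: "real^'n"
  assumes z: "norm z = 1" and t: "tame \<psi>" and nn: "\<And>h. norm h < 1 \<Longrightarrow> 0 \<le> \<psi> h"
    and c: "norm c \<le> 7/8" "1/8 \<le> z \<bullet> c"
  shows "ball_integral c \<psi> / mass p z \<le> mean p z \<psi>"
  unfolding mean_def
proof (intro divide_right_mono integral_mono)
  have *: "norm h < 1 \<and> 0 < z \<bullet> h" if "h \<in> ball c (1/8)" for h
  proof -
    have d: "norm (h - c) < 1/8" using that by (simp add: dist_norm norm_minus_commute)
    have "norm h \<le> norm (h - c) + norm c" by (metis diff_add_cancel norm_triangle_ineq)
    moreover have "- (z \<bullet> (h - c)) \<le> norm z * norm (h - c)"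
      using Cauchy_Schwarz_ineq2[of z "h - c"] by simp
    ultimately show ?thesis using d z c by (auto simp: inner_diff_right)
  qed
  show "integrable lborel (\<lambda>h. weight p z h * \<psi> h)" using integrable_weight_mult[OF z t] .
  show le: "indicator (ball c (1/8)) h * \<psi> h \<le> weight p z h * \<psi> h" for h
  proof (cases "norm h < 1")
    case True
    then show ?thesis
      using nn[OF True] * weight_ge_1[OF p1 p2 z True]
      by (intro mult_right_mono) (auto simp: indicator_def weight_nonneg)
  next
    case False
    then have "indicator (ball c (1/8)) h = (0::real)" using * by (auto simp: indicator_def)
    then show ?thesis using False by (simp add: weight_eq_0)
  qed
  have m: "\<psi> \<in> borel_measurable borel" using t by (simp add: tame_def)
  show "integrable lborel (\<lambda>h. indicator (ball c (1/8)) h * \<psi> h)"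
  proof (rule Bochner_Integration.integrable_bound[OF integrable_weight_mult[OF z t]])
    show "(\<lambda>h. indicator (ball c (1/8)) h * \<psi> h) \<in> borel_measurable lborel"
      using m by (intro borel_measurable_times borel_measurable_indicator) auto
    have "\<bar>indicator (ball c (1/8)) h * \<psi> h\<bar> \<le> \<bar>weight p z h * \<psi> h\<bar>" for h
    proof (cases "h \<in> ball c (1/8)")
      case True
      then show ?thesis using le[of h] nn[of h] *[OF True] by (simp add: weight_nonneg)
    qed simp
    then show "AE h in lborel. norm (indicator (ball c (1/8)) h * \<psi> h) \<le> norm (weight p z h * \<psi> h)"
      by simp
  qed
qed (use mass_pos[OF z] in simp)

end

section \<open>First and second moments of the tilted averages\<close>

lemma tame_inner [simp]: "tame (\<lambda>h. h \<bullet> a)" "tame (\<lambda>h. a \<bullet> h)"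
  by (auto intro!: tame_continuous continuous_intros)

lemma tame_nth [simp]: "tame (\<lambda>h. h $ i)"
  by (auto intro!: tame_continuous continuous_intros)

lemma tame_quadratic: "tame (\<lambda>h. h \<bullet> (H *v h))"
  by (intro tame_continuous continuous_intros)

context
  fixes p :: real
  assumes p1: "1 < p" and p2: "p < 2"
begin

text \<open>The negated reflection fixes \<open>z\<close> and reverses its orthogonal complement; it
  preserves the weight, so the mean displacement has no component orthogonal to
  \<open>z\<close>.\<close>

lemma first_moment_tilt:
  fixes z :: "real^'n"
  assumes z: "norm z = 1"
  shows "mean p z (\<lambda>h. h \<bullet> a) = mean p z (\<lambda>h. z \<bullet> h) * (z \<bullet> a)"
proof -
  define T where "T h = - reflection z h" for h
  have T: "orthogonal_transformation T" unfolding T_def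
    by (rule orthogonal_transformation_minus[OF orthogonal_transformation_reflection[OF z]])
  have zz: "z \<bullet> z = 1" using z by (simp add: norm_eq_1)
  then have Tz: "T z = z" by (simp add: T_def reflection_def algebra_simps scaleR_2)
  have "mean p z (\<lambda>h. h \<bullet> a) = mean p z (\<lambda>h. T h \<bullet> a)"
    using mean_orthogonal[OF p1 p2 T z, of "\<lambda>h. h \<bullet> a"] tame_inner(1)[of a] Tz by (simp add: tame_def)
  also have "(\<lambda>h. T h \<bullet> a) = (\<lambda>h. (2 * (z \<bullet> a)) * (z \<bullet> h) - h \<bullet> a)"
    by (auto simp: T_def reflection_def inner_diff_left algebra_simps)
  also have "mean p z \<dots> = 2 * (z \<bullet> a) * mean p z (\<lambda>h. z \<bullet> h) - mean p z (\<lambda>h. h \<bullet> a)"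
    using z by (simp add: mean_diff[OF p1 p2] tame_cmult mean_cmult[OF p1 p2])
  finally show ?thesis by simp
qed

text \<open>The length of the mean displacement: \<open>first_moment_tilt\<close> makes that
  displacement \<open>drift z\<close> times \<open>z\<close>, and by \<open>drift_eq\<close> the
  factor is the same for all unit vectors.\<close>

definition drift :: "real^'n \<Rightarrow> real" where "drift z = mean p z (\<lambda>h. z \<bullet> h)"

text \<open>Let \<open>\<Phi>\<close> be the integral of the positive part of \<open>1 - |h|^2\<close> against the unrestricted weight.
  Scaling coordinate \<open>i\<close> by \<open>l\<close> multiplies the weight by an explicit power of \<open>l\<close>, and since the positive
  part is convex, \<open>\<Phi>\<close> dominates an explicit function of \<open>l\<close> with equality at \<open>l = 1\<close>. Its vanishing
  derivative there determines the \<open>i\<close>-th moment without differentiating under the integral.\<close>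

lemma second_moment_axis:
  fixes i k :: "'n::finite"
  shows "(\<integral>h. weight p (axis k 1) h * (h $ i)^2 \<partial>lborel)
    = (if i = k then p - 1 else 1) / (real CARD('n) + p) * mass p (axis k (1::real) :: real^'n)"
proof -
  define z :: "real^'n" where "z = axis k 1"
  have z: "norm z = 1" by (simp add: z_def)
  define S where "S i = (\<integral>h. weight p z h * (h $ i)^2 \<partial>lborel)" for i
  \<comment> \<open>\<open>b i\<close> is the exponent of \<open>l\<close> produced by stretching
    coordinate \<open>i\<close>: 1 from the Jacobian and, in the singular coordinate
    \<open>k\<close>, a further \<open>p - 2\<close> from the weight.\<close>
  define b where "b i = (if i = k then p - 1 else 1)" for i
  define f :: "real^'n \<Rightarrow> real" where "f h = pos_powr (h $ k) (p - 2) * max 0 (1 - (norm h)^2)" for h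
  define \<Phi> where "\<Phi> = (\<integral>h. f h \<partial>lborel)"
  have tq: "tame (\<lambda>h::real^'n. (h $ i)^2)" for i by (auto intro!: tame_continuous continuous_intros)
  have tn: "tame (\<lambda>h::real^'n. (norm h)^2)" by (auto intro!: tame_continuous continuous_intros)
  have fw: "f h = weight p z h * (1 - (norm h)^2)" for h
  proof (cases "norm h < 1")
    case True
    then have "(norm h)^2 \<le> 1" by (simp add: power_le_one)
    then show ?thesis using True by (simp add: f_def weight_def z_def inner_axis' max_def)
  next
    case False
    then have "1 - (norm h)^2 \<le> 0" by (simp add: one_le_power)
    then have "max 0 (1 - (norm h)^2) = 0" by (rule max_absorb1)
    then show ?thesis using False by (simp add: f_def weight_def)
  qed
  have fm [measurable]: "f \<in> borel_measurable borel" unfolding f_def by measurable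
  have fi: "integrable lborel f" unfolding fw
    by (intro integrable_weight_mult[OF p1 p2 z] tame_diff tn tame_const)
  have "b i * \<Phi> = 2 * S i" for i
  proof -
    have *: "l powr b i * (\<Phi> - (l^2 - 1) * S i) \<le> \<Phi>" if l: "0 < l" for l
    proof -
      define L :: "real^'n \<Rightarrow> real^'n" where "L h = (\<chi> j. if j = i then l * h $ j else h $ j)" for h
      define m where "m = (if i = k then l powr (p - 2) else 1)"
      have m: "0 < m" using l by (simp add: m_def)
      have ml: "l * m = l powr b i"
        using l by (auto simp: m_def b_def powr_diff powr_minus field_simps power2_eq_square)
      have nL: "(norm (L h))^2 = (norm h)^2 + (l^2 - 1) * (h $ i)^2" for h
      proof -
        have "(norm (L h))^2 = (\<Sum>j\<in>UNIV. (L h $ j)^2)"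
          by (simp only: power2_norm_eq_inner inner_vec_def) (simp add: power2_eq_square)
        also have "\<dots> = (\<Sum>j\<in>UNIV. (h $ j)^2 + (if i = j then (l^2 - 1) * (h $ j)^2 else 0))"
          by (intro sum.cong) (auto simp: L_def power_mult_distrib algebra_simps)
        also have "\<dots> = (norm h)^2 + (l^2 - 1) * (h $ i)^2"
          by (simp only: power2_norm_eq_inner inner_vec_def) (simp add: sum.distrib power2_eq_square)
        finally show ?thesis .
      qed
      have pp: "pos_powr (L h $ k) (p - 2) = m * pos_powr (h $ k) (p - 2)" for h
        using l by (auto simp: L_def m_def pos_powr_def powr_mult zero_less_mult_iff)
      have le: "m * (weight p z h * (1 - (norm h)^2) - (l^2 - 1) * (weight p z h * (h $ i)^2)) \<le> f (L h)" for h
      proof (cases "norm h < 1")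
        case True
        have "f (L h) = m * (pos_powr (h $ k) (p - 2) * max 0 (1 - ((norm h)^2 + (l^2 - 1) * (h $ i)^2)))"
          unfolding f_def nL pp by simp
        also have "\<dots> \<ge> m * (pos_powr (h $ k) (p - 2) * (1 - ((norm h)^2 + (l^2 - 1) * (h $ i)^2)))"
          using m by (intro mult_left_mono) (auto simp: pos_powr_nonneg)
        finally show ?thesis using True by (simp add: weight_def z_def inner_axis' algebra_simps)
      next
        case False
        have "0 \<le> f (L h)" by (simp add: f_def pos_powr_nonneg)
        then show ?thesis using False by (simp add: weight_def)
      qed
      have iw: "integrable lborel (\<lambda>h. weight p z h * (h $ i)^2)"
        using integrable_weight_mult[OF p1 p2 z tq] .
      have "m * (\<Phi> - (l^2 - 1) * S i)
          = (\<integral>h. m * (weight p z h * (1 - (norm h)^2) - (l^2 - 1) * (weight p z h * (h $ i)^2)) \<partial>lborel)"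
        using iw fi unfolding S_def \<Phi>_def fw by simp
      also have "\<dots> \<le> (\<integral>h. f (L h) \<partial>lborel)"
        using iw fi integrable_scale_coordinate[OF fm l fi, of i] unfolding fw[symmetric] L_def[symmetric]
        by (intro integral_mono) (auto simp: le[folded fw])
      finally have "l * (m * (\<Phi> - (l^2 - 1) * S i)) \<le> l * (\<integral>h. f (L h) \<partial>lborel)"
        using l by simp
      also have "\<dots> = \<Phi>"
        using integral_scale_coordinate[OF fm l, of i] unfolding \<Phi>_def L_def by simp
      finally show ?thesis unfolding ml[symmetric] by (simp add: mult.assoc)
    qed
    define g where "g l = l powr b i * (\<Phi> - (l^2 - 1) * S i)" for l
    have "(g has_real_derivative (b i * \<Phi> - 2 * S i)) (at 1)"
      unfolding g_def by (auto intro!: derivative_eq_intros)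
    moreover have "g y \<le> g 1" if "\<bar>1 - y\<bar> < 1" for y
      using *[of y] that by (simp add: g_def)
    ultimately have "b i * \<Phi> - 2 * S i = 0"
      by (intro DERIV_local_max[of g _ 1 1]) auto
    then show ?thesis by simp
  qed
  then have S: "S i = b i * \<Phi> / 2" for i by simp
  \<comment> \<open>The moments sum to the integral of \<open>(norm h)^2\<close> against the weight,
    which is the mass minus \<open>\<Phi>\<close>; this fixes \<open>\<Phi>\<close> and brings in
    the denominator \<open>N + p\<close>.\<close>
  have "(\<Sum>i\<in>UNIV. S i) = (\<integral>h. (\<Sum>i\<in>UNIV. weight p z h * (h $ i)^2) \<partial>lborel)"
    unfolding S_def by (rule Bochner_Integration.integral_sum[symmetric])
      (rule integrable_weight_mult[OF p1 p2 z tq])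
  also have "\<dots> = (\<integral>h. weight p z h - f h \<partial>lborel)"
  proof (rule Bochner_Integration.integral_cong)
    fix h :: "real^'n"
    have "(\<Sum>i\<in>UNIV. (h $ i)^2) = (norm h)^2"
      by (simp only: power2_norm_eq_inner inner_vec_def) (simp add: power2_eq_square)
    then show "(\<Sum>i\<in>UNIV. weight p z h * (h $ i)^2) = weight p z h - f h"
      by (simp add: fw sum_distrib_left[symmetric] right_diff_distrib)
  qed simp
  also have "\<dots> = mass p z - \<Phi>"
    unfolding mass_def \<Phi>_def using integrable_weight[OF p1 p2 z] fi by simp
  finally have "(\<Sum>i\<in>UNIV. b i) * \<Phi> / 2 = mass p z - \<Phi>"
    unfolding S by (simp add: sum_distrib_right[symmetric] sum_divide_distrib[symmetric])
  moreover have "(\<Sum>i\<in>UNIV. b i) = real CARD('n) + p - 2"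
  proof -
    have "(\<Sum>i\<in>UNIV. b i) = (\<Sum>i\<in>UNIV. 1 + (if k = i then p - 2 else 0))"
      by (intro sum.cong) (auto simp: b_def)
    then show ?thesis by (simp add: sum.distrib)
  qed
  ultimately have "\<Phi> * (real CARD('n) + p) = 2 * mass p z" by (simp add: field_simps)
  moreover have "real CARD('n) + p > 0" using p1 by (simp add: add_nonneg_pos)
  ultimately have "\<Phi> / 2 = mass p z / (real CARD('n) + p)" by (simp add: field_simps)
  moreover have "S i = b i * (\<Phi> / 2)" by (simp add: S)
  ultimately have "S i = b i / (real CARD('n) + p) * mass p z" by (simp only: times_divide_eq_left times_divide_eq_right)
  then show ?thesis by (simp add: S_def b_def z_def)
qed

text \<open>At least one of two different coordinates is not the tilted one; flipping its sign
  preserves the weight and changes the sign of the product.\<close>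

lemma mixed_moment_axis:
  fixes i j k :: "'n::finite"
  assumes "i \<noteq> j"
  shows "mean p (axis k (1::real)) (\<lambda>h. h $ i * h $ j) = 0"
proof -
  obtain m where m: "m \<noteq> k" "m = i \<or> m = j" using assms by metis
  define T :: "real^'n \<Rightarrow> real^'n" where "T = reflection (axis m 1)"
  have T: "orthogonal_transformation T" unfolding T_def
    by (rule orthogonal_transformation_reflection) simp
  have Tk: "T (axis k 1) = axis k 1"
    using m(1) by (simp add: T_def reflection_def inner_axis_axis)
  have "axis m (1::real) $ l = (if l = m then 1 else 0)" for l by (simp add: axis_def)
  then have Th: "T h $ l = (if l = m then - h $ l else h $ l)" for h l
    by (simp add: T_def reflection_def inner_axis')
  have "tame (\<lambda>h::real^'n. h $ i * h $ j)" by (intro tame_mult) simp_all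
  then have "mean p (axis k (1::real)) (\<lambda>h. h $ i * h $ j) = mean p (axis k 1) (\<lambda>h. T h $ i * T h $ j)"
    using mean_orthogonal[OF p1 p2 T, of "axis k 1" "\<lambda>h. h $ i * h $ j"] Tk by (simp add: tame_def)
  also have "(\<lambda>h. T h $ i * T h $ j) = (\<lambda>h. - (h $ i * h $ j))"
    using m(2) assms by (auto simp: Th)
  also have "mean p (axis k 1) (\<lambda>h. - (h $ i * h $ j)) = - mean p (axis k 1) (\<lambda>h. h $ i * h $ j)"
    by (rule mean_uminus[OF p1 p2])
  finally show ?thesis by simp
qed

lemma quadratic_moment_axis:
  fixes H :: "real^'n^'n"
  shows "mean p (axis k 1) (\<lambda>h. h \<bullet> (H *v h)) = (trace H + (p - 2) * H $ k $ k) / (real CARD('n) + p)"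
proof -
  have n: "norm (axis k 1 :: real^'n) = 1" by simp
  have t: "tame (\<lambda>h::real^'n. h $ i * h $ j)" for i j by (intro tame_mult) simp_all
  have e: "h \<bullet> (H *v h) = (\<Sum>i\<in>UNIV. \<Sum>j\<in>UNIV. H $ i $ j * (h $ i * h $ j))" for h
    by (simp add: inner_vec_def matrix_vector_mult_def sum_distrib_left mult_ac)
  have d: "mean p (axis k (1::real)) (\<lambda>h. h $ i * h $ i) = (if i = k then p - 1 else 1) / (real CARD('n) + p)"
    for i :: 'n
    using second_moment_axis[of k i] mass_pos[OF p1 p2 n]
    by (simp add: mean_def power2_eq_square)
  have "mean p (axis k 1) (\<lambda>h. h \<bullet> (H *v h))
      = (\<Sum>i\<in>UNIV. \<Sum>j\<in>UNIV. H $ i $ j * mean p (axis k (1::real)) (\<lambda>h. h $ i * h $ j))"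
    unfolding e by (simp add: mean_sum[OF p1 p2 n] tame_sum tame_cmult t mean_cmult[OF p1 p2])
  also have "\<dots> = (\<Sum>i\<in>UNIV. \<Sum>j\<in>UNIV. if i = j then H $ i $ i * ((if i = k then p - 1 else 1) / (real CARD('n) + p)) else 0)"
    by (intro sum.cong refl) (auto simp: mixed_moment_axis d)
  also have "\<dots> = (\<Sum>i\<in>UNIV. H $ i $ i / (real CARD('n) + p) + (if k = i then (p - 2) * H $ i $ i / (real CARD('n) + p) else 0))"
    by (intro sum.cong refl) (auto simp: add_divide_distrib[symmetric] algebra_simps)
  also have "\<dots> = (trace H + (p - 2) * H $ k $ k) / (real CARD('n) + p)"
    by (simp add: sum.distrib trace_def sum_divide_distrib[symmetric] add_divide_distrib)
  finally show ?thesis .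
qed

text \<open>This identity is where the normalized p-Laplacian comes from: with \<open>z\<close>
  along the gradient the numerator is that operator, and the factor 1/2 of the Taylor formula turns
  the denominator into \<open>2 * (N + p)\<close>. Conjugating \<open>H\<close> by a rotation
  reduces the claim to a coordinate direction.\<close>

lemma quadratic_moment:
  fixes H :: "real^'n^'n" and z :: "real^'n"
  assumes z: "norm z = 1"
  shows "mean p z (\<lambda>h. h \<bullet> (H *v h)) = (trace H + (p - 2) * (z \<bullet> (H *v z))) / (real CARD('n) + p)"
proof -
  fix k :: 'n
  have n: "norm (axis k 1 :: real^'n) = 1" by simp
  obtain T :: "real^'n \<Rightarrow> real^'n" where T: "orthogonal_transformation T" "T (axis k 1) = z"
    by (rule orthogonal_transformation_exists_1[OF n z])
  define M where "M = matrix T"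
  have TM: "T h = M *v h" for h
    using T(1) by (simp add: M_def orthogonal_transformation_linear matrix_works)
  have om: "orthogonal_matrix M" using T(1) orthogonal_transformation_matrix M_def by blast
  define H' where "H' = transpose M ** H ** M"
  have q: "T h \<bullet> (H *v T h) = h \<bullet> (H' *v h)" for h
  proof -
    have "h \<bullet> (H' *v h) = h \<bullet> (transpose M *v (H *v (M *v h)))"
      by (simp only: H'_def matrix_vector_mul_assoc[symmetric])
    also have "\<dots> = ((H *v (M *v h)) v* M) \<bullet> h"
      by (simp add: transpose_matrix_vector inner_commute)
    also have "\<dots> = (H *v (M *v h)) \<bullet> (M *v h)" by (rule dot_lmul_matrix)
    finally show ?thesis by (simp add: TM inner_commute)
  qed
  have "mean p z (\<lambda>h. h \<bullet> (H *v h)) = mean p (axis k 1) (\<lambda>h. h \<bullet> (H' *v h))"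
    using mean_orthogonal[OF p1 p2 T(1) n, of "\<lambda>h. h \<bullet> (H *v h)"] tame_quadratic[of H]
    by (simp add: T(2) q tame_def)
  also have "\<dots> = (trace H' + (p - 2) * H' $ k $ k) / (real CARD('n) + p)"
    by (rule quadratic_moment_axis)
  also have "H' $ k $ k = axis k 1 \<bullet> (H' *v axis k 1)"
    by (simp add: inner_axis' matrix_vector_mul_component inner_axis)
  also have "\<dots> = z \<bullet> (H *v z)" using q[of "axis k 1"] T(2) by simp
  also have "trace H' = trace (M ** (transpose M ** H))"
    unfolding H'_def by (rule trace_mul_sym)
  also have "\<dots> = trace H"
    using om by (simp add: matrix_mul_assoc orthogonal_matrix_def)
  finally show ?thesis .
qed

lemma inner_square_moment:
  fixes v z :: "real^'n"
  assumes z: "norm z = 1" and v: "norm v = 1"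
  shows "mean p z (\<lambda>h. (v \<bullet> h)^2) = (1 + (p - 2) * (v \<bullet> z)^2) / (real CARD('n) + p)"
proof -
  define H :: "real^'n^'n" where "H = (\<chi> i j. v $ i * v $ j)"
  have q: "h \<bullet> (H *v h) = (v \<bullet> h)^2" for h
    by (simp add: H_def inner_vec_def matrix_vector_mult_def power2_eq_square sum_product sum_distrib_left mult_ac)
  have "trace H = v \<bullet> v" by (simp add: H_def trace_def inner_vec_def)
  then have "trace H = 1" using v by (simp add: norm_eq_1)
  then show ?thesis using quadratic_moment[OF z, of H] by (simp add: q)
qed

text \<open>As \<open>p < 2\<close>, the second moment is smallest for \<open>v\<close> parallel to
  \<open>z\<close>, where it equals this bound.\<close>

lemma inner_square_moment_ge:
  fixes v z :: "real^'n"
  assumes z: "norm z = 1" and v: "norm v = 1"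
  shows "(p - 1) / (real CARD('n) + p) \<le> mean p z (\<lambda>h. (v \<bullet> h)^2)"
proof -
  have "\<bar>v \<bullet> z\<bar> \<le> 1" using Cauchy_Schwarz_ineq2[of v z] z v by simp
  then have "(v \<bullet> z)^2 \<le> 1" by (simp add: abs_square_le_1)
  then have "(2 - p) * (v \<bullet> z)^2 \<le> (2 - p) * 1" using p2 by (intro mult_left_mono) auto
  then show ?thesis unfolding inner_square_moment[OF z v]
    using p1 by (intro divide_right_mono) (auto simp: algebra_simps)
qed

text \<open>On the half ball \<open>z \<bullet> h\<close> lies in \<open>{0..1}\<close>, so it
  dominates its own square, whose mean is already known.\<close>

lemma drift_ge:
  fixes z :: "real^'n"
  assumes z: "norm z = 1"
  shows "(p - 1) / (real CARD('n) + p) \<le> drift z"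
proof -
  have "mean p z (\<lambda>h. (z \<bullet> h)^2) \<le> mean p z (\<lambda>h. z \<bullet> h)"
  proof (rule mean_mono_supp[OF p1 p2 z])
    show "tame (\<lambda>h. (z \<bullet> h)^2)" unfolding power2_eq_square by (intro tame_mult) simp_all
    show "(z \<bullet> h)^2 \<le> z \<bullet> h" if "norm h < 1" "0 < z \<bullet> h" for h
      using that norm_cauchy_schwarz[of z h] z by (simp add: power2_eq_square mult_left_le)
  qed simp
  then show ?thesis using inner_square_moment_ge[OF z z] by (simp add: drift_def)
qed

lemma drift_eq:
  fixes z z' :: "real^'n"
  assumes z: "norm z = 1" and z': "norm z' = 1"
  shows "drift z = drift z'"
proof -
  obtain T :: "real^'n \<Rightarrow> real^'n" where T: "orthogonal_transformation T" "T z' = z"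
    by (rule orthogonal_transformation_exists_1[OF z' z])
  have "drift z = mean p z' (\<lambda>h. z \<bullet> T h)"
    using mean_orthogonal[OF p1 p2 T(1) z', of "\<lambda>h. z \<bullet> h"] tame_inner(2)[of z]
    by (simp add: drift_def T(2) tame_def)
  also have "(\<lambda>h. z \<bullet> T h) = (\<lambda>h. z' \<bullet> h)"
    using T by (auto simp: orthogonal_transformation_def)
  finally show ?thesis by (simp add: drift_def)
qed

end

section \<open>The coupling estimate\<close>

text \<open>This is the tangent line at \<open>r^2\<close> of the fourth root, a concave function of
  \<open>\<rho>^2\<close>. Squared distances are polynomial in the steps, hence no norm has to be
  differentiated.\<close>

lemma sqrt_le_first_order:
  fixes r \<rho> :: real
  assumes r: "0 < r" and \<rho>: "0 \<le> \<rho>"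
  shows "sqrt \<rho> \<le> sqrt r * (1 + (\<rho>^2 - r^2) / (4 * r^2))"
proof -
  define x where "x = sqrt (\<rho> / r)"
  have x0: "0 \<le> x" using r \<rho> by (simp add: x_def)
  have x2: "x^2 = \<rho> / r" using r \<rho> by (simp add: x_def)
  have x4: "x ^ 4 = \<rho>^2 / r^2"
    using x2 by (metis power_divide power_mult numeral_Bit0 mult_2)
  have "0 \<le> (x - 1)^2 * (x^2 + 2 * x + 3)" using x0 by simp
  also have "\<dots> = x ^ 4 - 4 * x + 3" by (simp add: power2_eq_square power4_eq_xxxx algebra_simps)
  finally have "x \<le> 1 + (x ^ 4 - 1) / 4" by (simp add: field_simps)
  also have "\<dots> = 1 + (\<rho>^2 - r^2) / (4 * r^2)" using r x4 by (simp add: field_simps)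
  finally have "sqrt r * x \<le> sqrt r * (1 + (\<rho>^2 - r^2) / (4 * r^2))"
    using r by (intro mult_left_mono) auto
  moreover have "sqrt r * x = sqrt \<rho>" using r by (simp add: x_def real_sqrt_mult[symmetric])
  ultimately show ?thesis by simp
qed

text \<open>The fourth root of 1 + t expands as 1 + t/4 - 3 t^2/32 + ...; weakening 3/32 to 1/12
  absorbs the cubic remainder for small \<open>t\<close>.\<close>

lemma fourth_root_le_second_order:
  fixes x t :: real
  assumes x: "0 \<le> x" and xt: "x ^ 4 = 1 + t" and t: "\<bar>t\<bar> \<le> 1/16"
  shows "x \<le> 1 + t / 4 - t^2 / 12"
proof -
  \<comment> \<open>With this \<open>w\<close> the claimed bound is \<open>1 + t * w\<close>, so it
    suffices that its fourth power is at least \<open>1 + t\<close>; the numerals below are crude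
    bounds on \<open>w\<close>.\<close>
  define w where "w = 1/4 - t / 12"
  have w: "244/1000 \<le> w" "w \<le> 256/1000" using t by (auto simp: w_def)
  have w2: "(244/1000)^2 \<le> w^2" using w by (intro power_mono) auto
  have w3: "w ^ 3 \<le> (256/1000) ^ 3" "0 \<le> w ^ 3" using w by (auto intro: power_mono)
  have "\<bar>t\<bar> * w ^ 3 \<le> (1/16) * (256/1000) ^ 3" using t w3 by (intro mult_mono) auto
  then have "- ((1/16) * (256/1000) ^ 3) \<le> t * w ^ 3"
    using mult_right_mono[of "- \<bar>t\<bar>" t "w ^ 3"] w3(2) abs_ge_minus_self[of t] by linarith
  then have pos: "0 \<le> - 1/3 + 6 * w^2 + 4 * (t * w ^ 3)"
    using w2 by (simp add: power2_eq_square power3_eq_cube)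
  have e: "(1 + t * w) ^ 4 - (1 + t) = t^2 * (- 1/3 + 6 * w^2 + 4 * (t * w ^ 3)) + (t * w) ^ 4 + t * (4 * w - 1 + t / 3)"
    by (simp add: power2_eq_square power3_eq_cube power4_eq_xxxx algebra_simps)
  have "4 * w - 1 + t / 3 = 0" by (simp add: w_def field_simps)
  then have e: "(1 + t * w) ^ 4 - (1 + t) = t^2 * (- 1/3 + 6 * w^2 + 4 * (t * w ^ 3)) + (t * w) ^ 4"
    unfolding e by simp
  have "0 \<le> t^2 * (- 1/3 + 6 * w^2 + 4 * (t * w ^ 3))" "0 \<le> (t * w) ^ 4" using pos by simp_all
  then have "0 \<le> (1 + t * w) ^ 4 - (1 + t)" unfolding e by (rule add_nonneg_nonneg)
  then have "(1 + t) \<le> (1 + t * w) ^ 4" by linarith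
  then have "x ^ Suc 3 \<le> (1 + t * w) ^ Suc 3" using xt by simp
  moreover have "\<bar>t * w\<bar> \<le> 1"
    unfolding abs_mult using t w by (intro mult_le_one) auto
  ultimately have "x \<le> 1 + t * w"
    by (intro power_le_imp_le_base[of x 3]) auto
  then show ?thesis by (simp add: w_def power2_eq_square field_simps)
qed

lemma norm_add_scaled_square:
  fixes e v :: "'a::real_inner"
  assumes "norm e = 1" "norm v = 1"
  shows "(norm (r *\<^sub>R e + s *\<^sub>R v))^2 = r^2 + 2 * r * s * (v \<bullet> e) + s^2"
proof -
  have "e \<bullet> e = 1" "v \<bullet> v = 1" using assms by (auto simp: norm_eq_1)
  then show ?thesis unfolding power2_norm_eq_inner
    by (simp add: inner_add_left inner_add_right inner_commute[of e v] power2_eq_square algebra_simps)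
qed

text \<open>The two signs cancel the first order term. At second order, in units of
  \<open>sqrt r\<close>, the length of the displacement contributes growth
  \<open>2 * \<sigma>^2\<close> and concavity a loss
  \<open>(8/3) * \<sigma>^2 * (v \<bullet> e)^2\<close>. The alignment bound 7/8 leaves a net loss
  of at least \<open>\<sigma>^2 / 3\<close>.\<close>

lemma sqrt_symmetric_gain:
  fixes e v :: "'a::real_inner"
  assumes e: "norm e = 1" and v: "norm v = 1" and c: "7/8 \<le> (v \<bullet> e)^2"
    and r: "0 < r" and \<sigma>: "\<bar>\<sigma>\<bar> \<le> 1/100"
  shows "sqrt (norm (r *\<^sub>R e + (2 * r * \<sigma>) *\<^sub>R v)) + sqrt (norm (r *\<^sub>R e - (2 * r * \<sigma>) *\<^sub>R v))
     \<le> 2 * sqrt r * (1 - \<sigma>^2 / 6)"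
proof -
  define c where "c = v \<bullet> e"
  have c1: "\<bar>c\<bar> \<le> 1" using Cauchy_Schwarz_ineq2[of v e] e v by (simp add: c_def)
  have *: "sqrt (norm (r *\<^sub>R e + (2 * r * s) *\<^sub>R v)) \<le> sqrt r * (1 + (s * c + s^2) - (4/3) * (s * c + s^2)^2)"
    if s: "\<bar>s\<bar> \<le> 1/100" for s
  proof -
    define \<rho> where "\<rho> = norm (r *\<^sub>R e + (2 * r * s) *\<^sub>R v)"
    define q where "q = s * c + s^2"
    define t where "t = 4 * q"
    define x where "x = sqrt (\<rho> / r)"
    have \<rho>: "0 \<le> \<rho>" by (simp add: \<rho>_def)
    have \<rho>2: "\<rho>^2 = r^2 * (1 + t)"
      unfolding \<rho>_def norm_add_scaled_square[OF e v] by (simp add: t_def q_def c_def power2_eq_square algebra_simps)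
    have "x^2 = \<rho> / r" using r \<rho> by (simp add: x_def)
    then have "x ^ 4 = \<rho>^2 / r^2" by (metis power_divide power_mult numeral_Bit0 mult_2)
    then have x4: "x ^ 4 = 1 + t" using r by (simp add: \<rho>2)
    have "\<bar>s * c\<bar> \<le> 1/100 * 1" unfolding abs_mult using s c1 by (intro mult_mono) auto
    then have sc: "s * c \<le> 1/100" "- (1/100) \<le> s * c" unfolding abs_le_iff by simp_all
    have "\<bar>s\<bar> * \<bar>s\<bar> \<le> 1/100 * (1/100)" using s by (intro mult_mono) auto
    then have ss: "s^2 \<le> 1/10000" by (simp add: power2_eq_square abs_mult[symmetric])
    have "0 \<le> s^2" by simp
    with sc ss have "s * c + s^2 \<le> 1/64" by linarith
    moreover from sc \<open>0 \<le> s^2\<close> have "- (1/64) \<le> s * c + s^2" by linarith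
    ultimately have "4 * (s * c + s^2) \<le> 1/16" "- (1/16) \<le> 4 * (s * c + s^2)" by auto
    then have "\<bar>t\<bar> \<le> 1/16" unfolding t_def q_def abs_le_iff by linarith
    then have "x \<le> 1 + t / 4 - t^2 / 12"
      using r \<rho> by (intro fourth_root_le_second_order[OF _ x4]) (simp_all add: x_def)
    also have "\<dots> = 1 + q - (4/3) * q^2"
      by (simp add: t_def power_mult_distrib)
    finally have "sqrt r * x \<le> sqrt r * (1 + q - (4/3) * q^2)"
      using r by (intro mult_left_mono) auto
    moreover have "sqrt r * x = sqrt \<rho>" using r by (simp add: x_def real_sqrt_mult[symmetric])
    ultimately show ?thesis unfolding \<rho>_def q_def by simp
  qed
  have 1: "sqrt (norm (r *\<^sub>R e + (2 * r * \<sigma>) *\<^sub>R v)) \<le> sqrt r * (1 + (\<sigma> * c + \<sigma>^2) - (4/3) * (\<sigma> * c + \<sigma>^2)^2)"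
    using *[OF \<sigma>] .
  have 2: "sqrt (norm (r *\<^sub>R e - (2 * r * \<sigma>) *\<^sub>R v)) \<le> sqrt r * (1 + (- \<sigma> * c + \<sigma>^2) - (4/3) * (- \<sigma> * c + \<sigma>^2)^2)"
    using *[of "- \<sigma>"] \<sigma> by simp
  define X where "X = 1 + (\<sigma> * c + \<sigma>^2) - (4/3) * (\<sigma> * c + \<sigma>^2)^2"
  define Y where "Y = 1 + (- \<sigma> * c + \<sigma>^2) - (4/3) * (- \<sigma> * c + \<sigma>^2)^2"
  have "X + Y = 2 + 2 * \<sigma>^2 - (8/3) * (\<sigma>^2 * c^2) - (8/3) * (\<sigma>^2)^2"
    by (simp add: X_def Y_def power2_eq_square algebra_simps)
  also have "\<dots> \<le> 2 * (1 - \<sigma>^2 / 6)"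
  proof -
    have "\<sigma>^2 * (7/8) \<le> \<sigma>^2 * c^2" using c by (intro mult_left_mono) (auto simp: c_def)
    have gen: "2 + 2 * a - (8/3) * b - (8/3) * d \<le> 2 * (1 - a / 6)"
      if "a * (7/8) \<le> b" "0 \<le> d" for a b d :: real
      using that by (simp add: field_simps)
    show ?thesis by (rule gen) (use \<open>\<sigma>^2 * (7/8) \<le> \<sigma>^2 * c^2\<close> in simp_all)
  qed
  finally have "sqrt r * (X + Y) \<le> sqrt r * (2 * (1 - \<sigma>^2 / 6))"
    using r by (intro mult_left_mono) auto
  then show ?thesis using 1 2 unfolding X_def[symmetric] Y_def[symmetric] distrib_left by linarith
qed

section \<open>Almost optimal directions and the equation at a point\<close>

lemma tame_step:
  fixes u :: "real^'n \<Rightarrow> real"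
  assumes "u \<in> borel_measurable borel" and "\<And>x. \<bar>u x\<bar> \<le> M"
  shows "tame (\<lambda>h. u (x + eps *\<^sub>R h))"
proof (rule tameI)
  have "(\<lambda>h. x + eps *\<^sub>R h) \<in> borel \<rightarrow>\<^sub>M borel" by measurable
  then show "(\<lambda>h. u (x + eps *\<^sub>R h)) \<in> borel_measurable borel"
    by (rule measurable_compose[OF _ assms(1)])
qed (rule assms(2))

lemma optimal_directions:
  fixes \<phi> :: "real^'n \<Rightarrow> real"
  assumes p: "1 < p" "p < 2" and t: "tame \<phi>" and b: "\<And>h. norm h < 1 \<Longrightarrow> \<bar>\<phi> h\<bar> \<le> M" and \<eta>: "0 < \<eta>"
  shows "\<exists>z. norm z = 1 \<and> (SUP z\<in>sphere 0 1. mean p z \<phi>) - \<eta> < mean p z \<phi>"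
    and "\<exists>z. norm z = 1 \<and> mean p z \<phi> < (INF z\<in>sphere 0 1. mean p z \<phi>) + \<eta>"
    and "norm w = 1 \<Longrightarrow> mean p w \<phi> \<le> (SUP z\<in>sphere 0 1. mean p z \<phi>)"
    and "norm w = 1 \<Longrightarrow> (INF z\<in>sphere 0 1. mean p z \<phi>) \<le> mean p w \<phi>"
proof -
  have ne: "sphere (0::real^'n) 1 \<noteq> {}" by (simp add: sphere_eq_empty)
  have "mean p z \<phi> \<le> M" "- M \<le> mean p z \<phi>" if "z \<in> sphere 0 1" for z
    using mean_bounded[OF p _ t b, of z] that by (auto simp: abs_le_iff)
  then have above: "bdd_above ((\<lambda>z. mean p z \<phi>) ` sphere 0 1)" and below: "bdd_below ((\<lambda>z. mean p z \<phi>) ` sphere 0 1)"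
    by (auto intro: bdd_aboveI2[of _ _ M] bdd_belowI2[of _ "- M"])
  show "\<exists>z. norm z = 1 \<and> (SUP z\<in>sphere 0 1. mean p z \<phi>) - \<eta> < mean p z \<phi>"
    using less_cSUP_iff[OF ne above, of "(SUP z\<in>sphere 0 1. mean p z \<phi>) - \<eta>"] \<eta> by auto
  show "\<exists>z. norm z = 1 \<and> mean p z \<phi> < (INF z\<in>sphere 0 1. mean p z \<phi>) + \<eta>"
    using cINF_less_iff[OF ne below, of "(INF z\<in>sphere 0 1. mean p z \<phi>) + \<eta>"] \<eta> by auto
  show "norm w = 1 \<Longrightarrow> mean p w \<phi> \<le> (SUP z\<in>sphere 0 1. mean p z \<phi>)" by (intro cSUP_upper above) simp
  show "norm w = 1 \<Longrightarrow> (INF z\<in>sphere 0 1. mean p z \<phi>) \<le> mean p w \<phi>" by (intro cINF_lower below) simp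
qed

text \<open>Pointwise and for a function on the whole space, so that it fits zero extensions and can
  be required on a small ball alone.\<close>

definition dpp_at :: "real \<Rightarrow> real \<Rightarrow> (real^'n \<Rightarrow> real) \<Rightarrow> (real^'n \<Rightarrow> real) \<Rightarrow> real^'n \<Rightarrow> bool" where
  "dpp_at p eps f u x \<longleftrightarrow> u x = 1/2 * ((SUP z\<in>sphere 0 1. mean p z (\<lambda>h. u (x + eps *\<^sub>R h))) +
     (INF z\<in>sphere 0 1. mean p z (\<lambda>h. u (x + eps *\<^sub>R h)))) + eps^2 * f x"

text \<open>The equation is required only in a ball, but measurability and the bound hold
  everywhere, since the comparison takes a supremum over all pairs of points.\<close>

locale dpp_ball =
  fixes p eps R M Mf :: real and u f :: "real^'n \<Rightarrow> real" and x0 :: "real^'n"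
  assumes p1: "1 < p" and p2: "p < 2"
    and R: "0 < R" "R \<le> 1" and eps: "0 < eps" "eps < 1"
    and u_measurable: "u \<in> borel_measurable borel"
    and u_bound: "\<And>x. \<bar>u x\<bar> \<le> M"
    and f_bound: "\<And>x. x \<in> ball x0 R \<Longrightarrow> \<bar>f x\<bar> \<le> Mf"
    and dpp: "\<And>x. x \<in> ball x0 R \<Longrightarrow> dpp_at p eps f u x"
begin

abbreviation step :: "real^'n \<Rightarrow> real^'n \<Rightarrow> real^'n" where
  "step a h \<equiv> a + eps *\<^sub>R h"

definition U :: "real^'n \<Rightarrow> real^'n \<Rightarrow> real" where
  "U x z = mean p z (\<lambda>h. u (step x h))"

lemma tame_u: "tame (\<lambda>h. u (step x h))"
  by (rule tame_step[OF u_measurable u_bound])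

text \<open>The supremum at \<open>x\<close> and the infimum at \<open>y\<close> are realized up to
  \<open>\<eta>\<close> by \<open>z1\<close> and \<open>z2\<close>. The infimum at \<open>x\<close>
  and the supremum at \<open>y\<close> enter with the favourable sign, so any \<open>w1\<close> and
  \<open>w2\<close> may be inserted; these are the answers.\<close>

lemma direction_choice:
  assumes x: "x \<in> ball x0 R" and y: "y \<in> ball x0 R" and \<eta>: "0 < \<eta>"
  obtains z1 z2 where "norm z1 = 1" "norm z2 = 1"
    "\<And>w1 w2. norm w1 = 1 \<Longrightarrow> norm w2 = 1 \<Longrightarrow>
      u x - u y \<le> 1/2 * (U x z1 - U y z2) + 1/2 * (U x w1 - U y w2) + eps^2 * (f x - f y) + \<eta>"
proof -
  note opt = optimal_directions[OF p1 p2 tame_u u_bound \<eta>, folded U_def]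
  obtain z1 where z1: "norm z1 = 1" "(SUP z\<in>sphere 0 1. U x z) - \<eta> < U x z1" using opt(1)[of x] by blast
  obtain z2 where z2: "norm z2 = 1" "U y z2 < (INF z\<in>sphere 0 1. U y z) + \<eta>" using opt(2)[of y] by blast
  show ?thesis
  proof (rule that[OF z1(1) z2(1)])
    fix w1 w2 :: "real^'n"
    assume w: "norm w1 = 1" "norm w2 = 1"
    show "u x - u y \<le> 1/2 * (U x z1 - U y z2) + 1/2 * (U x w1 - U y w2) + eps^2 * (f x - f y) + \<eta>"
      using dpp[OF x] dpp[OF y] z1(2) z2(2) opt(3)[OF w(2), of y] opt(4)[OF w(1), of x]
      unfolding dpp_at_def U_def[symmetric] by (simp add: algebra_simps)
  qed
qed

end

section \<open>The comparison function and its constants\<close>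

lemma continuous_on_orthogonal:
  fixes T :: "real^'n \<Rightarrow> real^'n"
  assumes "orthogonal_transformation T"
  shows "continuous_on S (\<lambda>h. T h)"
  using assms orthogonal_transformation_linear linear_conv_bounded_linear linear_continuous_on by blast

text \<open>\<open>\<kappa>\<close> bounds both the drift and the second moments from below;
  \<open>\<beta>\<close> is the probability guaranteed to a ball of radius 1/8 inside the half ball.
  \<open>G\<close> collects the errors: \<open>6 * K\<close> from localization,
  \<open>2 * Mf\<close> from \<open>f\<close>, and 2 from the two approximate choices. The constants
  are fixed in the order \<open>K\<close>, \<open>G\<close>, \<open>C\<close>,
  \<open>\<Lambda>\<close> and \<open>lam\<close>, \<open>A\<close>, \<open>J\<close>; the last two
  pay at smaller distances for what the earlier ones cost there.\<close>

locale dpp_comparison = dpp_ball p eps R M Mf u f x0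
  for p eps R M Mf :: real and u f :: "real^'n \<Rightarrow> real" and x0 :: "real^'n" +
  fixes m0 c1 \<kappa> \<beta> C A J K lam \<Lambda> G :: real
  assumes \<kappa>_def: "\<kappa> = (p - 1) / (real CARD('n) + p)"
    and \<beta>_def: "\<beta> = measure lborel (ball (0::real^'n) (1/8)) / m0"
    and mass_m0: "\<And>z::real^'n. norm z = 1 \<Longrightarrow> mass p z = m0"
    and drift_c1: "\<And>z::real^'n. norm z = 1 \<Longrightarrow> drift p z = c1"
    and nonneg: "0 \<le> C" "0 \<le> A" "0 \<le> J" "0 \<le> K" "0 \<le> lam" "0 \<le> Mf"
    and G_def: "G = 6 * K + 2 * Mf + 2"
    and K_large: "2 * M \<le> K * R^2"
    and C_large: "256 * G \<le> C * \<kappa>"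
    and Lambda_large: "100 \<le> \<Lambda>" "128 \<le> \<kappa> * \<Lambda>"
    and lam_large: "4 \<le> \<beta> * exp (lam / 4)"
    and A_large: "3 * C + G \<le> A * exp (- lam * \<Lambda>)"
    and J_large: "2 * (2 * C + A + G) \<le> \<beta> * J"
begin

text \<open>The square root works at distances above \<open>\<Lambda> * eps\<close>, the exponential at distances comparable to
  \<open>eps\<close> (each step approaching by \<open>eps / 4\<close> multiplies it by the large factor \<open>exp (lam / 4)\<close>), and the
  jump \<open>J * sqrt eps\<close> pays for distances below \<open>eps / 2\<close>, where the two steps land at the same point with
  positive probability. The last term localizes to the ball.\<close>

definition \<Psi> :: "real^'n \<Rightarrow> real^'n \<Rightarrow> real" where
  "\<Psi> x y = J * sqrt eps + C * sqrt (norm (x - y)) + A * sqrt eps * (1 - exp (- lam * norm (x - y) / eps))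
     + K * ((norm (x - x0))^2 + (norm (y - x0))^2)"

lemma \<Psi>_ge: "J * sqrt eps + K * ((norm (x - x0))^2 + (norm (y - x0))^2) \<le> \<Psi> x y"
proof -
  have "0 \<le> lam * norm (x - y) / eps" using nonneg eps by simp
  then have "0 \<le> A * sqrt eps * (1 - exp (- lam * norm (x - y) / eps))" "0 \<le> C * sqrt (norm (x - y))"
    using nonneg eps by simp_all
  then show ?thesis unfolding \<Psi>_def by linarith
qed

lemma exp_gain:
  assumes "m \<le> r - eps / 4"
  shows "exp (lam / 4) * exp (- lam * r / eps) \<le> exp (- lam * m / eps)"
proof -
  have "lam * m \<le> lam * (r - eps / 4)" using assms nonneg by (intro mult_left_mono) auto
  then have "lam * m / eps \<le> lam * (r - eps / 4) / eps" using eps by (intro divide_right_mono) auto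
  also have "\<dots> = lam * r / eps - lam / 4" using eps by (simp add: field_simps)
  finally show ?thesis unfolding exp_add[symmetric] by simp
qed

lemma \<kappa>_pos: "0 < \<kappa>"
  using p1 by (simp add: \<kappa>_def)

lemma c1_ge: "\<kappa> \<le> c1"
proof -
  fix k :: 'n
  show ?thesis using drift_ge[OF p1 p2, of "axis k 1"] drift_c1[of "axis k 1"] by (simp add: \<kappa>_def)
qed

lemma moment:
  fixes z a :: "real^'n"
  assumes z: "norm z = 1"
  shows "mean p z (\<lambda>h. a \<bullet> h) = c1 * (z \<bullet> a)"
proof -
  have "mean p z (\<lambda>h. a \<bullet> h) = mean p z (\<lambda>h. h \<bullet> a)"
    by (rule mean_cong[OF p1 p2]) (rule inner_commute)
  also have "\<dots> = drift p z * (z \<bullet> a)"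
    unfolding drift_def[OF p1 p2] by (rule first_moment_tilt[OF p1 p2 z])
  finally show ?thesis by (simp only: drift_c1[OF z])
qed

lemma m0_pos: "0 < m0"
proof -
  fix k :: 'n
  show ?thesis using mass_pos[OF p1 p2, of "axis k 1"] mass_m0[of "axis k 1"] by simp
qed

lemma measure_ball_eighth: "measure lborel (ball (c::real^'n) (1/8)) = \<beta> * m0"
  using m0_pos by (simp add: \<beta>_def content_ball)

lemma G_pos: "2 \<le> G" using nonneg by (simp add: G_def)

lemma sqrt_eps: "eps \<le> sqrt eps" "eps^2 \<le> eps" "0 < sqrt eps"
proof -
  show "eps^2 \<le> eps" using eps by (simp add: power2_eq_square mult_left_le)
  then show "eps \<le> sqrt eps" by (rule real_le_rsqrt)
qed (use eps in simp)

text \<open>A lower bound on one small ball in the half ball survives averaging up to the factor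
  \<open>\<beta>\<close>, whatever the direction.\<close>

lemma mean_lower:
  assumes z: "norm z = 1" and t: "tame \<psi>" and nn: "\<And>h. norm h < 1 \<Longrightarrow> 0 \<le> \<psi> h"
    and c: "norm (c::real^'n) \<le> 7/8" "1/8 \<le> z \<bullet> c"
    and m: "0 \<le> m" "\<And>h. norm h < 1 \<Longrightarrow> norm (h - c) < 1/8 \<Longrightarrow> m \<le> \<psi> h"
  shows "\<beta> * m \<le> mean p z \<psi>"
proof -
  have ti: "tame (\<lambda>h. m * indicator (ball c (1/8)) h)"
    by (intro tame_cmult tameI[of _ 1] borel_measurable_indicator) (auto simp: indicator_def)
  have "ball_integral c (\<lambda>h. m * indicator (ball c (1/8)) h)
      = (\<integral>h. m * indicator (ball c (1/8)) h \<partial>lborel)"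
    by (rule Bochner_Integration.integral_cong) (auto simp: indicator_def)
  also have "\<dots> = m * measure lborel (ball c (1/8))" by simp
  also have "\<dots> = m * \<beta> * m0" by (simp add: measure_ball_eighth)
  finally have "ball_integral c (\<lambda>h. m * indicator (ball c (1/8)) h) / mass p z = \<beta> * m"
    using m0_pos mass_m0[OF z] by simp
  moreover have "\<dots> \<le> mean p z (\<lambda>h. m * indicator (ball c (1/8)) h)"
    using mean_ge_ball[OF p1 p2 z ti _ c] m(1) calculation by simp
  moreover have "\<dots> \<le> mean p z \<psi>"
    using m(2) nn by (intro mean_mono[OF p1 p2 z ti t])
      (auto simp: indicator_def dist_norm norm_minus_commute)
  ultimately show ?thesis by simp
qed

lemma \<beta>_bounds: "0 < \<beta>" "\<beta> \<le> 1"
proof -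
  show "0 < \<beta>" using m0_pos content_ball_pos[of "1/8" "0::real^'n"] by (simp add: \<beta>_def)
  fix k :: 'n
  have "\<beta> * 1 \<le> mean p (axis k 1 :: real^'n) (\<lambda>h. 1)"
    by (rule mean_lower[of _ _ "(1/2) *\<^sub>R axis k 1"]) (auto simp: inner_axis_axis)
  then show "\<beta> \<le> 1" using mean_const[OF p1 p2, of "axis k (1::real)" 1] by simp
qed

lemma tame_\<Psi>:
  assumes T: "orthogonal_transformation T"
  shows "tame (\<lambda>h. \<Psi> (step x h) (step y (T h)))"
  unfolding \<Psi>_def using eps
  by (intro tame_continuous continuous_intros continuous_on_orthogonal[OF T]) auto

text \<open>If \<open>h\<close> follows the weight of \<open>z\<close>, then \<open>T h\<close>
  follows that of \<open>T z\<close>. Hence every orthogonal map taking one direction to the other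
  couples the two random steps, and the freedom in choosing \<open>T\<close> is what is exploited
  below.\<close>

lemma U_orthogonal:
  assumes T: "orthogonal_transformation T" and z: "norm z = 1"
  shows "U x z - U y (T z) = mean p z (\<lambda>h. u (step x h) - u (step y (T h)))"
proof -
  have "U y (T z) = mean p z (\<lambda>h. u (step y (T h)))"
    unfolding U_def using tame_u[of y] by (intro mean_orthogonal[OF p1 p2 T z]) (simp add: tame_def)
  then show ?thesis
    unfolding U_def by (simp add: mean_diff[OF p1 p2 z tame_u tame_orthogonal[OF tame_u T]])
qed

lemma coupling:
  assumes T: "orthogonal_transformation T" and z: "norm z = 1"
    and le: "\<And>x y. u x - u y \<le> \<theta> + \<Psi> x y"
  shows "U x z - U y (T z) \<le> \<theta> + mean p z (\<lambda>h. \<Psi> (step x h) (step y (T h)))"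
proof -
  have "U x z - U y (T z) \<le> mean p z (\<lambda>h. \<theta> + \<Psi> (step x h) (step y (T h)))"
    unfolding U_orthogonal[OF T z]
    by (intro mean_mono[OF p1 p2 z] tame_diff tame_u tame_orthogonal[OF tame_u T] tame_add tame_\<Psi>[OF T] le tame_const)
  also have "\<dots> = \<theta> + mean p z (\<lambda>h. \<Psi> (step x h) (step y (T h)))"
    using mean_add[OF p1 p2 z tame_const tame_\<Psi>[OF T]] mean_const[OF p1 p2 z] by simp
  finally show ?thesis .
qed

end

text \<open>A pair of points at which \<open>u x - u y - \<Psi> x y\<close> is, up to \<open>eps^2\<close>, maximal and positive: the
  configuration to be excluded.\<close>

locale dpp_max = dpp_comparison p eps R M Mf u f x0 m0 c1 \<kappa> \<beta> C A J K lam \<Lambda> G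
  for p eps R M Mf :: real and u f :: "real^'n \<Rightarrow> real" and x0 :: "real^'n"
    and m0 c1 \<kappa> \<beta> C A J K lam \<Lambda> G :: real +
  fixes x y z1 z2 e :: "real^'n" and r \<theta> :: real
  assumes x: "x \<in> ball x0 R" and y: "y \<in> ball x0 R"
    and le: "\<And>x y. u x - u y \<le> \<theta> + \<Psi> x y"
    and near: "\<theta> - eps^2 < u x - u y - \<Psi> x y"
    and theta: "0 < \<theta>"
    and z: "norm z1 = 1" "norm z2 = 1"
    and choice: "\<And>w1 w2. norm w1 = 1 \<Longrightarrow> norm w2 = 1 \<Longrightarrow>
      u x - u y \<le> 1/2 * (U x z1 - U y z2) + 1/2 * (U x w1 - U y w2) + eps^2 * (f x - f y) + eps^2"
    and e: "norm e = 1" and xy: "x - y = r *\<^sub>R e" and r: "0 < r" "r \<le> 2"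
begin

section \<open>Estimates at an almost maximal pair, and the answer that brings the points
  together\<close>

abbreviation coupled_\<Psi> :: "(real^'n \<Rightarrow> real^'n) \<Rightarrow> real^'n \<Rightarrow> real" where
  "coupled_\<Psi> T h \<equiv> \<Psi> (step x h) (step y (T h))"

abbreviation separation :: "(real^'n \<Rightarrow> real^'n) \<Rightarrow> real^'n \<Rightarrow> real" where
  "separation T h \<equiv> norm (step x h - step y (T h))"

lemma f_diff: "eps^2 * (f x - f y) + 2 * eps^2 \<le> (2 * Mf + 2) * eps^2"
proof -
  have "f x - f y \<le> 2 * Mf" using f_bound[OF x] f_bound[OF y] by (simp add: abs_le_iff)
  then have "eps^2 * (f x - f y) \<le> eps^2 * (2 * Mf)" by (intro mult_left_mono) auto
  then show ?thesis by (simp add: algebra_simps)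
qed

lemma r_eq: "norm (x - y) = r" using e r by (simp add: xy)

text \<open>The adversary's half and the answer's half are both bounded through the same
  \<open>\<theta>\<close>, which cancels against near maximality. What remains says that
  \<open>\<Psi>\<close> does not decrease on average by more than the stated error.\<close>

lemma coupled:
  assumes T1: "orthogonal_transformation T1" "T1 z1 = z2"
    and T2: "orthogonal_transformation T2" and w: "norm w = 1"
  shows "\<Psi> x y < 1/2 * mean p z1 (coupled_\<Psi> T1)
    + 1/2 * mean p w (coupled_\<Psi> T2) + (2 * Mf + 2) * eps^2"
proof -
  have "norm (T2 w) = 1" using T2 w by (simp add: orthogonal_transformation_norm)
  note c0 = choice[OF w this]
  have c1: "U x z1 - U y z2 \<le> \<theta> + mean p z1 (coupled_\<Psi> T1)"
    using coupling[OF T1(1) z(1) le, of x y] unfolding T1(2) .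
  have "\<psi> < 1/2 * m1 + 1/2 * m2 + X"
    if "d \<le> 1/2 * P + 1/2 * Q + D + q" "P \<le> \<theta> + m1" "Q \<le> \<theta> + m2" "\<theta> - q < d - \<psi>" "D + 2 * q \<le> X"
    for \<psi> m1 m2 X d P Q D q :: real
    using that by linarith
  from this[OF c0 c1 coupling[OF T2 w le] near f_diff] show ?thesis .
qed

text \<open>The linear term makes this of order \<open>eps\<close> only.
  \<open>choice_mirror\<close> pairs \<open>h\<close> with \<open>- h\<close> to remove that
  term.\<close>

lemma localization_le:
  assumes "norm h < 1" and "a \<in> ball x0 R"
  shows "(norm (step a h - x0))^2 \<le> (norm (a - x0))^2 + 3 * eps"
proof -
  have d: "norm (a - x0) < 1" using assms(2) R by (simp add: dist_norm norm_minus_commute)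
  have "norm (step a h - x0) \<le> norm (a - x0) + norm (eps *\<^sub>R h)"
    by (metis add_diff_eq add.commute norm_triangle_ineq)
  also have "\<dots> \<le> norm (a - x0) + eps" using assms(1) eps by simp
  finally have "(norm (step a h - x0))^2 \<le> (norm (a - x0) + eps)^2" by (intro power_mono) auto
  also have "\<dots> = (norm (a - x0))^2 + 2 * eps * norm (a - x0) + eps^2"
    by (simp add: power2_eq_square algebra_simps)
  also have "\<dots> \<le> (norm (a - x0))^2 + 2 * eps * 1 + eps"
    using d eps sqrt_eps(2) by (intro add_mono mult_left_mono) auto
  finally show ?thesis by simp
qed

lemma local_part:
  assumes "norm h < 1" "norm k < 1"
  shows "K * ((norm (step x h - x0))^2 + (norm (step y k - x0))^2)
    \<le> K * ((norm (x - x0))^2 + (norm (y - x0))^2) + 6 * K * eps"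
proof -
  have "K * ((norm (step x h - x0))^2 + (norm (step y k - x0))^2)
      \<le> K * (((norm (x - x0))^2 + 3 * eps) + ((norm (y - x0))^2 + 3 * eps))"
    using assms x y nonneg by (intro mult_left_mono add_mono localization_le) auto
  then show ?thesis by (simp add: algebra_simps)
qed

text \<open>\<open>e \<bullet> h - e \<bullet> k\<close> is the first order change of the distance
  in units of \<open>eps\<close>, kept exact because its mean is the drift; the quadratic part is
  bounded crudely through \<open>norm (h - k) \<le> 2\<close>.\<close>

lemma sqrt_part:
  assumes "norm h < 1" "norm k < 1"
  shows "C * sqrt (norm (step x h - step y k))
    \<le> C * sqrt r * (1 + eps^2 / r^2) + C * sqrt r * (eps / (2 * r)) * (e \<bullet> h - e \<bullet> k)"
proof -
  define \<rho> where "\<rho> = norm (step x h - step y k)"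
  have "step x h - step y k = r *\<^sub>R e + eps *\<^sub>R (h - k)"
    using xy by (simp add: algebra_simps)
  then have "\<rho>^2 = r^2 + 2 * r * eps * (e \<bullet> (h - k)) + eps^2 * (norm (h - k))^2"
    using e unfolding \<rho>_def power2_norm_eq_inner
    by (simp add: norm_eq_1 inner_add_left inner_add_right inner_diff_left inner_diff_right inner_commute[of h e] inner_commute[of k e] power2_eq_square algebra_simps)
  moreover have "norm (h - k) \<le> 2" using norm_triangle_ineq4[of h k] assms by linarith
  then have "(norm (h - k))^2 \<le> 2^2" by (intro power_mono) auto
  then have "eps^2 * (norm (h - k))^2 \<le> eps^2 * 4" by (intro mult_left_mono) auto
  ultimately have "(\<rho>^2 - r^2) / (4 * r^2) \<le> (2 * r * eps * (e \<bullet> (h - k)) + eps^2 * 4) / (4 * r^2)"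
    by (intro divide_right_mono) auto
  also have "\<dots> = (eps / (2 * r)) * (e \<bullet> h - e \<bullet> k) + eps^2 / r^2"
    using r by (simp add: field_simps power2_eq_square inner_diff_right)
  finally have "sqrt r * (1 + (\<rho>^2 - r^2) / (4 * r^2)) \<le> sqrt r * (1 + ((eps / (2 * r)) * (e \<bullet> h - e \<bullet> k) + eps^2 / r^2))"
    using r by (intro mult_left_mono) auto
  with sqrt_le_first_order[OF r(1), of \<rho>]
  have "sqrt \<rho> \<le> sqrt r * (1 + ((eps / (2 * r)) * (e \<bullet> h - e \<bullet> k) + eps^2 / r^2))"
    by (simp add: \<rho>_def)
  then have "C * sqrt \<rho> \<le> C * (sqrt r * (1 + ((eps / (2 * r)) * (e \<bullet> h - e \<bullet> k) + eps^2 / r^2)))"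
    using nonneg by (intro mult_left_mono) auto
  then show ?thesis by (simp add: \<rho>_def algebra_simps)
qed

text \<open>The adversary's half is coupled by any orthogonal map taking \<open>z1\<close> to
  \<open>z2\<close>, ignoring the exponential; the answer \<open>- e\<close> at \<open>x\<close> and
  \<open>e\<close> at \<open>y\<close> is coupled by the reflection along \<open>e\<close>, which
  confines the change of \<open>x - y\<close> to that direction. The sum of the two brackets with
  \<open>z1\<close> and \<open>z2\<close> measures how far the adversary is from compensating this
  drift.\<close>

lemma choice_towards:
  assumes re: "eps / 2 \<le> r"
  shows "A * sqrt eps * exp (- lam * r / eps)
      + C * sqrt r * (eps * c1 * ((1 - z1 \<bullet> e) + (1 + z2 \<bullet> e)) / (4 * r) - eps^2 / r^2) < G * eps"
proof -
  \<comment> \<open>\<open>a\<close> is \<open>\<Psi> x y\<close> without its exponential part, plus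
    the worst errors; \<open>b\<close> is the slope of the square root term per unit of displacement
    along \<open>e\<close>.\<close>
  define a where "a = J * sqrt eps + C * sqrt r * (1 + eps^2 / r^2) + A * sqrt eps
    + K * ((norm (x - x0))^2 + (norm (y - x0))^2) + 6 * K * eps"
  define b where "b = C * sqrt r * (eps / (2 * r))"
  obtain T1 :: "real^'n \<Rightarrow> real^'n" where T1: "orthogonal_transformation T1" "T1 z1 = z2"
    by (rule orthogonal_transformation_exists_1[OF z])
  define T2 :: "real^'n \<Rightarrow> real^'n" where "T2 = reflection e"
  have T2: "orthogonal_transformation T2"
    unfolding T2_def using e by (rule orthogonal_transformation_reflection)
  have ee: "e \<bullet> e = 1" using e by (simp add: norm_eq_1)
  have e': "norm (- e) = 1" using e by simp
  define E where "E h = exp (- lam * separation T2 h / eps)" for h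
  have tE: "tame E" unfolding E_def using eps
    by (intro tame_continuous continuous_intros continuous_on_orthogonal[OF T2]) auto
  have t1: "tame (\<lambda>h. e \<bullet> h - e \<bullet> T1 h)"
    by (intro tame_diff tame_orthogonal[OF _ T1(1)] tame_inner)
  have "mean p z1 (coupled_\<Psi> T1) \<le> mean p z1 (\<lambda>h. a + b * (e \<bullet> h - e \<bullet> T1 h))"
  proof (intro mean_mono[OF p1 p2 z(1) tame_\<Psi>[OF T1(1)]] tame_add tame_const tame_cmult t1)
    fix h :: "real^'n" assume h: "norm h < 1"
    then have k: "norm (T1 h) < 1" using orthogonal_transformation_norm[OF T1(1)] by simp
    have "A * sqrt eps * (1 - exp (- lam * separation T1 h / eps)) \<le> A * sqrt eps * 1"
      using nonneg eps by (intro mult_left_mono) auto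
    with sqrt_part[OF h k] local_part[OF h k]
    show "coupled_\<Psi> T1 h \<le> a + b * (e \<bullet> h - e \<bullet> T1 h)"
      unfolding \<Psi>_def a_def b_def by linarith
  qed
  also have "\<dots> = a + b * (mean p z1 (\<lambda>h. e \<bullet> h) - mean p z1 (\<lambda>h. e \<bullet> T1 h))"
    using z t1 by (simp add: mean_add[OF p1 p2] mean_cmult[OF p1 p2] tame_cmult mean_const[OF p1 p2]
        mean_diff[OF p1 p2] tame_orthogonal[OF _ T1(1), of "\<lambda>h. e \<bullet> h"])
  also have "mean p z1 (\<lambda>h. e \<bullet> h) = c1 * (z1 \<bullet> e)" by (rule moment[OF z(1)])
  also have "mean p z1 (\<lambda>h. e \<bullet> T1 h) = mean p z2 (\<lambda>h. e \<bullet> h)"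
    using mean_orthogonal[OF p1 p2 T1(1) z(1), of "\<lambda>h. e \<bullet> h"] tame_inner(2)[of e] by (simp add: T1(2) tame_def)
  also have "\<dots> = c1 * (z2 \<bullet> e)" by (rule moment[OF z(2)])
  finally have 1: "mean p z1 (coupled_\<Psi> T1) \<le> a + b * (c1 * (z1 \<bullet> e) - c1 * (z2 \<bullet> e))" .
  have "mean p (- e) (coupled_\<Psi> T2)
      \<le> mean p (- e) (\<lambda>h. a + (2 * b) * (e \<bullet> h) - (A * sqrt eps) * E h)"
  proof (intro mean_mono[OF p1 p2 e' tame_\<Psi>[OF T2]] tame_diff tame_add tame_const tame_cmult tE tame_inner)
    fix h :: "real^'n" assume h: "norm h < 1"
    then have k: "norm (T2 h) < 1" using orthogonal_transformation_norm[OF T2] by simp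
    have "e \<bullet> T2 h = - (e \<bullet> h)" by (simp add: T2_def reflection_def inner_diff_right ee)
    then have "b * (e \<bullet> h - e \<bullet> T2 h) = (2 * b) * (e \<bullet> h)" by simp
    with sqrt_part[OF h k] local_part[OF h k]
    show "coupled_\<Psi> T2 h \<le> a + (2 * b) * (e \<bullet> h) - (A * sqrt eps) * E h"
      unfolding \<Psi>_def a_def b_def E_def right_diff_distrib mult_1_right by linarith
  qed
  also have "\<dots> = a + (2 * b) * mean p (- e) (\<lambda>h. e \<bullet> h) - (A * sqrt eps) * mean p (- e) E"
    using e' by (simp add: mean_diff[OF p1 p2] mean_add[OF p1 p2] mean_cmult[OF p1 p2] tame_cmult
        tame_add tE mean_const[OF p1 p2] del: norm_minus_cancel)
  also have "mean p (- e) (\<lambda>h. e \<bullet> h) = - c1"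
    using moment[OF e', of e] by (simp add: ee)
  finally have 2: "mean p (- e) (coupled_\<Psi> T2)
      \<le> a + (2 * b) * (- c1) - (A * sqrt eps) * mean p (- e) E" .
  define E0 where "E0 = exp (- lam * r / eps)"
  \<comment> \<open>For steps near \<open>- ((1/4) *\<^sub>R e)\<close> the distance drops by at
    least \<open>eps / 4\<close>. The factor 4 gained from \<open>lam_large\<close> is halved by the
    averaging and still leaves one \<open>E0\<close> over.\<close>
  have "\<beta> * (exp (lam / 4) * E0) \<le> mean p (- e) E"
  proof (rule mean_lower[OF e' tE, of "- ((1/4) *\<^sub>R e)"])
    show "0 \<le> E h" for h by (simp add: E_def)
    show "norm (- ((1/4) *\<^sub>R e)) \<le> 7/8" using e by simp
    show "1/8 \<le> - e \<bullet> - ((1/4) *\<^sub>R e)" using ee by simp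
    show "0 \<le> exp (lam / 4) * E0" by (simp add: E0_def)
    fix h :: "real^'n" assume h: "norm h < 1" "norm (h - - ((1/4) *\<^sub>R e)) < 1/8"
    define s where "s = e \<bullet> h"
    have "\<bar>e \<bullet> (h + (1/4) *\<^sub>R e)\<bar> < 1/8" using Cauchy_Schwarz_ineq2[of e "h + (1/4) *\<^sub>R e"] e h(2) by simp
    then have "\<bar>s + 1/4\<bar> < 1/8" by (simp add: s_def inner_add_right ee)
    then have s: "- 3/8 < s" "s < - 1/8" unfolding abs_less_iff by linarith+
    have "step x h - step y (T2 h) = (r + 2 * eps * s) *\<^sub>R e"
      using xy by (simp add: T2_def reflection_def s_def algebra_simps)
    then have n: "separation T2 h = \<bar>r + 2 * eps * s\<bar>" using e by simp
    have "eps * s \<le> eps * (- 1/8)" "eps * (- 3/8) \<le> eps * s" using s eps by (intro mult_left_mono; simp)+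
    \<comment> \<open>The points may cross each other; \<open>eps / 2 \<le> r\<close> is what keeps
      the new distance below \<open>r - eps / 4\<close> in that case.\<close>
    then have "\<bar>r + 2 * eps * s\<bar> \<le> r - eps / 4" using re unfolding abs_le_iff by (auto simp: algebra_simps)
    then show "exp (lam / 4) * E0 \<le> E h" unfolding E_def E0_def n by (rule exp_gain)
  qed
  moreover have "4 * E0 \<le> (\<beta> * exp (lam / 4)) * E0"
    using lam_large by (intro mult_right_mono) (auto simp: E0_def)
  ultimately have "4 * E0 \<le> mean p (- e) E" by (simp add: mult.assoc)
  then have "(A * sqrt eps) * (4 * E0) \<le> (A * sqrt eps) * mean p (- e) E"
    using nonneg eps by (intro mult_left_mono) auto
  moreover have "b * c1 / 2 * (z1 \<bullet> e - z2 \<bullet> e - 2)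
      = 1/2 * (b * (c1 * (z1 \<bullet> e) - c1 * (z2 \<bullet> e))) + 1/2 * ((2 * b) * (- c1))"
    by (simp add: field_simps)
  moreover have "(A * sqrt eps) * (4 * E0) = 4 * (A * sqrt eps * E0)" by simp
  ultimately have "\<Psi> x y < a + b * c1 / 2 * (z1 \<bullet> e - z2 \<bullet> e - 2) - 2 * (A * sqrt eps * E0) + (2 * Mf + 2) * eps^2"
    using 1 2 coupled[OF T1 T2 e'] by linarith
  moreover have "\<Psi> x y = a - C * sqrt r * (eps^2 / r^2) - A * sqrt eps * E0 - 6 * K * eps"
    unfolding \<Psi>_def a_def r_eq E0_def by (simp add: algebra_simps)
  moreover have "(2 * Mf + 2) * eps^2 \<le> (2 * Mf + 2) * eps"
    using nonneg sqrt_eps(2) by (intro mult_left_mono) auto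
  moreover have "b * c1 / 2 * (z1 \<bullet> e - z2 \<bullet> e - 2)
      = - (C * sqrt r * (eps * c1 * ((1 - z1 \<bullet> e) + (1 + z2 \<bullet> e)) / (4 * r)))"
    using r by (simp add: b_def field_simps)
  ultimately have "A * sqrt eps * E0 + C * sqrt r * (eps * c1 * ((1 - z1 \<bullet> e) + (1 + z2 \<bullet> e)) / (4 * r))
      - C * sqrt r * (eps^2 / r^2) < G * eps"
    unfolding G_def distrib_right by linarith
  then show ?thesis unfolding E0_def right_diff_distrib by simp
qed

end

section \<open>The drift-free answer and the reflection coupling\<close>

lemma integral_lborel_translate:
  fixes f :: "'a::euclidean_space \<Rightarrow> real"
  assumes "f \<in> borel_measurable borel"
  shows "(\<integral>h. f (c + h) \<partial>lborel) = (\<integral>h. f h \<partial>lborel)"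
  using integral_distr[of "(+) c" lborel borel f] assms by (simp add: lborel_distr_plus)

lemma integrable_indicator_ball_mult:
  fixes g :: "'a::euclidean_space \<Rightarrow> real"
  assumes g: "g \<in> borel_measurable borel" and B: "\<And>h. \<bar>g h\<bar> \<le> B"
  shows "integrable lborel (\<lambda>h. indicator (ball c \<rho>) h * g h)"
proof (rule Bochner_Integration.integrable_bound)
  show "integrable lborel (\<lambda>h. B * indicat_real (ball c \<rho>) h)"
    by (intro integrable_mult_right integrable_real_indicator emeasure_lborel_ball_finite) simp
  show "(\<lambda>h. indicator (ball c \<rho>) h * g h) \<in> borel_measurable lborel"
    using g by (intro borel_measurable_times borel_measurable_indicator) auto
  have "\<bar>indicator (ball c \<rho>) h * g h\<bar> \<le> \<bar>B * indicat_real (ball c \<rho>) h\<bar>" for h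
    using B[of h] by (auto simp: indicator_def)
  then show "AE h in lborel. norm (indicator (ball c \<rho>) h * g h) \<le> norm (B * indicat_real (ball c \<rho>) h)"
    by simp
qed

lemma norm_parallelogram_le:
  fixes a h :: "'a::real_inner"
  assumes "norm h < 1"
  shows "(norm (a + eps *\<^sub>R h))^2 + (norm (a - eps *\<^sub>R h))^2 \<le> 2 * (norm a)^2 + 2 * eps^2"
proof -
  have "(norm (a + eps *\<^sub>R h))^2 + (norm (a - eps *\<^sub>R h))^2 = 2 * (norm a)^2 + 2 * (eps^2 * (norm h)^2)"
    unfolding power2_norm_eq_inner
    by (simp add: inner_add_left inner_add_right inner_diff_left inner_diff_right power2_eq_square
        inner_commute[of h a] algebra_simps)
  moreover have "eps^2 * (norm h)^2 \<le> eps^2 * 1"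
    using assms by (intro mult_left_mono) (auto simp: power_le_one)
  ultimately show ?thesis by simp
qed

context dpp_max
begin

text \<open>One reflection \<open>T\<close> serves both halves, and the mean in direction
  \<open>- z1\<close> is that in direction \<open>z1\<close> of the reversed step, so everything
  reduces to \<open>g h + g (- h)\<close>. All first order terms cancel, those of the localization
  included, which is why the error is \<open>G * eps^2\<close> and the second order gain of the
  square root suffices.\<close>

lemma choice_mirror:
  assumes z1e: "15/16 \<le> z1 \<bullet> e" and z2e: "z2 \<bullet> e \<le> - 15/16" and re: "100 * eps \<le> r"
  shows "C * sqrt r * (eps^2 * \<kappa> / (6 * r^2)) < G * eps^2"
proof -
  \<comment> \<open>\<open>v\<close> is the unit normal of the mirror exchanging \<open>z1\<close>
    and \<open>z2\<close>. The difference has length between 15/8 and 2, which transfers the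
    alignment with \<open>e\<close> to \<open>v\<close>.\<close>
  define n where "n = norm (z1 - z2)"
  define v where "v = (1 / n) *\<^sub>R (z1 - z2)"
  have zz: "z1 \<bullet> z1 = 1" "z2 \<bullet> z2 = 1" using z by (auto simp: norm_eq_1)
  have ee: "e \<bullet> e = 1" using e by (simp add: norm_eq_1)
  have n2: "n^2 = 2 - 2 * (z1 \<bullet> z2)"
    unfolding n_def power2_norm_eq_inner
    by (simp add: inner_diff_left inner_diff_right zz inner_commute[of z2 z1])
  have "15/8 \<le> (z1 - z2) \<bullet> e" using z1e z2e by (simp add: inner_diff_left)
  also have "\<dots> \<le> n" using norm_cauchy_schwarz[of "z1 - z2" e] e by (simp add: n_def)
  finally have n: "15/8 \<le> n" .
  have n': "n \<le> 2" using norm_triangle_ineq4[of z1 z2] z by (simp add: n_def)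
  have v: "norm v = 1" using n by (simp add: v_def n_def[symmetric])
  have "15/16 * n \<le> 15/8" using n' by simp
  then have ve: "15/16 \<le> v \<bullet> e" using \<open>15/8 \<le> (z1 - z2) \<bullet> e\<close> n
    by (simp add: v_def pos_le_divide_eq)
  have vz: "v \<bullet> z1 = n / 2"
  proof -
    have "n * n = 2 - 2 * (z1 \<bullet> z2)" using n2 by (simp add: power2_eq_square)
    moreover have "n * (v \<bullet> z1) = 1 - z1 \<bullet> z2"
      using n by (simp add: v_def inner_diff_left zz inner_commute[of z2 z1])
    ultimately have "n * (2 * (v \<bullet> z1)) = n * n" by linarith
    then have "2 * (v \<bullet> z1) = n" using n by (subst (asm) mult_cancel_left) auto
    then show ?thesis by simp
  qed
  define T where "T = reflection v"
  have T: "orthogonal_transformation T" unfolding T_def using v by (rule orthogonal_transformation_reflection)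
  have "n *\<^sub>R v = z1 - z2" using n by (simp add: v_def)
  moreover have "T z1 = z1 - n *\<^sub>R v" by (simp add: T_def reflection_def vz)
  ultimately have Tz: "T z1 = z2" by simp
  have z1': "norm (- z1) = 1" using z by simp
  define g where "g h = coupled_\<Psi> T h" for h
  have tg: "tame g" unfolding g_def using tame_\<Psi>[OF T] .
  have om: "orthogonal_transformation (\<lambda>h::real^'n. - h)"
    by (rule orthogonal_transformation_minus) (rule orthogonal_transformation_id)
  have tg': "tame (\<lambda>h. g (- h))" by (rule tame_orthogonal[OF tg om])
  have "mean p (- z1) g = mean p z1 (\<lambda>h. g (- h))"
    using tg by (intro mean_uminus_direction[OF p1 p2 z(1)]) (simp add: tame_def)
  with coupled[OF T Tz T z1'] have lt: "\<Psi> x y < 1/2 * mean p z1 (\<lambda>h. g h + g (- h)) + (2 * Mf + 2) * eps^2"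
    unfolding g_def[symmetric] mean_add[OF p1 p2 z(1) tg tg'] by (simp add: add_divide_distrib)
  define E where "E h = exp (- lam * separation T h / eps)" for h
  have tE: "tame E" unfolding E_def using eps
    by (intro tame_continuous continuous_intros continuous_on_orthogonal[OF T]) auto
  have tE': "tame (\<lambda>h. E (- h))" by (rule tame_orthogonal[OF tE om])
  have E0: "0 \<le> E h" for h by (simp add: E_def)
  define D where "D = (norm (x - x0))^2 + (norm (y - x0))^2"
  define a where "a = 2 * (J * sqrt eps) + 2 * (C * sqrt r) + 2 * (A * sqrt eps) + 2 * (K * D) + 4 * (K * eps^2)"
  define b where "b = C * sqrt r * (eps^2 / (3 * r^2))"
  have Tm: "T (- h) = - T h" for h by (simp add: T_def reflection_def)
  \<comment> \<open>The coupled steps agree except along \<open>v\<close>. The displacement is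
    written in the form of \<open>sqrt_symmetric_gain\<close>, where
    \<open>100 * eps \<le> r\<close> makes the parameter \<open>\<sigma>\<close> small.\<close>
  have dif: "step x h - step y (T h) = r *\<^sub>R e + (2 * r * (eps * (v \<bullet> h) / r)) *\<^sub>R v" for h
    using xy r by (simp add: T_def reflection_def algebra_simps)
  have ts: "tame (\<lambda>h. (v \<bullet> h)^2)" unfolding power2_eq_square by (intro tame_mult tame_inner)
  have "mean p z1 (\<lambda>h. g h + g (- h)) \<le> mean p z1 (\<lambda>h. a - b * (v \<bullet> h)^2 - (A * sqrt eps) * (E h + E (- h)))"
  proof (intro mean_mono[OF p1 p2 z(1)] tame_diff tame_add tame_const tame_cmult ts tE tE' tg tg')
    fix h :: "real^'n" assume h: "norm h < 1"
    have k: "norm (T h) < 1" using h orthogonal_transformation_norm[OF T] by simp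
    define \<sigma> where "\<sigma> = eps * (v \<bullet> h) / r"
    have "\<bar>v \<bullet> h\<bar> \<le> 1" using Cauchy_Schwarz_ineq2[of v h] v h by simp
    then have "eps * \<bar>v \<bullet> h\<bar> \<le> eps * 1" using eps by (intro mult_left_mono) auto
    then have "100 * (eps * \<bar>v \<bullet> h\<bar>) \<le> r" using re by linarith
    then have s: "\<bar>\<sigma>\<bar> \<le> 1/100" using r eps by (simp add: \<sigma>_def abs_mult field_simps)
    have "(15/16)^2 \<le> (v \<bullet> e)^2" using ve by (intro power_mono) auto
    then have "7/8 \<le> (v \<bullet> e)^2" by (simp add: power2_eq_square)
    then have "sqrt (separation T h) + sqrt (separation T (- h))
        \<le> 2 * sqrt r * (1 - \<sigma>^2 / 6)"
      using sqrt_symmetric_gain[OF e v _ r(1) s] unfolding dif by (simp add: \<sigma>_def)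
    then have "C * (sqrt (separation T h) + sqrt (separation T (- h)))
        \<le> C * (2 * sqrt r * (1 - \<sigma>^2 / 6))"
      using nonneg by (intro mult_left_mono) auto
    also have "\<dots> = 2 * (C * sqrt r) - b * (v \<bullet> h)^2"
      using r by (simp add: b_def \<sigma>_def field_simps)
    finally have 1: "C * sqrt (separation T h) + C * sqrt (separation T (- h))
        \<le> 2 * (C * sqrt r) - b * (v \<bullet> h)^2" by (simp only: distrib_left)
    have q: "(norm (step w k - x0))^2 + (norm (step w (- k) - x0))^2 \<le> 2 * (norm (w - x0))^2 + 2 * eps^2"
      if "norm k < 1" for w k
      using norm_parallelogram_le[OF that, of "w - x0" eps] by (simp add: algebra_simps)
    have "K * (((norm (step x h - x0))^2 + (norm (step x (- h) - x0))^2)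
        + ((norm (step y (T h) - x0))^2 + (norm (step y (- T h) - x0))^2))
      \<le> K * ((2 * (norm (x - x0))^2 + 2 * eps^2) + (2 * (norm (y - x0))^2 + 2 * eps^2))"
      using nonneg by (intro mult_left_mono add_mono q h k) auto
    also have "\<dots> = 2 * (K * D) + 4 * (K * eps^2)" by (simp add: D_def algebra_simps)
    finally have 2: "K * ((norm (step x h - x0))^2 + (norm (step y (T h) - x0))^2)
        + K * ((norm (step x (- h) - x0))^2 + (norm (step y (T (- h)) - x0))^2)
        \<le> 2 * (K * D) + 4 * (K * eps^2)" unfolding Tm by (simp add: distrib_left)
    show "g h + g (- h) \<le> a - b * (v \<bullet> h)^2 - (A * sqrt eps) * (E h + E (- h))"
      using 1 2 unfolding g_def \<Psi>_def a_def E_def right_diff_distrib mult_1_right distrib_left[of "A * sqrt eps"]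
      by linarith
  qed
  also have "\<dots> = a - b * mean p z1 (\<lambda>h. (v \<bullet> h)^2) - (A * sqrt eps) * mean p z1 (\<lambda>h. E h + E (- h))"
    using mean_diff[OF p1 p2 z(1) tame_diff[OF tame_const tame_cmult[OF ts]] tame_cmult[OF tame_add[OF tE tE']]]
      mean_diff[OF p1 p2 z(1) tame_const tame_cmult[OF ts]] mean_const[OF p1 p2 z(1)]
    by (simp only: mean_cmult[OF p1 p2])
  finally have up: "mean p z1 (\<lambda>h. g h + g (- h))
      \<le> a - b * mean p z1 (\<lambda>h. (v \<bullet> h)^2) - (A * sqrt eps) * mean p z1 (\<lambda>h. E h + E (- h))" .
  define E0 where "E0 = exp (- lam * r / eps)"
  \<comment> \<open>For \<open>h\<close> near \<open>(1/2) *\<^sub>R v\<close> it is the reversed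
    step that brings the points together, so only \<open>E (- h)\<close> is used. The drop by
    \<open>eps / 4\<close> survives the quadratic term because of
    \<open>100 * eps \<le> r\<close>.\<close>
  have "\<beta> * (exp (lam / 4) * E0) \<le> mean p z1 (\<lambda>h. E h + E (- h))"
  proof (rule mean_lower[OF z(1) tame_add[OF tE tE'], of "(1/2) *\<^sub>R v"])
    show "0 \<le> E h + E (- h)" for h using E0[of h] E0[of "- h"] by simp
    show "norm ((1/2) *\<^sub>R v) \<le> 7/8" using v by simp
    show "1/8 \<le> z1 \<bullet> ((1/2) *\<^sub>R v)" using vz n by (simp add: inner_commute[of z1 v])
    show "0 \<le> exp (lam / 4) * E0" by (simp add: E0_def)
    fix h :: "real^'n" assume h: "norm h < 1" "norm (h - (1/2) *\<^sub>R v) < 1/8"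
    define s where "s = v \<bullet> h"
    have vv: "v \<bullet> v = 1" using v by (simp add: norm_eq_1)
    have "\<bar>v \<bullet> (h - (1/2) *\<^sub>R v)\<bar> < 1/8" using Cauchy_Schwarz_ineq2[of v "h - (1/2) *\<^sub>R v"] v h(2) by simp
    then have "\<bar>s - 1/2\<bar> < 1/8" by (simp add: s_def inner_diff_right vv)
    then have s: "3/8 < s" "s < 5/8" unfolding abs_less_iff by linarith+
    define m where "m = separation T (- h)"
    have "step x (- h) - step y (T (- h)) = r *\<^sub>R e + (- 2 * eps * s) *\<^sub>R v"
      unfolding dif using r by (simp add: s_def)
    then have m2: "m^2 = r^2 + 2 * r * (- 2 * eps * s) * (v \<bullet> e) + (- 2 * eps * s)^2"
      unfolding m_def by (simp only: norm_add_scaled_square[OF e v])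
    have "(3/8) * (15/16) \<le> s * (v \<bullet> e)" using s ve by (intro mult_mono) auto
    then have a1: "(r * eps) * ((3/8) * (15/16)) \<le> (r * eps) * (s * (v \<bullet> e))"
      using r eps by (intro mult_left_mono) auto
    have "s * s \<le> 1 * 1" using s by (intro mult_mono) auto
    then have a2: "(eps * eps) * (s * s) \<le> (eps * eps) * 1" using eps by (intro mult_left_mono) auto
    have "(100 * eps) * eps \<le> r * eps" using re eps by (intro mult_right_mono) auto
    then have a3: "100 * (eps * eps) \<le> r * eps" by (simp add: mult.assoc)
    have a4: "0 \<le> eps * eps" by simp
    have "t - 4 * Q + 4 * W \<le> t - P / 2 + E / 16"
      if "P * ((3/8) * (15/16)) \<le> Q" "W \<le> E * 1" "100 * E \<le> P" "0 \<le> E" for t P Q W E :: real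
      using that by linarith
    from this[OF a1 a2 a3 a4]
    have "r^2 - 4 * ((r * eps) * (s * (v \<bullet> e))) + 4 * ((eps * eps) * (s * s)) \<le> r^2 - (r * eps) / 2 + (eps * eps) / 16" .
    also have "\<dots> = (r - eps / 4)^2" by (simp add: power2_eq_square field_simps)
    finally have "m^2 \<le> (r - eps / 4)^2" unfolding m2 by (simp add: power2_eq_square mult_ac)
    then have "m \<le> r - eps / 4" by (rule power2_le_imp_le) (use re eps in linarith)
    then have "exp (lam / 4) * E0 \<le> E (- h)" unfolding E_def E0_def m_def by (rule exp_gain)
    then show "exp (lam / 4) * E0 \<le> E h + E (- h)" using E0[of h] by simp
  qed
  moreover have "4 * E0 \<le> (\<beta> * exp (lam / 4)) * E0"
    using lam_large by (intro mult_right_mono) (auto simp: E0_def)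
  ultimately have "4 * E0 \<le> mean p z1 (\<lambda>h. E h + E (- h))" by (simp add: mult.assoc)
  then have e1: "(A * sqrt eps) * (4 * E0) \<le> (A * sqrt eps) * mean p z1 (\<lambda>h. E h + E (- h))"
    using nonneg eps by (intro mult_left_mono) auto
  have "\<kappa> \<le> mean p z1 (\<lambda>h. (v \<bullet> h)^2)"
    using inner_square_moment_ge[OF p1 p2 z(1) v] by (simp add: \<kappa>_def)
  then have e2: "b * \<kappa> \<le> b * mean p z1 (\<lambda>h. (v \<bullet> h)^2)"
    using nonneg r by (intro mult_left_mono) (auto simp: b_def)
  have e3: "\<Psi> x y = J * sqrt eps + C * sqrt r + A * sqrt eps - A * sqrt eps * E0 + K * D"
    unfolding \<Psi>_def r_eq E0_def D_def by (simp add: algebra_simps)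
  have "0 \<le> A * sqrt eps * E0" using nonneg eps by (simp add: E0_def)
  moreover have "0 \<le> K * eps^2" using nonneg by simp
  moreover have "(A * sqrt eps) * (4 * E0) = 4 * (A * sqrt eps * E0)" by simp
  moreover have "G * eps^2 = 6 * (K * eps^2) + (2 * Mf + 2) * eps^2" by (simp add: G_def algebra_simps)
  ultimately have "b * \<kappa> / 2 < G * eps^2"
    using lt up e1 e2 e3 unfolding a_def by linarith
  then show ?thesis by (simp add: b_def mult_ac)
qed

section \<open>Excluding an almost maximum at each scale of the distance\<close>

lemma inner_e: "z1 \<bullet> e \<le> 1" "- 1 \<le> z2 \<bullet> e"
  using Cauchy_Schwarz_ineq2[of z1 e] Cauchy_Schwarz_ineq2[of z2 e] z e by (auto simp: abs_le_iff)

text \<open>If both directions are aligned with \<open>e\<close>, the concavity gain and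
  \<open>r * sqrt r \<le> 4\<close> give \<open>C * \<kappa> < 24 * G\<close>. Otherwise the slack
  1/16 yields a drift gain, half of which is spent on the term \<open>eps^2 / r^2\<close> thanks to
  \<open>128 \<le> \<kappa> * \<Lambda>\<close>; with \<open>sqrt r \<le> 2\<close> this gives
  \<open>C * \<kappa> < 256 * G\<close>. Both contradict \<open>C_large\<close>.\<close>

lemma no_far_maximum:
  assumes re: "\<Lambda> * eps \<le> r"
  shows False
proof -
  have "0 < \<Lambda>" using Lambda_large by simp
  have sr: "0 < sqrt r" "sqrt r \<le> 2" "sqrt r * sqrt r = r"
    using r real_sqrt_le_mono[of r 4] by auto
  have "100 * eps \<le> \<Lambda> * eps" using Lambda_large(1) eps by (intro mult_right_mono) auto
  then have re': "100 * eps \<le> r" using re by linarith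
  show False
  proof (cases "15/16 \<le> z1 \<bullet> e \<and> z2 \<bullet> e \<le> - 15/16")
    case True
    then have "C * sqrt r * (eps^2 * \<kappa> / (6 * r^2)) < G * eps^2" using re' by (intro choice_mirror) auto
    moreover have "C * sqrt r * (eps^2 * \<kappa> / (6 * r^2)) = (C * \<kappa> / (6 * (r * sqrt r))) * eps^2"
    proof -
      have "sqrt r / r^2 = 1 / (r * sqrt r)" using sr r by (simp add: field_simps power2_eq_square)
      then have "(sqrt r / r^2) * (C * eps^2 * \<kappa> / 6) = (1 / (r * sqrt r)) * (C * eps^2 * \<kappa> / 6)" by simp
      then show ?thesis by (simp add: mult_ac)
    qed
    ultimately have "(C * \<kappa> / (6 * (r * sqrt r))) * eps^2 < G * eps^2" by simp
    then have "C * \<kappa> / (6 * (r * sqrt r)) < G" by (rule mult_right_less_imp_less) simp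
    have "r * sqrt r \<le> 2 * 2" using r sr by (intro mult_mono) auto
    then have "G * (6 * (r * sqrt r)) \<le> G * (6 * (2 * 2))" using G_pos by (intro mult_left_mono) auto
    moreover have "C * \<kappa> < G * (6 * (r * sqrt r))"
      using \<open>C * \<kappa> / (6 * (r * sqrt r)) < G\<close> sr r by (simp add: pos_divide_less_eq)
    ultimately have "C * \<kappa> < G * (6 * (2 * 2))" by linarith
    then show False using C_large G_pos by simp
  next
    case False
    define \<delta> where "\<delta> = (1 - z1 \<bullet> e) + (1 + z2 \<bullet> e)"
    have \<delta>: "1/16 \<le> \<delta>" using False inner_e by (auto simp: \<delta>_def)
    have "eps / 2 \<le> r" using re' eps by simp
    from choice_towards[OF this]
    have 1: "A * sqrt eps * exp (- lam * r / eps) + C * sqrt r * (eps * c1 * \<delta> / (4 * r) - eps^2 / r^2) < G * eps"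
      by (simp only: \<delta>_def)
    have "\<kappa> * (1/16) \<le> c1 * \<delta>" using c1_ge \<kappa>_pos \<delta> by (intro mult_mono) auto
    then have "(eps / (4 * r)) * (\<kappa> * (1/16)) \<le> (eps / (4 * r)) * (c1 * \<delta>)"
      using eps r by (intro mult_left_mono) auto
    then have 2: "eps * \<kappa> / (64 * r) \<le> eps * c1 * \<delta> / (4 * r)" by (simp add: mult_ac)
    have "128 * eps \<le> \<kappa> * r"
    proof -
      have "128 * eps \<le> (\<kappa> * \<Lambda>) * eps" using Lambda_large(2) eps by (intro mult_right_mono) auto
      also have "\<dots> = \<kappa> * (\<Lambda> * eps)" by simp
      also have "\<dots> \<le> \<kappa> * r" using re \<kappa>_pos by (intro mult_left_mono) auto
      finally show ?thesis .
    qed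
    then have "(eps / r^2) * (128 * eps) \<le> (eps / r^2) * (\<kappa> * r)" using eps by (intro mult_left_mono) auto
    then have "eps^2 / r^2 \<le> eps * \<kappa> / (128 * r)" using r by (simp add: field_simps power2_eq_square)
    moreover have "eps * \<kappa> / (64 * r) = 2 * (eps * \<kappa> / (128 * r))" by simp
    ultimately have "eps * \<kappa> / (128 * r) \<le> eps * c1 * \<delta> / (4 * r) - eps^2 / r^2" using 2 by linarith
    then have 3: "C * sqrt r * (eps * \<kappa> / (128 * r)) \<le> C * sqrt r * (eps * c1 * \<delta> / (4 * r) - eps^2 / r^2)"
      using nonneg r by (intro mult_left_mono) auto
    have "sqrt r / r = 1 / sqrt r" using sr by (simp add: field_simps)
    then have "(sqrt r / r) * (C * eps * \<kappa> / 128) = (1 / sqrt r) * (C * eps * \<kappa> / 128)" by simp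
    then have "C * sqrt r * (eps * \<kappa> / (128 * r)) = (C * \<kappa> / (128 * sqrt r)) * eps" by (simp add: mult_ac)
    moreover have "0 \<le> A * sqrt eps * exp (- lam * r / eps)" using nonneg eps by simp
    ultimately have "(C * \<kappa> / (128 * sqrt r)) * eps < G * eps" using 1 3 by linarith
    then have "C * \<kappa> / (128 * sqrt r) < G" by (rule mult_right_less_imp_less) (use eps in simp)
    then have "C * \<kappa> < G * (128 * sqrt r)" using sr by (simp add: pos_divide_less_eq)
    also have "\<dots> \<le> G * (128 * 2)" using sr G_pos by (intro mult_left_mono) auto
    finally show False using C_large by simp
  qed
qed

text \<open>Here the adversary may cancel the drift entirely, and the second order error of the
  square root is of the size of its value. From \<open>eps / 2 \<le> r\<close> that error is at most
  \<open>3 * C * sqrt eps\<close>, and from \<open>r \<le> \<Lambda> * eps\<close> the exponential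
  still yields \<open>A * exp (- lam * \<Lambda>) * sqrt eps\<close>, which is enough by
  \<open>A_large\<close>.\<close>

lemma no_intermediate_maximum:
  assumes re: "eps / 2 \<le> r" "r \<le> \<Lambda> * eps"
  shows False
proof -
  define \<delta> where "\<delta> = (1 - z1 \<bullet> e) + (1 + z2 \<bullet> e)"
  have \<delta>: "0 \<le> \<delta>" using inner_e by (auto simp: \<delta>_def)
  from choice_towards[OF re(1)]
  have 1: "A * sqrt eps * exp (- lam * r / eps) + C * sqrt r * (eps * c1 * \<delta> / (4 * r) - eps^2 / r^2) < G * eps"
    by (simp only: \<delta>_def)
  have "0 \<le> eps * c1 * \<delta> / (4 * r)" using eps c1_ge \<kappa>_pos \<delta> r by simp
  then have "C * sqrt r * (- (eps^2 / r^2)) \<le> C * sqrt r * (eps * c1 * \<delta> / (4 * r) - eps^2 / r^2)"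
    using nonneg r by (intro mult_left_mono) auto
  then have 2: "- (C * (sqrt r * (eps^2 / r^2))) \<le> C * sqrt r * (eps * c1 * \<delta> / (4 * r) - eps^2 / r^2)" by simp
  have "sqrt r * (eps^2 / r^2) \<le> 3 * sqrt eps"
  proof -
    have "sqrt eps \<le> sqrt (2 * r)" using re by (intro real_sqrt_le_mono) simp
    also have "\<dots> = sqrt 2 * sqrt r" by (rule real_sqrt_mult)
    also have "\<dots> \<le> (3/2) * sqrt r"
    proof (rule mult_right_mono)
      have "sqrt 2 \<le> sqrt ((3/2)^2)" by (rule real_sqrt_le_mono) (simp add: power2_eq_square)
      then show "sqrt 2 \<le> 3/2" by simp
    qed (use r in simp)
    finally have "eps * sqrt eps \<le> (2 * r) * ((3/2) * sqrt r)" using re eps r by (intro mult_mono) auto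
    then have "(eps * sqrt eps) * (sqrt eps * (1 / (r * sqrt r))) \<le> ((2 * r) * ((3/2) * sqrt r)) * (sqrt eps * (1 / (r * sqrt r)))"
      using r eps by (intro mult_right_mono) auto
    also have "\<dots> = 3 * sqrt eps" using r by (simp add: field_simps)
    also have "(eps * sqrt eps) * (sqrt eps * (1 / (r * sqrt r))) = eps^2 / (r * sqrt r)"
      using eps by (simp add: power2_eq_square)
    also have "\<dots> = sqrt r * (eps^2 / r^2)"
    proof -
      have "sqrt r * sqrt r = r" using r by simp
      then have "sqrt r / r^2 = 1 / (r * sqrt r)" using r by (simp add: field_simps power2_eq_square)
      moreover have "sqrt r * (eps^2 / r^2) = (sqrt r / r^2) * eps^2" by simp
      ultimately show ?thesis by simp
    qed
    finally show ?thesis .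
  qed
  then have 3: "C * (sqrt r * (eps^2 / r^2)) \<le> C * (3 * sqrt eps)" using nonneg by (intro mult_left_mono) auto
  have "lam * (r / eps) \<le> lam * \<Lambda>" using re eps nonneg by (intro mult_left_mono) (auto simp: field_simps)
  then have "exp (- lam * \<Lambda>) \<le> exp (- lam * r / eps)" by simp
  then have "A * sqrt eps * exp (- lam * \<Lambda>) \<le> A * sqrt eps * exp (- lam * r / eps)"
    using nonneg eps by (intro mult_left_mono) auto
  moreover have "sqrt eps * (3 * C + G) \<le> sqrt eps * (A * exp (- lam * \<Lambda>))"
    using A_large eps by (intro mult_left_mono) auto
  moreover have "G * eps \<le> G * sqrt eps" using sqrt_eps(1) G_pos by (intro mult_left_mono) auto
  ultimately show False using 1 2 3 by (simp add: algebra_simps)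
qed

end

context dpp_max
begin

text \<open>If both points move in direction \<open>e\<close>, their step distributions share a ball of Lebesgue measure
  of probability at least \<open>\<beta>\<close>, on which \<open>u\<close> cancels.\<close>

lemma merge:
  assumes re: "r \<le> eps / 2"
    and S: "\<And>h. norm h < 1 \<Longrightarrow> u (step x h) \<le> S" and I: "\<And>h. norm h < 1 \<Longrightarrow> I \<le> u (step y h)"
  shows "U x e - U y e \<le> (1 - \<beta>) * (S - I)"
proof -
  have ee: "e \<bullet> e = 1" using e by (simp add: norm_eq_1)
  have q: "0 < r / eps" "r / eps \<le> 1/2" using re r eps by (auto simp: field_simps)
  \<comment> \<open>Since \<open>x = y + eps *\<^sub>R d\<close>, the ball about \<open>c\<close>
    seen from \<open>x\<close> and the ball about \<open>c + d\<close> seen from \<open>y\<close>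
    are the same set of landing points; \<open>r \<le> eps / 2\<close> keeps the second one in the
    half ball.\<close>
  define c where "c = (1/4) *\<^sub>R e"
  define d where "d = (r / eps) *\<^sub>R e"
  define \<psi>1 where "\<psi>1 h = S - u (step x h)" for h
  define \<psi>2 where "\<psi>2 h = u (step y h) - I" for h
  have t: "tame \<psi>1" "tame \<psi>2" unfolding \<psi>1_def \<psi>2_def by (intro tame_diff tame_u tame_const)+
  have m: "\<psi>1 \<in> borel_measurable borel" "\<psi>2 \<in> borel_measurable borel" using t by (auto simp: tame_def)
  have b: "\<bar>\<psi>1 h\<bar> \<le> \<bar>S\<bar> + M" "\<bar>\<psi>2 h\<bar> \<le> \<bar>I\<bar> + M" for h
    unfolding \<psi>1_def \<psi>2_def using u_bound[of "step x h"] u_bound[of "step y h"] by linarith+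
  have 1: "ball_integral c \<psi>1 / mass p e \<le> mean p e \<psi>1"
    using e ee S by (intro mean_ge_ball[OF p1 p2 e t(1)]) (auto simp: \<psi>1_def c_def)
  have 2: "ball_integral (c + d) \<psi>2 / mass p e \<le> mean p e \<psi>2"
  proof (rule mean_ge_ball[OF p1 p2 e t(2)])
    show "0 \<le> \<psi>2 h" if "norm h < 1" for h using I[OF that] by (simp add: \<psi>2_def)
    have cd: "c + d = (1/4 + r / eps) *\<^sub>R e" by (simp add: c_def d_def algebra_simps)
    have "norm (c + d) = 1/4 + r / eps" unfolding cd norm_scaleR e using q by simp
    then show "norm (c + d) \<le> 7/8" using q by linarith
    have "e \<bullet> (c + d) = 1/4 + r / eps" unfolding cd inner_scaleR_right ee by simp
    then show "1/8 \<le> e \<bullet> (c + d)" using q by linarith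
  qed
  have "ball_integral (c + d) \<psi>2
      = (\<integral>h. indicator (ball (c + d) (1/8)) (d + h) * \<psi>2 (d + h) \<partial>lborel)"
    using m(2) by (intro integral_lborel_translate[symmetric] borel_measurable_times borel_measurable_indicator) auto
  also have "\<dots> = ball_integral c (\<lambda>h. u (step x h) - I)"
  proof (rule Bochner_Integration.integral_cong)
    fix h :: "real^'n"
    have "step y (d + h) = step x h"
      using xy eps by (simp add: d_def scaleR_add_right) (simp add: algebra_simps)
    then have "\<psi>2 (d + h) = u (step x h) - I" by (simp add: \<psi>2_def)
    moreover have "indicator (ball (c + d) (1/8)) (d + h) = (indicator (ball c (1/8)) h :: real)"
      by (auto simp: indicator_def dist_norm)
    ultimately show "indicator (ball (c + d) (1/8)) (d + h) * \<psi>2 (d + h)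
      = indicator (ball c (1/8)) h * (u (step x h) - I)" by simp
  qed simp
  finally have 3: "ball_integral (c + d) \<psi>2
      = ball_integral c (\<lambda>h. u (step x h) - I)" .
  have ti: "tame (\<lambda>h. u (step x h) - I)" by (intro tame_diff tame_u tame_const)
  have bi: "\<bar>u (step x h) - I\<bar> \<le> \<bar>I\<bar> + M" for h
    using u_bound[of "step x h"] by linarith
  have "ball_integral c \<psi>1
      + ball_integral c (\<lambda>h. u (step x h) - I)
      = (\<integral>h. indicator (ball c (1/8)) h * \<psi>1 h + indicator (ball c (1/8)) h * (u (step x h) - I) \<partial>lborel)"
    using ti by (intro Bochner_Integration.integral_add[symmetric] integrable_indicator_ball_mult[OF m(1) b(1)]
        integrable_indicator_ball_mult[OF _ bi]) (simp add: tame_def)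
  also have "\<dots> = (\<integral>h. (S - I) * indicator (ball c (1/8)) h \<partial>lborel)"
    by (rule Bochner_Integration.integral_cong) (auto simp: \<psi>1_def algebra_simps indicator_def)
  also have "\<dots> = (S - I) * (\<beta> * m0)" by (simp add: measure_ball_eighth)
  finally have "ball_integral c \<psi>1 / mass p e
      + ball_integral (c + d) \<psi>2 / mass p e = (S - I) * \<beta>"
    unfolding 3 using m0_pos mass_m0[OF e] by (simp add: add_divide_distrib[symmetric])
  with 1 2 have "(S - I) * \<beta> \<le> mean p e \<psi>1 + mean p e \<psi>2" by linarith
  also have "\<dots> = S - I - (U x e - U y e)"
    unfolding \<psi>1_def \<psi>2_def U_def
    using mean_diff[OF p1 p2 e tame_const tame_u] mean_diff[OF p1 p2 e tame_u tame_const] mean_const[OF p1 p2 e]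
    by simp
  finally show ?thesis by (simp add: algebra_simps)
qed

text \<open>After one step each the points are within \<open>4 * eps\<close>, so
  \<open>\<Psi>\<close> grows by at most \<open>B\<close>, of order \<open>sqrt eps\<close>, and
  every difference of landing values is at most \<open>V\<close>. Merging the answered steps removes
  \<open>\<beta> * V\<close> from one half, hence \<open>\<beta> * V / 2\<close> is at most of order
  \<open>sqrt eps\<close>; but \<open>V\<close> is at least \<open>J * sqrt eps\<close>.\<close>

lemma no_near_maximum:
  assumes re: "r < eps / 2"
  shows False
proof -
  define B where "B = (2 * C + A + 6 * K) * sqrt eps"
  define V where "V = \<theta> + \<Psi> x y + B"
  have bnd: "u (step x h) - u (step y k) \<le> V" if h: "norm h < 1" and k: "norm k < 1" for h k
  proof -
    define \<rho> where "\<rho> = norm (step x h - step y k)"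
    have eq: "step x h - step y k = (x - y) + (eps *\<^sub>R h - eps *\<^sub>R k)" by simp
    have "\<rho> \<le> r + (eps * norm h + eps * norm k)"
      unfolding \<rho>_def eq using norm_triangle_ineq[of "x - y" "eps *\<^sub>R h - eps *\<^sub>R k"]
        norm_triangle_ineq4[of "eps *\<^sub>R h" "eps *\<^sub>R k"] eps r_eq by simp
    moreover have "eps * norm h \<le> eps * 1" "eps * norm k \<le> eps * 1" using h k eps by (intro mult_left_mono; simp)+
    ultimately have "\<rho> \<le> 4 * eps" using re eps by linarith
    then have "sqrt \<rho> \<le> sqrt (4 * eps)" by (rule real_sqrt_le_mono)
    also have "\<dots> = 2 * sqrt eps" by (simp add: real_sqrt_mult)
    finally have 1: "C * sqrt \<rho> \<le> C * (2 * sqrt eps)" using nonneg by (intro mult_left_mono) auto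
    have 2: "A * sqrt eps * (1 - exp (- lam * \<rho> / eps)) \<le> A * sqrt eps * 1"
      using nonneg eps by (intro mult_left_mono) auto
    have 3: "6 * K * eps \<le> 6 * K * sqrt eps" using nonneg sqrt_eps by (intro mult_left_mono) auto
    have "\<Psi> (step x h) (step y k) \<le> \<Psi> x y + B"
      using 1 2 3 local_part[OF h k] \<Psi>_ge[of x y]
      unfolding \<Psi>_def[of "step x h"] B_def \<rho>_def[symmetric] distrib_right by linarith
    then show ?thesis using le[of "step x h" "step y k"] by (simp add: V_def)
  qed
  \<comment> \<open>Taking the supremum over one variable turns the bound on differences into
    separate one-sided bounds at \<open>x\<close> and at \<open>y\<close>, as \<open>merge\<close>
    requires.\<close>
  define S where "S = (SUP h\<in>ball 0 1. u (step x h))"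
  define I where "I = S - V"
  have "u (step x h) \<le> M" for h using u_bound[of "step x h"] by simp
  then have S: "u (step x h) \<le> S" if "norm h < 1" for h
    unfolding S_def using that by (intro cSUP_upper bdd_aboveI2[of _ _ M]) auto
  have I: "I \<le> u (step y k)" if k: "norm k < 1" for k
  proof -
    have "S \<le> V + u (step y k)"
      unfolding S_def using bnd[OF _ k] by (intro cSUP_least) (auto simp: algebra_simps)
    then show ?thesis by (simp add: I_def)
  qed
  have VB: "\<theta> + \<Psi> x y = V - B" and IV: "I = S - V" by (simp_all add: V_def I_def)
  have "U x e - U y e \<le> (1 - \<beta>) * V"
    using merge[OF _ S I] re by (simp add: I_def)
  then have c1: "U x e - U y e \<le> V - \<beta> * V" by (simp add: algebra_simps)
  have c2: "U x z1 \<le> S"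
    using mean_mono[OF p1 p2 z(1) tame_u tame_const S] mean_const[OF p1 p2 z(1)] by (simp add: U_def)
  have c3: "I \<le> U y z2"
    using mean_mono[OF p1 p2 z(2) tame_const tame_u I] mean_const[OF p1 p2 z(2)] by (simp add: U_def)
  have gen: "b / 2 < B + X"
    if "d \<le> 1/2 * (a1 - a2) + 1/2 * c + D + q" "t - q < d - \<psi>" "D + 2 * q \<le> X" "t + \<psi> = V - B"
      "c \<le> V - b" "a1 \<le> S" "I \<le> a2" "I = S - V" for a1 a2 b c d t \<psi> q D X :: real
    using that by (simp add: field_simps)
  have "\<beta> * V / 2 < B + (2 * Mf + 2) * eps^2"
    by (rule gen[OF choice[OF e e] near f_diff VB c1 c2 c3 IV])
  moreover have "(2 * Mf + 2) * eps^2 \<le> (2 * Mf + 2) * sqrt eps"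
    using nonneg sqrt_eps by (intro mult_left_mono) auto
  moreover have "B + (2 * Mf + 2) * sqrt eps = (2 * C + A + G) * sqrt eps"
    by (simp add: B_def G_def algebra_simps)
  moreover have "(2 * (2 * C + A + G)) * sqrt eps = 2 * ((2 * C + A + G) * sqrt eps)" by simp
  ultimately have "\<beta> * V < (2 * (2 * C + A + G)) * sqrt eps" by linarith
  also have "\<dots> \<le> (\<beta> * J) * sqrt eps" using J_large eps by (intro mult_right_mono) auto
  finally have "\<beta> * V < \<beta> * (J * sqrt eps)" by (simp add: mult.assoc)
  then have "V < J * sqrt eps" using \<beta>_bounds by simp
  moreover have "J * sqrt eps \<le> V"
  proof -
    have "0 \<le> K * ((norm (x - x0))^2 + (norm (y - x0))^2)" "0 \<le> B"
      using nonneg eps by (simp_all add: B_def)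
    then show ?thesis using theta \<Psi>_ge[of x y] unfolding V_def by linarith
  qed
  ultimately show False by simp
qed

lemma no_maximum: False
  using no_near_maximum no_intermediate_maximum no_far_maximum by argo

end

section \<open>The comparison principle and the modulus of continuity\<close>

context dpp_comparison
begin

text \<open>A positive value of \<open>u x - u y - \<Psi> x y\<close> together with
  \<open>K_large\<close> forces both points into the ball, so no condition at its boundary enters.
  The supremum need not be attained, which is why \<open>dpp_max\<close> only asks for an almost
  maximum.\<close>

lemma comparison: "u a - u b \<le> \<Psi> a b"
proof (rule ccontr)
  define F where "F = (\<lambda>(x, y). u x - u y - \<Psi> x y)"
  assume "\<not> u a - u b \<le> \<Psi> a b"
  then have Fab: "0 < F (a, b)" by (simp add: F_def)
  have J: "0 \<le> J * sqrt eps" using nonneg eps by simp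
  have pos: "0 \<le> \<Psi> x y" for x y
  proof -
    have "0 \<le> K * ((norm (x - x0))^2 + (norm (y - x0))^2)" using nonneg by simp
    then show ?thesis using \<Psi>_ge[of x y] J by linarith
  qed
  have uu: "u x - u y \<le> 2 * M" for x y using u_bound[of x] u_bound[of y] by (simp add: abs_le_iff)
  have "F q \<le> 2 * M" for q
  proof (cases q)
    case (Pair x y)
    then show ?thesis using pos[of x y] uu[of x y] by (simp add: F_def)
  qed
  then have bdd: "bdd_above (range F)" by (intro bdd_aboveI2[of _ _ "2 * M"]) auto
  define \<theta> where "\<theta> = (SUP q. F q)"
  have F\<theta>: "F q \<le> \<theta>" for q unfolding \<theta>_def using bdd by (intro cSUP_upper) auto
  have theta: "0 < \<theta>" using Fab F\<theta>[of "(a, b)"] by linarith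
  \<comment> \<open>The maximum with 0 secures near maximality and a positive value at the same
    pair.\<close>
  have "max (\<theta> - eps^2) 0 < \<theta>" using theta eps by simp
  then obtain q where "max (\<theta> - eps^2) 0 < F q"
    using less_cSUP_iff[OF UNIV_not_empty bdd, of "max (\<theta> - eps^2) 0", folded \<theta>_def] by auto
  then obtain x y where near: "\<theta> - eps^2 < u x - u y - \<Psi> x y" and Fp: "0 < u x - u y - \<Psi> x y"
    by (cases q) (auto simp: F_def)
  have "K * ((norm (x - x0))^2 + (norm (y - x0))^2) < 2 * M" using \<Psi>_ge[of x y] J Fp uu[of x y] by linarith
  then have "K * ((norm (x - x0))^2 + (norm (y - x0))^2) < K * R^2" using K_large by linarith
  then have "(norm (x - x0))^2 + (norm (y - x0))^2 < R^2" using nonneg by (simp add: mult_less_cancel_left)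
  then have "(norm (x - x0))^2 < R^2" "(norm (y - x0))^2 < R^2"
    by (smt (verit) zero_le_power2)+
  then have nR: "norm (x - x0) < R" "norm (y - x0) < R" using R by (auto intro: power2_less_imp_less)
  then have xB: "x \<in> ball x0 R" and yB: "y \<in> ball x0 R" by (auto simp: dist_norm norm_minus_commute)
  define r where "r = norm (x - y)"
  define e where "e = (1 / r) *\<^sub>R (x - y)"
  have "x \<noteq> y" using Fp pos[of x x] by auto
  then have r: "0 < r" by (simp add: r_def)
  have "r \<le> norm (x - x0) + norm (y - x0)"
    unfolding r_def using norm_triangle_ineq4[of "x - x0" "y - x0"] by simp
  then have r2: "r \<le> 2" using nR R by simp
  have e: "norm e = 1" using r by (simp add: e_def r_def)
  have xy: "x - y = r *\<^sub>R e" using r by (simp add: e_def)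
  have "0 < eps^2" using eps by simp
  from direction_choice[OF xB yB this] obtain z1 z2 where z: "norm z1 = 1" "norm z2 = 1" and
    choice: "\<And>w1 w2. norm w1 = 1 \<Longrightarrow> norm w2 = 1 \<Longrightarrow>
      u x - u y \<le> 1/2 * (U x z1 - U y z2) + 1/2 * (U x w1 - U y w2) + eps^2 * (f x - f y) + eps^2"
    by blast
  have le: "u x' - u y' \<le> \<theta> + \<Psi> x' y'" for x' y' using F\<theta>[of "(x', y')"] by (simp add: F_def)
  interpret dpp_max p eps R M Mf u f x0 m0 c1 \<kappa> \<beta> C A J K lam \<Lambda> G x y z1 z2 e r \<theta>
    by unfold_locales (fact xB yB le near theta z choice e xy r r2)+
  show False by (rule no_maximum)
qed

end

text \<open>The order of quantifiers matters: \<open>L\<close> serves all \<open>eps\<close>,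
  \<open>u\<close>, \<open>f\<close> and centers at once, as compactness requires. Since one of the
  two points is the center, the localization term is \<open>K\<close> times the squared distance,
  dominated by the square root at distances up to 1; beyond, the bound on \<open>u\<close>
  suffices.\<close>

lemma dpp_ball_modulus:
  fixes R M Mf p :: real
  assumes p: "1 < p" "p < 2" and R: "0 < R" "R \<le> 1" and M: "0 \<le> M" "0 \<le> Mf"
  shows "\<exists>L\<ge>0. \<forall>eps u f (x0::real^'n) y. dpp_ball p eps R M Mf u f x0 \<longrightarrow>
    \<bar>u x0 - u y\<bar> \<le> L * (sqrt eps + sqrt (dist x0 y))"
proof -
  fix k :: 'n
  define a :: "real^'n" where "a = axis k 1"
  have a: "norm a = 1" by (simp add: a_def)
  define m0 where "m0 = mass p a"
  define c1 where "c1 = drift p a"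
  define \<kappa> where "\<kappa> = (p - 1) / (real CARD('n) + p)"
  define \<beta> where "\<beta> = measure lborel (ball (0::real^'n) (1/8)) / m0"
  define K where "K = 2 * M / R^2"
  define G where "G = 6 * K + 2 * Mf + 2"
  define C where "C = 256 * G / \<kappa>"
  define \<Lambda> where "\<Lambda> = max 100 (128 / \<kappa>)"
  define lam where "lam = 4 * max 0 (ln (4 / \<beta>))"
  define A where "A = (3 * C + G) * exp (lam * \<Lambda>)"
  define J where "J = 2 * (2 * C + A + G) / \<beta>"
  have \<kappa>: "0 < \<kappa>" using p by (simp add: \<kappa>_def)
  have "0 < m0" unfolding m0_def by (rule mass_pos[OF p a])
  then have \<beta>: "0 < \<beta>" using content_ball_pos[of "1/8" "0::real^'n"] by (simp add: \<beta>_def)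
  have nn: "0 \<le> K" "0 \<le> G" "0 \<le> C" "0 \<le> A" "0 \<le> J" "0 \<le> lam"
    using M \<kappa> \<beta> by (simp_all add: K_def G_def C_def A_def J_def lam_def)
  define L where "L = J + A + C + K + 2 * M"
  have "\<bar>u x0 - u y\<bar> \<le> L * (sqrt eps + sqrt (dist x0 y))"
    if "dpp_ball p eps R M Mf u f x0" for eps u f and x0 y :: "real^'n"
  proof -
    interpret dpp_ball p eps R M Mf u f x0 by (fact that)
    interpret dpp_comparison p eps R M Mf u f x0 m0 c1 \<kappa> \<beta> C A J K lam \<Lambda> G
    proof unfold_locales
      show "mass p z = m0" if "norm z = 1" for z :: "real^'n" unfolding m0_def by (rule mass_eq[OF p that a])
      show "drift p z = c1" if "norm z = 1" for z :: "real^'n" unfolding c1_def by (rule drift_eq[OF p that a])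
      show "2 * M \<le> K * R^2" using R by (simp add: K_def)
      show "256 * G \<le> C * \<kappa>" using \<kappa> by (simp add: C_def)
      show "100 \<le> \<Lambda>" by (simp add: \<Lambda>_def)
      have "\<kappa> * (128 / \<kappa>) \<le> \<kappa> * \<Lambda>" using \<kappa> by (intro mult_left_mono) (auto simp: \<Lambda>_def)
      then show "128 \<le> \<kappa> * \<Lambda>" using \<kappa> by simp
      have "exp (ln (4 / \<beta>)) \<le> exp (lam / 4)" by (simp add: lam_def)
      then have "\<beta> * (4 / \<beta>) \<le> \<beta> * exp (lam / 4)" using \<beta> by (intro mult_left_mono) auto
      then show "4 \<le> \<beta> * exp (lam / 4)" using \<beta> by simp
      have "exp (lam * \<Lambda>) * exp (- lam * \<Lambda>) = 1" by (simp add: exp_add[symmetric])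
      then show "3 * C + G \<le> A * exp (- lam * \<Lambda>)" by (simp only: A_def mult.assoc) simp
      show "2 * (2 * C + A + G) \<le> \<beta> * J" using \<beta> by (simp add: J_def)
    qed (use nn M in \<open>auto simp: \<kappa>_def \<beta>_def G_def\<close>)
    define d where "d = dist x0 y"
    have d: "0 \<le> d" by (simp add: d_def)
    define s where "s = sqrt eps + sqrt d"
    have se: "0 \<le> sqrt eps" "0 \<le> sqrt d" using eps d by simp_all
    show ?thesis
    proof (cases "d \<le> 1")
      case True
      have "d^2 \<le> d" using d True by (simp add: power2_eq_square mult_left_le)
      moreover have "d \<le> sqrt d" by (rule real_le_rsqrt) (fact \<open>d^2 \<le> d\<close>)
      ultimately have d2: "d^2 \<le> s" using se(1) unfolding s_def by linarith
      have n: "norm (x0 - y) = d" "norm (y - x0) = d" by (simp_all add: d_def dist_norm norm_minus_commute)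
      have "A * sqrt eps * (1 - exp (- lam * d / eps)) \<le> A * sqrt eps * 1"
        using nn se by (intro mult_left_mono) auto
      also have "\<dots> \<le> A * s" using nn se by (simp add: s_def mult_left_mono)
      finally have 1: "A * sqrt eps * (1 - exp (- lam * d / eps)) \<le> A * s" .
      have 2: "J * sqrt eps \<le> J * s" "C * sqrt d \<le> C * s" "K * d^2 \<le> K * s"
        using nn se d2 by (simp_all add: s_def mult_left_mono)
      have 3: "0 \<le> 2 * M * s" using M se by (simp add: s_def)
      have "u x0 - u y \<le> L * s" "u y - u x0 \<le> L * s"
        using comparison[of x0 y] comparison[of y x0] 1 2 3
        unfolding \<Psi>_def n L_def distrib_right by simp_all
      then show ?thesis by (simp add: abs_le_iff s_def d_def)
    next
      case False
      have "\<bar>u x0 - u y\<bar> \<le> 2 * M" using u_bound[of x0] u_bound[of y] by linarith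
      also have "\<dots> \<le> L * 1" using nn by (simp add: L_def)
      also have "\<dots> \<le> L * s"
      proof (rule mult_left_mono)
        have "1 \<le> sqrt d" using False by simp
        then show "1 \<le> s" using se(1) unfolding s_def by linarith
      qed (use nn M in \<open>simp add: L_def\<close>)
      finally show ?thesis by (simp add: s_def d_def)
    qed
  qed
  moreover have "0 \<le> L" using nn M by (simp add: L_def)
  ultimately show ?thesis by blast
qed

section \<open>Solutions of the dynamic programming principle\<close>

lemma open_eps_nbhd: "open (eps_nbhd eps \<Omega>)"
  unfolding eps_nbhd_def by (intro open_Collect_less continuous_intros)

lemma step_in_eps_nbhd:
  assumes "x \<in> \<Omega>" "0 < eps" "norm h < 1"
  shows "x + eps *\<^sub>R h \<in> eps_nbhd eps \<Omega>"
proof -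
  have "infdist (x + eps *\<^sub>R h) \<Omega> \<le> dist (x + eps *\<^sub>R h) x" by (rule infdist_le[OF assms(1)])
  also have "\<dots> = eps * norm h" using assms by (simp add: dist_norm)
  also have "\<dots> < eps" using assms by simp
  finally show ?thesis by (simp add: eps_nbhd_def)
qed

text \<open>Values outside \<open>eps_nbhd eps \<Omega>\<close> are unconstrained, possibly not even measurable, and irrelevant
  at points of \<open>\<Omega>\<close>.\<close>

definition zero_extension :: "'a set \<Rightarrow> ('a \<Rightarrow> real) \<Rightarrow> 'a \<Rightarrow> real" where
  "zero_extension S u x = indicator S x * u x"

lemma zero_extension_measurable:
  assumes "u \<in> borel_measurable (restrict_space borel (eps_nbhd eps \<Omega>))"
  shows "zero_extension (eps_nbhd eps \<Omega>) u \<in> borel_measurable borel"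
  using assms borel_measurable_restrict_space_iff[of "eps_nbhd eps \<Omega>" borel u] borel_open[OF open_eps_nbhd[of eps \<Omega>]]
  by (simp add: zero_extension_def[abs_def])

lemma zero_extension_eq: "x \<in> \<Omega> \<Longrightarrow> 0 < eps \<Longrightarrow> zero_extension (eps_nbhd eps \<Omega>) u x = u x"
  using step_in_eps_nbhd[of x \<Omega> eps 0] by (simp add: zero_extension_def)

lemma avg_op_zero_extension:
  assumes "1 < p" "p < 2" "x \<in> \<Omega>" "0 < eps"
  shows "avg_op p eps z u x = mean p z (\<lambda>h. zero_extension (eps_nbhd eps \<Omega>) u (x + eps *\<^sub>R h))"
  unfolding avg_op_eq_mean using assms
  by (intro mean_cong[OF assms(1,2)]) (simp add: zero_extension_def step_in_eps_nbhd)

lemma dpp_at_zero_extension: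
  assumes p: "1 < p" "p < 2" and eps: "0 < eps" and dpp: "solves_DPP p eps \<Omega> f u" and x: "x \<in> \<Omega>"
  shows "dpp_at p eps f (zero_extension (eps_nbhd eps \<Omega>) u) x"
  using dpp[unfolded solves_DPP_def, rule_format, OF x]
  unfolding dpp_at_def zero_extension_eq[OF x eps] avg_op_zero_extension[OF p x eps] .

lemma dpp_ball_zero_extension:
  fixes u f :: "real^'n \<Rightarrow> real"
  assumes p: "1 < p" "p < 2" and R: "0 < R" "R \<le> 1" and eps: "0 < eps" "eps < 1"
    and meas: "u \<in> borel_measurable (restrict_space borel (eps_nbhd eps \<Omega>))"
    and bound: "\<And>x. x \<in> eps_nbhd eps \<Omega> \<Longrightarrow> \<bar>u x\<bar> \<le> M" and M: "0 \<le> M"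
    and f: "\<And>x. x \<in> \<Omega> \<Longrightarrow> \<bar>f x\<bar> \<le> Mf" and dpp: "solves_DPP p eps \<Omega> f u" and ball: "ball x0 R \<subseteq> \<Omega>"
  shows "dpp_ball p eps R M Mf (zero_extension (eps_nbhd eps \<Omega>) u) f x0"
proof
  show "zero_extension (eps_nbhd eps \<Omega>) u \<in> borel_measurable borel" by (rule zero_extension_measurable[OF meas])
  show "\<bar>zero_extension (eps_nbhd eps \<Omega>) u x\<bar> \<le> M" for x
    using bound M by (simp add: zero_extension_def indicator_def)
  fix x assume "x \<in> ball x0 R"
  then have x: "x \<in> \<Omega>" using ball by blast
  then show "\<bar>f x\<bar> \<le> Mf" by (rule f)
  show "dpp_at p eps f (zero_extension (eps_nbhd eps \<Omega>) u) x"
    by (rule dpp_at_zero_extension[OF p eps(1) dpp x])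
qed (use p R eps in auto)

section \<open>Compactness\<close>

text \<open>The functions may be discontinuous, but their failure of equicontinuity is of order
  \<open>sqrt (e n)\<close>, which tends to 0, so the classical argument survives: pointwise
  convergence on a countable dense set, then finitely many balls. \<open>y\<close> ranges over
  \<open>\<Omega>\<close> because dense points near \<open>K\<close> need not lie in
  \<open>K\<close>.\<close>

lemma asymptotic_Arzela_Ascoli:
  fixes v :: "nat \<Rightarrow> 'a::euclidean_space \<Rightarrow> real" and e :: "nat \<Rightarrow> real"
  assumes e: "e \<longlonglongrightarrow> 0" and bounded: "\<And>n x. x \<in> \<Omega> \<Longrightarrow> \<bar>v n x\<bar> \<le> M"
    and mod: "\<And>K. compact K \<Longrightarrow> K \<subseteq> \<Omega> \<Longrightarrow>
      \<exists>L\<ge>0. \<forall>n. \<forall>x\<in>K. \<forall>y\<in>\<Omega>. \<bar>v n x - v n y\<bar> \<le> L * (sqrt (e n) + sqrt (dist x y))"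
  obtains k u where "strict_mono (k :: nat \<Rightarrow> nat)"
    "\<And>K. compact K \<Longrightarrow> K \<subseteq> \<Omega> \<Longrightarrow> uniform_limit K (\<lambda>n. v (k n)) u sequentially"
    "\<And>K. compact K \<Longrightarrow> K \<subseteq> \<Omega> \<Longrightarrow> \<exists>L\<ge>0. \<forall>x\<in>K. \<forall>y\<in>\<Omega>. \<bar>u x - u y\<bar> \<le> L * sqrt (dist x y)"
proof -
  obtain D where D: "countable D" "D \<subseteq> \<Omega>" "\<Omega> \<subseteq> closure D" by (rule separable)
  have "\<And>n x. x \<in> D \<Longrightarrow> norm (v n x) \<le> M" using bounded D(2) by auto
  then obtain k where k: "strict_mono (k :: nat \<Rightarrow> nat)"
    and lim: "\<And>x. x \<in> D \<Longrightarrow> \<exists>l. (\<lambda>n. v (k n) x) \<longlonglongrightarrow> l"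
    using function_convergent_subsequence[OF D(1), of v M] by blast
  have ek: "(\<lambda>n. sqrt (e (k n))) \<longlonglongrightarrow> 0"
    using tendsto_real_sqrt[OF LIMSEQ_subseq_LIMSEQ[OF e k]] by (simp add: o_def)
  have unif: "uniformly_convergent_on K (\<lambda>n. v (k n))" if K: "compact K" "K \<subseteq> \<Omega>" for K
  proof (rule Cauchy_uniformly_convergent, unfold uniformly_Cauchy_on_def, intro allI impI)
    fix \<eta> :: real assume \<eta>: "0 < \<eta>"
    obtain L where L: "0 \<le> L" "\<And>n x y. x \<in> K \<Longrightarrow> y \<in> \<Omega> \<Longrightarrow> \<bar>v n x - v n y\<bar> \<le> L * (sqrt (e n) + sqrt (dist x y))"
      using mod[OF K] by blast
    \<comment> \<open>Radius \<open>q^2\<close> makes the square root of the distance at most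
      \<open>q\<close>, and \<open>L * (q + q)\<close> does not exceed \<open>\<eta> / 4\<close>;
      the added 1 covers \<open>L = 0\<close>.\<close>
    define q where "q = \<eta> / (8 * (L + 1))"
    have q: "0 < q" "L * q \<le> \<eta> / 8" using \<eta> L by (auto simp: q_def field_simps)
    have "K \<subseteq> (\<Union>d\<in>D. ball d (q^2))"
    proof
      fix x assume "x \<in> K"
      then have "x \<in> closure D" using K D by blast
      moreover have "0 < q^2" using q by simp
      ultimately obtain d where "d \<in> D" "dist d x < q^2" using closure_approachable[of x D] by blast
      then show "x \<in> (\<Union>d\<in>D. ball d (q^2))" by auto
    qed
    then obtain F where F: "F \<subseteq> D" "finite F" "K \<subseteq> (\<Union>d\<in>F. ball d (q^2))"
      using compactE_image[OF K(1), of D "\<lambda>d. ball d (q^2)"] by auto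
    have "\<exists>N. \<forall>m\<ge>N. \<forall>n\<ge>N. dist (v (k m) d) (v (k n) d) < \<eta> / 4" if "d \<in> F" for d
    proof -
      have "Cauchy (\<lambda>n. v (k n) d)" using lim[of d] F(1) that by (auto intro: LIMSEQ_imp_Cauchy)
      moreover have "0 < \<eta> / 4" using \<eta> by simp
      ultimately show ?thesis unfolding Cauchy_def by blast
    qed
    then obtain N where N: "\<And>d m n. d \<in> F \<Longrightarrow> N d \<le> m \<Longrightarrow> N d \<le> n \<Longrightarrow> dist (v (k m) d) (v (k n) d) < \<eta> / 4"
      by metis
    have "\<forall>\<^sub>F n in sequentially. dist (sqrt (e (k n))) 0 < q" using ek q by (auto dest: tendstoD)
    then obtain N' where "\<And>n. N' \<le> n \<Longrightarrow> \<bar>sqrt (e (k n))\<bar> < q"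
      by (auto simp: eventually_sequentially dist_real_def)
    then have N': "\<And>n. N' \<le> n \<Longrightarrow> sqrt (e (k n)) < q" unfolding abs_less_iff by blast
    have "dist (v (k m) x) (v (k n) x) < \<eta>"
      if x: "x \<in> K" and m: "Max (insert N' (N ` F)) \<le> m" and n: "Max (insert N' (N ` F)) \<le> n" for x m n
    proof -
      obtain d where d: "d \<in> F" "dist d x < q^2" using F(3) x by auto
      have "sqrt (dist x d) \<le> sqrt (q^2)" using d by (intro real_sqrt_le_mono) (simp add: dist_commute)
      then have sd: "sqrt (dist x d) \<le> q" using q by simp
      have N2: "N' \<le> m" "N d \<le> m" "N' \<le> n" "N d \<le> n" using m n d F(2) by auto
      have *: "\<bar>v (k j) x - v (k j) d\<bar> \<le> \<eta> / 4" if "N' \<le> j" for j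
      proof -
        have "\<bar>v (k j) x - v (k j) d\<bar> \<le> L * (sqrt (e (k j)) + sqrt (dist x d))"
          using L(2)[OF x] d F(1) D(2) by blast
        also have "\<dots> \<le> L * (q + q)" using N'[OF that] sd L(1) by (intro mult_left_mono) auto
        finally show ?thesis using q by (simp add: distrib_left)
      qed
      show ?thesis using *[OF N2(1)] *[OF N2(3)] N[OF d(1) N2(2,4)] unfolding dist_real_def by linarith
    qed
    then show "\<exists>M. \<forall>x\<in>K. \<forall>m\<ge>M. \<forall>n\<ge>M. dist (v (k m) x) (v (k n) x) < \<eta>" by blast
  qed
  define u where "u x = lim (\<lambda>n. v (k n) x)" for x
  have ul: "uniform_limit K (\<lambda>n. v (k n)) u sequentially" if "compact K" "K \<subseteq> \<Omega>" for K
    using unif[OF that] unfolding uniformly_convergent_uniform_limit_iff u_def[abs_def] .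
  have pt: "(\<lambda>n. v (k n) x) \<longlonglongrightarrow> u x" if "x \<in> \<Omega>" for x
    using tendsto_uniform_limitI[OF ul[of "{x}"]] that by simp
  have "\<exists>L\<ge>0. \<forall>x\<in>K. \<forall>y\<in>\<Omega>. \<bar>u x - u y\<bar> \<le> L * sqrt (dist x y)" if K: "compact K" "K \<subseteq> \<Omega>" for K
  proof -
    obtain L where L: "0 \<le> L" "\<And>n x y. x \<in> K \<Longrightarrow> y \<in> \<Omega> \<Longrightarrow> \<bar>v n x - v n y\<bar> \<le> L * (sqrt (e n) + sqrt (dist x y))"
      using mod[OF K] by blast
    have "\<bar>u x - u y\<bar> \<le> L * sqrt (dist x y)" if x: "x \<in> K" and y: "y \<in> \<Omega>" for x y
    proof (rule tendsto_le[OF sequentially_bot])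
      show "(\<lambda>n. \<bar>v (k n) x - v (k n) y\<bar>) \<longlonglongrightarrow> \<bar>u x - u y\<bar>"
        using x y K by (intro tendsto_intros pt) auto
      have "(\<lambda>n. L * (sqrt (e (k n)) + sqrt (dist x y))) \<longlonglongrightarrow> L * (0 + sqrt (dist x y))"
        by (intro tendsto_intros ek)
      then show "(\<lambda>n. L * (sqrt (e (k n)) + sqrt (dist x y))) \<longlonglongrightarrow> L * sqrt (dist x y)" by simp
    qed (use L(2)[OF x y] in simp)
    then show ?thesis using L(1) by blast
  qed
  with k ul show ?thesis by (rule that) 
qed

section \<open>Second order Taylor expansion and eigenvalues\<close>

lemma grad_has_derivative:
  fixes \<phi> :: "real^'n \<Rightarrow> real"
  assumes "\<phi> differentiable (at x)"
  shows "(\<phi> has_derivative (\<lambda>k. grad \<phi> x \<bullet> k)) (at x)"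
proof -
  have D: "(\<phi> has_derivative frechet_derivative \<phi> (at x)) (at x)"
    using assms frechet_derivative_works by blast
  then have lin: "linear (frechet_derivative \<phi> (at x))" by (rule has_derivative_linear)
  have "frechet_derivative \<phi> (at x) k = grad \<phi> x \<bullet> k" for k
  proof -
    have "frechet_derivative \<phi> (at x) k = frechet_derivative \<phi> (at x) (\<Sum>i\<in>UNIV. k $ i *\<^sub>R axis i 1)"
      using basis_expansion[of k] by (simp add: scalar_mult_eq_scaleR)
    also have "\<dots> = (\<Sum>i\<in>UNIV. k $ i * frechet_derivative \<phi> (at x) (axis i 1))"
      by (simp add: linear_sum[OF lin] linear_cmul[OF lin])
    also have "\<dots> = grad \<phi> x \<bullet> k" by (simp add: grad_def inner_vec_def mult.commute)
    finally show ?thesis .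
  qed
  then have "frechet_derivative \<phi> (at x) = (\<lambda>k. grad \<phi> x \<bullet> k)" by (rule ext)
  then show ?thesis using D by simp
qed

lemma hess_has_derivative:
  fixes \<phi> :: "real^'n \<Rightarrow> real"
  assumes "grad \<phi> differentiable (at x)"
  shows "(grad \<phi> has_derivative (\<lambda>k. hess \<phi> x *v k)) (at x)"
  using assms jacobian_works unfolding hess_def by blast

lemma quadratic_form_le:
  fixes M :: "real^'n^'n"
  shows "\<bar>k \<bullet> (M *v k)\<bar> \<le> real CARD('n) * real CARD('n) * norm M * (norm k)^2"
proof -
  have "\<bar>k \<bullet> (M *v k)\<bar> = \<bar>\<Sum>i\<in>UNIV. \<Sum>j\<in>UNIV. k $ i * (M $ i $ j * k $ j)\<bar>"
    by (simp add: inner_vec_def matrix_vector_mult_def sum_distrib_left)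
  also have "\<dots> \<le> (\<Sum>i\<in>UNIV. \<bar>\<Sum>j\<in>UNIV. k $ i * (M $ i $ j * k $ j)\<bar>)" by (rule sum_abs)
  also have "\<dots> \<le> (\<Sum>i\<in>(UNIV::'n set). \<Sum>j\<in>(UNIV::'n set). norm k * (norm M * norm k))"
  proof (rule sum_mono)
    fix i :: 'n
    have "\<bar>\<Sum>j\<in>UNIV. k $ i * (M $ i $ j * k $ j)\<bar> \<le> (\<Sum>j\<in>UNIV. \<bar>k $ i * (M $ i $ j * k $ j)\<bar>)" by (rule sum_abs)
    also have "\<dots> \<le> (\<Sum>j\<in>(UNIV::'n set). norm k * (norm M * norm k))"
    proof (rule sum_mono)
      fix j :: 'n
      have "\<bar>M $ i $ j\<bar> \<le> norm (M $ i)" by (rule component_le_norm_cart)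
      also have "\<dots> \<le> norm M" by (rule Finite_Cartesian_Product.norm_nth_le)
      finally show "\<bar>k $ i * (M $ i $ j * k $ j)\<bar> \<le> norm k * (norm M * norm k)"
        unfolding abs_mult by (intro mult_mono component_le_norm_cart) auto
    qed
    finally show "\<bar>\<Sum>j\<in>UNIV. k $ i * (M $ i $ j * k $ j)\<bar> \<le> (\<Sum>j\<in>(UNIV::'n set). norm k * (norm M * norm k))" .
  qed
  also have "\<dots> = real CARD('n) * real CARD('n) * norm M * (norm k)^2" by (simp add: power2_eq_square)
  finally show ?thesis .
qed

text \<open>The gradient is taken at the moving point but the Hessian at \<open>x0\<close>,
  uniformly for nearby points: the formula is applied at almost minima that vary with
  \<open>eps\<close>, and the quadratic part should stay the same along them.\<close>

lemma C2_on_taylor: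
  fixes \<phi> :: "real^'n \<Rightarrow> real"
  assumes C2: "C2_on \<Omega> \<phi>" and \<Omega>: "open \<Omega>" "x0 \<in> \<Omega>" and \<eta>: "0 < \<eta>"
  shows "\<exists>\<rho>>0. \<forall>x\<in>ball x0 \<rho>. \<forall>k. norm k < \<rho> \<longrightarrow>
      \<bar>\<phi> (x + k) - \<phi> x - grad \<phi> x \<bullet> k - (k \<bullet> (hess \<phi> x0 *v k)) / 2\<bar> \<le> \<eta> * (norm k)^2"
proof -
  define c where "c = real CARD('n) * real CARD('n)"
  have c: "0 < c" by (simp add: c_def)
  have "isCont (hess \<phi>) x0"
    using C2 \<Omega> by (auto simp: C2_on_def continuous_on_eq_continuous_at)
  then obtain d where d: "0 < d" "\<And>y. dist y x0 < d \<Longrightarrow> dist (hess \<phi> y) (hess \<phi> x0) < \<eta> / c"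
    unfolding continuous_at_eps_delta using \<eta> c by (meson divide_pos_pos)
  obtain d' where d': "0 < d'" "ball x0 d' \<subseteq> \<Omega>" using \<Omega> open_contains_ball by blast
  define \<rho> where "\<rho> = min d d' / 2"
  have \<rho>: "0 < \<rho>" "2 * \<rho> \<le> d" "2 * \<rho> \<le> d'" using d d' by (auto simp: \<rho>_def)
  have "\<bar>\<phi> (x + k) - \<phi> x - grad \<phi> x \<bullet> k - (k \<bullet> (hess \<phi> x0 *v k)) / 2\<bar> \<le> \<eta> * (norm k)^2"
    if x: "x \<in> ball x0 \<rho>" and k: "norm k < \<rho>" for x k
  proof -
    have near: "dist (x + t *\<^sub>R k) x0 < 2 * \<rho>" if "0 \<le> t" "t \<le> 1" for t
    proof -
      have "dist (x + t *\<^sub>R k) x0 \<le> norm (x - x0) + norm (t *\<^sub>R k)"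
        using norm_triangle_ineq[of "x - x0" "t *\<^sub>R k"] by (simp add: dist_norm algebra_simps)
      moreover have "norm (t *\<^sub>R k) \<le> 1 * norm k" using mult_right_mono[of t 1 "norm k"] that by simp
      ultimately show ?thesis using x k by (simp add: dist_norm norm_minus_commute)
    qed
    then have in\<Omega>: "x + t *\<^sub>R k \<in> \<Omega>" if "0 \<le> t" "t \<le> 1" for t
      using near[OF that] \<rho> d' by (auto simp: dist_commute)
    define D where "D m t = (if m = (0::nat) then \<phi> (x + t *\<^sub>R k) else if m = 1 then grad \<phi> (x + t *\<^sub>R k) \<bullet> k
      else (hess \<phi> (x + t *\<^sub>R k) *v k) \<bullet> k)" for m t
    have "\<exists>t::real. 0 < t \<and> t < 1 \<and> D 0 1 = (\<Sum>m<2. D m 0 / fact m * (1 - 0) ^ m) + D 2 t / fact 2 * (1 - 0) ^ 2"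
    proof (rule Taylor_up)
      show "\<forall>m t. m < 2 \<and> 0 \<le> t \<and> t \<le> (1::real) \<longrightarrow> (D m has_real_derivative D (Suc m) t) (at t)"
      proof (intro allI impI)
        fix m :: nat and t :: real
        assume "m < 2 \<and> 0 \<le> t \<and> t \<le> 1"
        then have m: "m = 0 \<or> m = 1" and t: "x + t *\<^sub>R k \<in> \<Omega>" using in\<Omega> by auto
        have line: "((\<lambda>t. x + t *\<^sub>R k) has_derivative (\<lambda>s. s *\<^sub>R k)) (at t)"
          by (auto intro!: derivative_eq_intros)
        have "(\<phi> has_derivative (\<lambda>k'. grad \<phi> (x + t *\<^sub>R k) \<bullet> k')) (at (x + t *\<^sub>R k))"
          using C2 t by (intro grad_has_derivative) (auto simp: C2_on_def)
        from diff_chain_at[OF line this] have 0: "((\<lambda>t. \<phi> (x + t *\<^sub>R k)) has_derivative (\<lambda>s. grad \<phi> (x + t *\<^sub>R k) \<bullet> (s *\<^sub>R k))) (at t)"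
          by (simp add: o_def)
        have "(grad \<phi> has_derivative (\<lambda>k'. hess \<phi> (x + t *\<^sub>R k) *v k')) (at (x + t *\<^sub>R k))"
          using C2 t by (intro hess_has_derivative) (auto simp: C2_on_def)
        from diff_chain_at[OF line this] have "((\<lambda>t. grad \<phi> (x + t *\<^sub>R k)) has_derivative (\<lambda>s. hess \<phi> (x + t *\<^sub>R k) *v (s *\<^sub>R k))) (at t)"
          by (simp add: o_def)
        then have 1: "((\<lambda>t. grad \<phi> (x + t *\<^sub>R k) \<bullet> k) has_derivative (\<lambda>s. (hess \<phi> (x + t *\<^sub>R k) *v (s *\<^sub>R k)) \<bullet> k)) (at t)"
          by (rule has_derivative_inner_left)
        show "(D m has_real_derivative D (Suc m) t) (at t)"
          using m
        proof
          assume m: "m = 0"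
          show ?thesis using 0 unfolding has_field_derivative_def m D_def
            by (simp add: mult.commute[of _ "grad \<phi> (x + t *\<^sub>R k) \<bullet> k"] fun_eq_iff)
        next
          assume m: "m = 1"
          have "(\<lambda>s. (hess \<phi> (x + t *\<^sub>R k) *v (s *\<^sub>R k)) \<bullet> k) = (*) ((hess \<phi> (x + t *\<^sub>R k) *v k) \<bullet> k)"
            by (rule ext) (simp add: matrix_vector_mult_scaleR mult.commute)
          then show ?thesis using 1 unfolding has_field_derivative_def m D_def by simp
        qed
      qed
    qed auto
    then obtain t where t: "0 < t" "t < 1" and T: "\<phi> (x + k) = \<phi> x + grad \<phi> x \<bullet> k + (k \<bullet> (hess \<phi> (x + t *\<^sub>R k) *v k)) / 2"
      by (auto simp: D_def numeral_2_eq_2 inner_commute)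
    have "norm (hess \<phi> (x + t *\<^sub>R k) - hess \<phi> x0) < \<eta> / c"
      using d(2)[of "x + t *\<^sub>R k"] near[of t] t \<rho> by (simp add: dist_norm)
    then have "c * norm (hess \<phi> (x + t *\<^sub>R k) - hess \<phi> x0) * (norm k)^2 \<le> \<eta> * (norm k)^2"
      using c by (intro mult_right_mono) (auto simp: field_simps)
    with quadratic_form_le[of k "hess \<phi> (x + t *\<^sub>R k) - hess \<phi> x0"]
    have "\<bar>k \<bullet> ((hess \<phi> (x + t *\<^sub>R k) - hess \<phi> x0) *v k)\<bar> \<le> \<eta> * (norm k)^2" by (simp add: c_def)
    moreover have "0 \<le> \<eta> * (norm k)^2" using \<eta> by simp
    moreover have "k \<bullet> ((hess \<phi> (x + t *\<^sub>R k) - hess \<phi> x0) *v k)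
      = k \<bullet> (hess \<phi> (x + t *\<^sub>R k) *v k) - k \<bullet> (hess \<phi> x0 *v k)"
      by (simp add: matrix_vector_mult_diff_rdistrib inner_diff_right)
    ultimately show ?thesis unfolding T by (simp add: abs_le_iff)
  qed
  then show ?thesis using \<rho>(1) by blast
qed

lemma C2_on_isCont_grad:
  "C2_on \<Omega> \<phi> \<Longrightarrow> x \<in> \<Omega> \<Longrightarrow> isCont (grad \<phi>) x"
  by (auto simp: C2_on_def intro: differentiable_imp_continuous_within)

text \<open>The second difference of \<open>\<phi>\<close> in the directions \<open>a\<close>, \<open>b\<close> is symmetric in \<open>a\<close> and \<open>b\<close>, and
  equals \<open>(hess \<phi> x *v a) \<bullet> b\<close> to leading order.\<close>

lemma hess_symmetric:
  fixes \<phi> :: "real^'n \<Rightarrow> real"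
  assumes C2: "C2_on \<Omega> \<phi>" and \<Omega>: "open \<Omega>" "x \<in> \<Omega>"
  shows "(hess \<phi> x *v a) \<bullet> b = (hess \<phi> x *v b) \<bullet> a"
proof -
  define H where "H = hess \<phi> x"
  define S where "S = norm a + norm b + 1"
  have S: "0 < S" "norm a \<le> S" "norm b \<le> S" by (auto simp: S_def intro: add_nonneg_pos)
  have "\<bar>(H *v a) \<bullet> b - (H *v b) \<bullet> a\<bar> \<le> 6 * \<eta> * S^2" if \<eta>: "0 < \<eta>" for \<eta>
  proof -
    obtain \<rho> where \<rho>: "0 < \<rho>" and T: "\<And>y k. y \<in> ball x \<rho> \<Longrightarrow> norm k < \<rho> \<Longrightarrow>
        \<bar>\<phi> (y + k) - \<phi> y - grad \<phi> y \<bullet> k - (k \<bullet> (H *v k)) / 2\<bar> \<le> \<eta> * (norm k)^2"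
      using C2_on_taylor[OF C2 \<Omega> \<eta>] unfolding H_def by blast
    have "(grad \<phi> has_derivative (\<lambda>k. H *v k)) (at x)"
      unfolding H_def using C2 \<Omega> by (intro hess_has_derivative) (auto simp: C2_on_def)
    then obtain d where d: "0 < d" and L: "\<And>y. norm (y - x) < d \<Longrightarrow>
        norm (grad \<phi> y - grad \<phi> x - H *v (y - x)) \<le> \<eta> * norm (y - x)"
      unfolding has_derivative_at_alt using \<eta> by blast
    define t where "t = min \<rho> d / (2 * S)"
    have t: "0 < t" "t * S < \<rho>" "t * S < d" using \<rho> d S by (auto simp: t_def min_def field_simps)
    \<comment> \<open>The second difference is a difference of two expansions in
      \<open>t *\<^sub>R l\<close>, whose quadratic parts agree and cancel; three errors of size
      \<open>\<eta> * (t * S)^2\<close> remain, the third from differentiating the gradient.\<close>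
    have *: "\<bar>\<phi> (x + t *\<^sub>R k + t *\<^sub>R l) - \<phi> (x + t *\<^sub>R k) - \<phi> (x + t *\<^sub>R l) + \<phi> x - t^2 * ((H *v k) \<bullet> l)\<bar> \<le> 3 * \<eta> * S^2 * t^2"
      if k: "norm k \<le> S" and l: "norm l \<le> S" for k l
    proof -
      have ns: "norm (t *\<^sub>R k) \<le> t * S" "norm (t *\<^sub>R l) \<le> t * S" using k l t by simp_all
      have kr: "norm (t *\<^sub>R k) < \<rho>" "norm (t *\<^sub>R l) < \<rho>" and kd: "norm (t *\<^sub>R k) < d"
        using ns t by linarith+
      have sq: "\<eta> * (norm (t *\<^sub>R l))^2 \<le> \<eta> * (t * S)^2" using ns(2) \<eta> by (intro mult_left_mono power_mono) auto
      have 1: "\<bar>\<phi> (x + t *\<^sub>R k + t *\<^sub>R l) - \<phi> (x + t *\<^sub>R k) - grad \<phi> (x + t *\<^sub>R k) \<bullet> (t *\<^sub>R l) - ((t *\<^sub>R l) \<bullet> (H *v (t *\<^sub>R l))) / 2\<bar> \<le> \<eta> * (t * S)^2"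
        by (rule order_trans[OF T[OF _ kr(2)] sq]) (use kr(1) in \<open>simp add: dist_norm\<close>)
      have 2: "\<bar>\<phi> (x + t *\<^sub>R l) - \<phi> x - grad \<phi> x \<bullet> (t *\<^sub>R l) - ((t *\<^sub>R l) \<bullet> (H *v (t *\<^sub>R l))) / 2\<bar> \<le> \<eta> * (t * S)^2"
        by (rule order_trans[OF T[OF _ kr(2)] sq]) (use \<rho> in simp)
      have "norm (grad \<phi> (x + t *\<^sub>R k) - grad \<phi> x - H *v (t *\<^sub>R k)) \<le> \<eta> * norm (t *\<^sub>R k)"
        using L[of "x + t *\<^sub>R k"] kd by simp
      also have "\<dots> \<le> \<eta> * (t * S)" using ns(1) \<eta> by (intro mult_left_mono) auto
      finally have "norm (grad \<phi> (x + t *\<^sub>R k) - grad \<phi> x - H *v (t *\<^sub>R k)) * norm (t *\<^sub>R l) \<le> \<eta> * (t * S) * (t * S)"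
        using ns t S \<eta> by (intro mult_mono) auto
      then have "\<bar>(grad \<phi> (x + t *\<^sub>R k) - grad \<phi> x - H *v (t *\<^sub>R k)) \<bullet> (t *\<^sub>R l)\<bar> \<le> \<eta> * (t * S) * (t * S)"
        using Cauchy_Schwarz_ineq2 order_trans by blast
      then have 3: "\<bar>grad \<phi> (x + t *\<^sub>R k) \<bullet> (t *\<^sub>R l) - grad \<phi> x \<bullet> (t *\<^sub>R l) - (H *v (t *\<^sub>R k)) \<bullet> (t *\<^sub>R l)\<bar> \<le> \<eta> * (t * S)^2"
        by (simp only: inner_diff_left power2_eq_square mult.assoc)
      have "(H *v (t *\<^sub>R k)) \<bullet> (t *\<^sub>R l) = t^2 * ((H *v k) \<bullet> l)"
        by (simp add: matrix_vector_mult_scaleR power2_eq_square)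
      moreover have "3 * \<eta> * S^2 * t^2 = 3 * (\<eta> * (t * S)^2)" by (simp add: power_mult_distrib)
      ultimately show ?thesis using 1 2 3 by linarith
    qed
    have sw: "x + t *\<^sub>R b + t *\<^sub>R a = x + t *\<^sub>R a + t *\<^sub>R b" by simp
    have "\<bar>t^2 * ((H *v a) \<bullet> b) - t^2 * ((H *v b) \<bullet> a)\<bar> \<le> 2 * (3 * \<eta> * S^2 * t^2)"
      using *[OF S(2,3)] *[OF S(3,2)] unfolding sw by linarith
    then have "t^2 * \<bar>(H *v a) \<bullet> b - (H *v b) \<bullet> a\<bar> \<le> t^2 * (6 * \<eta> * S^2)"
      unfolding right_diff_distrib[symmetric] abs_mult by (simp add: mult_ac)
    then show ?thesis using t(1) by (subst (asm) mult_le_cancel_left_pos) auto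
  qed note bnd = this
  have "\<bar>(H *v a) \<bullet> b - (H *v b) \<bullet> a\<bar> \<le> 0 + \<tau>" if \<tau>: "0 < \<tau>" for \<tau>
    using bnd[of "\<tau> / (6 * S^2)"] \<tau> S by simp
  then have "\<bar>(H *v a) \<bullet> b - (H *v b) \<bullet> a\<bar> \<le> 0" by (rule field_le_epsilon)
  then show ?thesis by (simp add: H_def)
qed

section \<open>Extreme eigenvalues as bounds of the quadratic form\<close>

text \<open>Eigenvectors of different eigenvalues are orthogonal, so a choice of one per eigenvalue
  is independent. Finiteness gives \<open>Max\<close> and \<open>Min\<close> their meaning.\<close>

lemma eigenvalues_finite:
  fixes H :: "real^'n^'n"
  assumes sym: "\<And>a b. (H *v a) \<bullet> b = (H *v b) \<bullet> a"
  shows "finite (eigenvalues H)"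
proof -
  have "\<forall>l\<in>eigenvalues H. \<exists>v. v \<noteq> 0 \<and> H *v v = l *\<^sub>R v" by (simp add: eigenvalues_def)
  then obtain v where v: "\<And>l. l \<in> eigenvalues H \<Longrightarrow> v l \<noteq> 0 \<and> H *v v l = l *\<^sub>R v l" by metis
  have orth: "v l \<bullet> v m = 0" if "l \<in> eigenvalues H" "m \<in> eigenvalues H" "l \<noteq> m" for l m
  proof -
    have "l * (v l \<bullet> v m) = m * (v m \<bullet> v l)" using sym[of "v l" "v m"] v that by simp
    then show ?thesis using that(3) by (simp add: inner_commute)
  qed
  have inj: "inj_on v (eigenvalues H)"
    by (rule inj_onI) (metis orth v inner_eq_zero_iff)
  have "pairwise orthogonal (v ` eigenvalues H)"
    using orth by (auto simp: pairwise_def orthogonal_def)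
  then have "independent (v ` eigenvalues H)"
    using v by (intro pairwise_orthogonal_independent) auto
  then have "finite (v ` eigenvalues H)" by (rule independent_imp_finite)
  then show ?thesis using inj by (rule finite_imageD)
qed

text \<open>A maximizer \<open>v\<close> of the form on the sphere is an eigenvector:
  \<open>\<mu> * (z \<bullet> z) - z \<bullet> (H *v z)\<close> is nonnegative and vanishes at
  \<open>v\<close>, so its first variation there is zero.\<close>

lemma quadratic_form_max_eigenvalue:
  fixes H :: "real^'n^'n"
  assumes sym: "\<And>a b. (H *v a) \<bullet> b = (H *v b) \<bullet> a"
  obtains \<mu> where "\<mu> \<in> eigenvalues H" "\<And>z. norm z = 1 \<Longrightarrow> z \<bullet> (H *v z) \<le> \<mu>"
proof -
  have "continuous_on (sphere 0 1) (\<lambda>z. z \<bullet> (H *v z))" by (intro continuous_intros)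
  moreover have "sphere (0::real^'n) 1 \<noteq> {}" by (simp add: sphere_eq_empty)
  ultimately obtain v where v: "v \<in> sphere 0 1" "\<And>z. z \<in> sphere 0 1 \<Longrightarrow> z \<bullet> (H *v z) \<le> v \<bullet> (H *v v)"
    using continuous_attains_sup[of "sphere (0::real^'n) 1" "\<lambda>z. z \<bullet> (H *v z)"] by auto
  define \<mu> where "\<mu> = v \<bullet> (H *v v)"
  have vv: "v \<bullet> v = 1" using v(1) by (simp add: norm_eq_1)
  have le: "z \<bullet> (H *v z) \<le> \<mu> * (z \<bullet> z)" for z
  proof (cases "z = 0")
    case False
    define y where "y = (1 / norm z) *\<^sub>R z"
    have "y \<bullet> (H *v y) \<le> \<mu>" using v(2)[of y] False by (simp add: y_def \<mu>_def)
    moreover have "z = norm z *\<^sub>R y" using False by (simp add: y_def)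
    then have "z \<bullet> (H *v z) = (norm z)^2 * (y \<bullet> (H *v y))"
      by (metis inner_scaleR_left inner_scaleR_right matrix_vector_mult_scaleR mult.assoc power2_eq_square)
    ultimately show ?thesis by (simp add: power2_norm_eq_inner[symmetric] mult.commute mult_right_mono)
  qed (simp)
  have "(H *v v - \<mu> *\<^sub>R v) \<bullet> w = 0" for w
  proof -
    define c where "c = (H *v v - \<mu> *\<^sub>R v) \<bullet> w"
    define d where "d = \<mu> * (w \<bullet> w) - w \<bullet> (H *v w)"
    have *: "2 * t * c \<le> t^2 * d" for t
    proof -
      have "(v + t *\<^sub>R w) \<bullet> (H *v (v + t *\<^sub>R w)) = \<mu> + 2 * t * ((H *v v) \<bullet> w) + t^2 * (w \<bullet> (H *v w))"
        using sym[of v w]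
        by (simp add: matrix_vector_right_distrib matrix_vector_mult_scaleR inner_add_left inner_add_right
            \<mu>_def power2_eq_square inner_commute algebra_simps)
      moreover have "(v + t *\<^sub>R w) \<bullet> (v + t *\<^sub>R w) = 1 + 2 * t * (v \<bullet> w) + t^2 * (w \<bullet> w)"
        by (simp add: inner_add_left inner_add_right vv power2_eq_square inner_commute algebra_simps)
      ultimately show ?thesis using le[of "v + t *\<^sub>R w"]
        by (simp add: c_def d_def inner_diff_left algebra_simps)
    qed
    have d: "0 \<le> d" using le[of w] by (simp add: d_def)
    \<comment> \<open>The inequality holds for all \<open>t\<close>; this value lets the linear term
      win over the quadratic one, and the added 1 avoids dividing by 0.\<close>
    have "2 * (c / (d + 1)) * c \<le> (c / (d + 1))^2 * d" by (rule *)
    also have "\<dots> \<le> (c / (d + 1))^2 * (d + 1)" by (intro mult_left_mono) auto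
    also have "\<dots> = (c / (d + 1)) * c" using d by (simp add: power2_eq_square)
    finally have "c * c / (d + 1) \<le> 0" by simp
    then have "c * c \<le> 0" using d by (simp add: divide_le_0_iff)
    then have "c * c = 0" using zero_le_square[of c] by linarith
    then show ?thesis by (simp add: c_def)
  qed
  then have "H *v v - \<mu> *\<^sub>R v = 0" by (metis inner_eq_zero_iff)
  then have "\<mu> \<in> eigenvalues H" using vv by (auto simp: eigenvalues_def intro!: exI[of _ v])
  moreover have "z \<bullet> (H *v z) \<le> \<mu>" if "norm z = 1" for z using v(2)[of z] that by (simp add: \<mu>_def)
  ultimately show ?thesis by (rule that)
qed

lemma quadratic_form_le_lambda_max:
  fixes H :: "real^'n^'n"
  assumes sym: "\<And>a b. (H *v a) \<bullet> b = (H *v b) \<bullet> a" and z: "norm z = 1"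
  shows "z \<bullet> (H *v z) \<le> lambda_max H"
proof -
  obtain \<mu> where "\<mu> \<in> eigenvalues H" "z \<bullet> (H *v z) \<le> \<mu>"
    using quadratic_form_max_eigenvalue[OF sym] z by metis
  then show ?thesis unfolding lambda_max_def using Max_ge[OF eigenvalues_finite[OF sym]] by force
qed

lemma lambda_max_uminus:
  fixes H :: "real^'n^'n"
  assumes sym: "\<And>a b. (H *v a) \<bullet> b = (H *v b) \<bullet> a"
  shows "lambda_max (- H) = - lambda_min H"
proof -
  have mv: "(- H) *v v = - (H *v v)" for v
    using matrix_vector_mult_diff_rdistrib[of 0 H v] by simp
  have "eigenvalues (- H) = uminus ` eigenvalues H"
  proof (rule set_eqI)
    fix l
    have "l \<in> eigenvalues (- H) \<longleftrightarrow> - l \<in> eigenvalues H"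
      by (auto simp: eigenvalues_def mv minus_equation_iff eq_commute)
    then show "l \<in> eigenvalues (- H) \<longleftrightarrow> l \<in> uminus ` eigenvalues H"
      by (metis image_iff minus_minus)
  qed
  moreover have "eigenvalues H \<noteq> {}"
    using quadratic_form_max_eigenvalue[OF sym] by (metis empty_iff)
  ultimately show ?thesis
    unfolding lambda_max_def lambda_min_def using minus_Min_eq_Max[OF eigenvalues_finite[OF sym]] by metis
qed

section \<open>The limit is a viscosity solution\<close>

text \<open>\<open>G\<close> and \<open>H\<close> stand for gradient and Hessian but enter only
  through the expansion, so the same statement serves \<open>- \<phi>\<close> without
  differentiating it. The first condition on \<open>z\<close> says that it is opposite to
  \<open>G x0\<close> when that is nonzero and is void otherwise. Of the error
  \<open>2 * \<eta>\<close>, one half comes from the expansion and one from the penalty in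
  \<open>w\<close>.\<close>

lemma viscosity_touching:
  fixes v :: "nat \<Rightarrow> real^'n \<Rightarrow> real" and u f \<phi> :: "real^'n \<Rightarrow> real" and G :: "real^'n \<Rightarrow> real^'n"
    and H :: "real^'n^'n"
  assumes p: "1 < p" "p < 2" and e: "\<And>n. 0 < e n" "e \<longlonglongrightarrow> 0"
    and v: "\<And>n. v n \<in> borel_measurable borel" "\<And>n x. \<bar>v n x\<bar> \<le> M"
    and dpp: "\<And>n x. x \<in> \<Omega> \<Longrightarrow> dpp_at p (e n) f (v n) x"
    and ul: "\<And>K. compact K \<Longrightarrow> K \<subseteq> \<Omega> \<Longrightarrow> uniform_limit K v u sequentially"
    and \<Omega>: "open \<Omega>" "x0 \<in> \<Omega>" and f: "isCont f x0" and G: "isCont G x0"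
    and taylor: "\<And>\<eta>. 0 < \<eta> \<Longrightarrow> \<exists>\<rho>>0. \<forall>x\<in>ball x0 \<rho>. \<forall>k. norm k < \<rho> \<longrightarrow>
      \<bar>\<phi> (x + k) - \<phi> x - G x \<bullet> k - (k \<bullet> (H *v k)) / 2\<bar> \<le> \<eta> * (norm k)^2"
    and touch: "\<exists>\<rho>>0. \<forall>x\<in>ball x0 \<rho>. u x0 - \<phi> x0 \<le> u x - \<phi> x"
    and \<eta>: "0 < \<eta>"
  shows "\<exists>z. norm z = 1 \<and> G x0 \<bullet> z \<le> - norm (G x0) \<and>
    (trace H + (p - 2) * (z \<bullet> (H *v z))) / (2 * (real CARD('n) + p)) + f x0 \<le> 2 * \<eta>"
proof -
  define q where "q z = (trace H + (p - 2) * (z \<bullet> (H *v z))) / (2 * (real CARD('n) + p))" for z :: "real^'n"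
  obtain \<rho>1 where \<rho>1: "0 < \<rho>1" "\<And>x k. x \<in> ball x0 \<rho>1 \<Longrightarrow> norm k < \<rho>1 \<Longrightarrow>
      \<bar>\<phi> (x + k) - \<phi> x - G x \<bullet> k - (k \<bullet> (H *v k)) / 2\<bar> \<le> \<eta> * (norm k)^2"
    using taylor[OF \<eta>] by blast
  obtain \<rho>2 where \<rho>2: "0 < \<rho>2" "\<And>x. x \<in> ball x0 \<rho>2 \<Longrightarrow> u x0 - \<phi> x0 \<le> u x - \<phi> x"
    using touch by blast
  obtain \<rho>3 where \<rho>3: "0 < \<rho>3" "cball x0 \<rho>3 \<subseteq> \<Omega>"
    using \<Omega> open_contains_cball by blast
  define \<rho> where "\<rho> = min (\<rho>1 / 2) (min (\<rho>2 / 2) \<rho>3)"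
  have \<rho>: "0 < \<rho>" "\<rho> < \<rho>1" "\<rho> < \<rho>2" "\<rho> \<le> \<rho>3" using \<rho>1 \<rho>2 \<rho>3 by (auto simp: \<rho>_def)
  define B where "B = cball x0 \<rho>"
  have B\<Omega>: "B \<subseteq> \<Omega>" using \<rho>3 \<rho> by (auto simp: B_def)
  have min: "u x0 - \<phi> x0 \<le> u x - \<phi> x" if "x \<in> B" for x
    using that \<rho> by (intro \<rho>2(2)) (auto simp: B_def)
  have x0B: "x0 \<in> B" using \<rho> by (simp add: B_def)
  have ulB: "uniform_limit B v u sequentially" using ul[OF _ B\<Omega>] by (simp add: B_def)
  \<comment> \<open>Subtracting a small paraboloid from the test function makes the minimum strict,
    which forces almost minima of \<open>w n\<close> to converge to \<open>x0\<close>.\<close>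
  define w where "w n x = v n x - (\<phi> x - \<eta> * (norm (x - x0))^2)" for n x
  have wu: "u x0 - \<phi> x0 + \<eta> * (norm (x - x0))^2 - s \<le> w n x"
    if "x \<in> B" "\<bar>v n x - u x\<bar> \<le> s" for x n s
    using min[OF that(1)] that(2) by (simp add: w_def abs_le_iff)
  have ev1: "\<forall>\<^sub>F n in sequentially. \<forall>x\<in>B. dist (v n x) (u x) < 1"
    using ulB by (rule uniform_limitD) simp
  \<comment> \<open>The tolerance \<open>(e n) ^ 3\<close> is negligible against the terms of size
    \<open>(e n)^2\<close> from which the equation is read.\<close>
  have "\<forall>\<^sub>F n in sequentially. \<exists>x\<in>B. \<forall>y\<in>B. w n x \<le> w n y + (e n) ^ 3"
    using ev1
  proof eventually_elim
    case (elim n)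
    have lb: "u x0 - \<phi> x0 - 1 \<le> w n x" if "x \<in> B" for x
    proof -
      have "0 \<le> \<eta> * (norm (x - x0))^2" using \<eta> by simp
      moreover have "\<bar>v n x - u x\<bar> \<le> 1" using elim that by (auto simp: dist_real_def intro: less_imp_le)
      ultimately show ?thesis using wu[OF that, of n 1] by linarith
    qed
    then have bdd: "bdd_below (w n ` B)" by (intro bdd_belowI2[of _ "u x0 - \<phi> x0 - 1"])
    have "(INF x\<in>B. w n x) < (INF x\<in>B. w n x) + (e n) ^ 3" using e(1)[of n] by simp
    moreover have "B \<noteq> {}" using x0B by auto
    ultimately obtain x where x: "x \<in> B" "w n x < (INF x\<in>B. w n x) + (e n) ^ 3"
      using cINF_less_iff[OF _ bdd] by blast
    have "w n x \<le> w n y + (e n) ^ 3" if "y \<in> B" for y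
      using x(2) cINF_lower[OF bdd that] by linarith
    then show ?case using x(1) by blast
  qed
  then obtain N0 where "\<And>n. N0 \<le> n \<Longrightarrow> \<exists>x\<in>B. \<forall>y\<in>B. w n x \<le> w n y + (e n) ^ 3"
    by (auto simp: eventually_sequentially)
  then obtain X where X: "\<And>n. N0 \<le> n \<Longrightarrow> X n \<in> B" "\<And>n y. N0 \<le> n \<Longrightarrow> y \<in> B \<Longrightarrow> w n (X n) \<le> w n y + (e n) ^ 3"
    by metis
  have e3: "(\<lambda>n. (e n) ^ 3) \<longlonglongrightarrow> 0" using tendsto_power[OF e(2), of 3] by simp
  have Xlim: "X \<longlonglongrightarrow> x0"
  proof (rule tendstoI)
    fix \<tau> :: real assume \<tau>: "0 < \<tau>"
    define s where "s = \<eta> * \<tau>^2 / 4"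
    have s: "0 < s" using \<tau> \<eta> by (simp add: s_def)
    have "\<forall>\<^sub>F n in sequentially. \<forall>x\<in>B. dist (v n x) (u x) < s" using ulB s by (rule uniform_limitD)
    moreover have "\<forall>\<^sub>F n in sequentially. dist ((e n) ^ 3) 0 < s" using e3 s by (rule tendstoD)
    moreover have "\<forall>\<^sub>F n in sequentially. N0 \<le> n" by (rule eventually_ge_at_top)
    ultimately show "\<forall>\<^sub>F n in sequentially. dist (X n) x0 < \<tau>"
    proof eventually_elim
      case (elim n)
      have d: "\<bar>v n x - u x\<bar> \<le> s" if "x \<in> B" for x using elim(1) that by (auto simp: dist_real_def intro: less_imp_le)
      have "u x0 - \<phi> x0 + \<eta> * (norm (X n - x0))^2 - s \<le> w n (X n)"
        using wu[OF X(1) d[OF X(1)]] elim(3) by blast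
      also have "\<dots> \<le> w n x0 + (e n) ^ 3" using X(2)[OF elim(3) x0B] .
      also have "w n x0 \<le> u x0 - \<phi> x0 + s" using d[OF x0B] by (simp add: w_def abs_le_iff)
      finally have "\<eta> * (norm (X n - x0))^2 \<le> 2 * s + (e n) ^ 3" by simp
      also have "\<dots> < 4 * s" using elim(2) s by (simp add: dist_real_def)
      finally have "\<eta> * (norm (X n - x0))^2 < \<eta> * \<tau>^2" by (simp add: s_def)
      then have "(norm (X n - x0))^2 < \<tau>^2" using \<eta> by simp
      then show ?case using \<tau> by (auto simp: dist_norm intro: power2_less_imp_less)
    qed
  qed
  define U where "U n z = mean p z (\<lambda>h. v n (X n + e n *\<^sub>R h))" for n z
  have tv: "tame (\<lambda>h. v n (X n + e n *\<^sub>R h))" for n by (rule tame_step[OF v])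
  have vb: "\<bar>v n (X n + e n *\<^sub>R h)\<bar> \<le> M" for n h by (rule v(2))
  have e3p: "0 < (e n) ^ 3" for n using e(1)[of n] by simp
  have "\<exists>z. norm z = 1 \<and> U n z < (INF z\<in>sphere 0 1. U n z) + (e n) ^ 3" for n
    unfolding U_def by (rule optimal_directions(2)[OF p tv vb e3p])
  then obtain Z where Z: "\<And>n. norm (Z n) = 1" "\<And>n. U n (Z n) < (INF z\<in>sphere 0 1. U n z) + (e n) ^ 3"
    by metis
  fix k0 :: 'n
  define c1 where "c1 = drift p (axis k0 1 :: real^'n)"
  have c1: "0 < c1"
  proof -
    have "0 < (p - 1) / (real CARD('n) + p)" using p by simp
    then show ?thesis using drift_ge[OF p, of "axis k0 1"] by (simp add: c1_def)
  qed
  define Gn where "Gn n = G (X n) - (2 * \<eta>) *\<^sub>R (X n - x0)" for n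
  have mz: "mean p z (\<lambda>h. h \<bullet> a) = c1 * (z \<bullet> a)" if z: "norm z = 1" for z a :: "real^'n"
    using first_moment_tilt[OF p z, of a] drift_eq[OF p z, of "axis k0 1"]
    by (simp add: c1_def drift_def[OF p])
  have ev: "\<forall>\<^sub>F n in sequentially. N0 \<le> n \<and> dist (X n) x0 < \<rho> / 2 \<and> e n < \<rho> / 2"
  proof -
    have "\<forall>\<^sub>F n in sequentially. dist (e n) 0 < \<rho> / 2" using e(2) \<rho> by (intro tendstoD) auto
    moreover have "\<forall>\<^sub>F n in sequentially. dist (X n) x0 < \<rho> / 2" using Xlim \<rho> by (intro tendstoD) auto
    ultimately show ?thesis using eventually_ge_at_top[of N0]
      by eventually_elim (auto simp: dist_real_def)
  qed
  \<comment> \<open>\<open>Z n\<close> is used for the infimum and an arbitrary \<open>a\<close> for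
    the supremum. Of the error, \<open>(e n) ^ 3\<close> stems from the almost minimality of
    \<open>X n\<close> and half of that from the choice of \<open>Z n\<close>.\<close>
  have main: "1/2 * e n * c1 * ((a + Z n) \<bullet> Gn n) + (e n)^2 * (1/2 * (q a + q (Z n)) - 2 * \<eta> + f (X n))
      \<le> 3/2 * (e n) ^ 3"
    if n: "N0 \<le> n \<and> dist (X n) x0 < \<rho> / 2 \<and> e n < \<rho> / 2" and a: "norm a = 1" for n a
  proof -
    have XB: "X n \<in> B" using X(1) n by blast
    have lower: "v n (X n) - (e n) ^ 3 - 2 * \<eta> * (e n)^2 + e n * (c1 * (z \<bullet> Gn n)) + (e n)^2 * q z \<le> U n z"
      if z: "norm z = 1" for z
    proof -
      define c where "c = v n (X n) - (e n) ^ 3 - 2 * \<eta> * (e n)^2"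
      have t: "tame (\<lambda>h. e n * (h \<bullet> Gn n))" "tame (\<lambda>h. (e n)^2 / 2 * (h \<bullet> (H *v h)))"
        by (intro tame_cmult tame_inner tame_quadratic)+
      have "mean p z (\<lambda>h. (c + e n * (h \<bullet> Gn n)) + (e n)^2 / 2 * (h \<bullet> (H *v h))) \<le> U n z"
        unfolding U_def
      proof (intro mean_mono[OF p z _ tv] tame_add tame_const t)
        fix h :: "real^'n" assume h: "norm h < 1"
        define k where "k = e n *\<^sub>R h"
        have ken: "norm k \<le> e n" using h e(1)[of n] by (simp add: k_def)
        have "norm (X n + k - x0) \<le> norm (X n - x0) + norm k"
          using norm_triangle_ineq[of "X n - x0" k] by (simp add: algebra_simps)
        then have YB: "X n + k \<in> B" using n ken by (simp add: B_def dist_norm norm_minus_commute)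
        have T: "\<phi> (X n + k) - \<phi> (X n) - G (X n) \<bullet> k - (k \<bullet> (H *v k)) / 2 \<ge> - (\<eta> * (norm k)^2)"
          using \<rho>1(2)[of "X n" k] n ken \<rho> by (simp add: abs_le_iff dist_commute)
        have S: "(norm (X n + k - x0))^2 = (norm (X n - x0))^2 + 2 * ((X n - x0) \<bullet> k) + (norm k)^2"
        proof -
          define y where "y = X n - x0"
          have eq: "X n + k - x0 = y + k" by (simp add: y_def)
          show ?thesis unfolding eq y_def[symmetric] power2_norm_eq_inner
            by (simp add: inner_add_left inner_add_right inner_commute[of k y])
        qed
        have "(norm k)^2 \<le> (e n)^2" using ken by (intro power_mono) auto
        then have "2 * \<eta> * (norm k)^2 \<le> 2 * \<eta> * (e n)^2" using \<eta> by (intro mult_left_mono) auto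
        moreover have "w n (X n) \<le> w n (X n + k) + (e n) ^ 3" using X(2) n YB by blast
        then have "v n (X n) + \<phi> (X n + k) - \<phi> (X n) - \<eta> * (2 * ((X n - x0) \<bullet> k)) - \<eta> * (norm k)^2 - (e n) ^ 3
            \<le> v n (X n + k)"
          unfolding w_def S by (simp add: algebra_simps)
        moreover have "Gn n \<bullet> k = G (X n) \<bullet> k - \<eta> * (2 * ((X n - x0) \<bullet> k))"
          by (simp add: Gn_def inner_diff_left)
        ultimately have a: "c + Gn n \<bullet> k + (k \<bullet> (H *v k)) / 2 \<le> v n (X n + k)"
          using T unfolding c_def by linarith
        have b: "Gn n \<bullet> k = e n * (h \<bullet> Gn n)" by (simp add: k_def inner_commute)
        have b': "k \<bullet> (H *v k) = (e n)^2 * (h \<bullet> (H *v h))"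
          by (simp add: k_def matrix_vector_mult_scaleR power2_eq_square)
        show "(c + e n * (h \<bullet> Gn n)) + (e n)^2 / 2 * (h \<bullet> (H *v h)) \<le> v n (X n + e n *\<^sub>R h)"
          using a unfolding b b' k_def[symmetric] by simp
      qed
      also have "mean p z (\<lambda>h. (c + e n * (h \<bullet> Gn n)) + (e n)^2 / 2 * (h \<bullet> (H *v h)))
          = c + e n * (c1 * (z \<bullet> Gn n)) + (e n)^2 / 2 * (2 * q z)"
      proof -
        have "mean p z (\<lambda>h. h \<bullet> (H *v h)) = 2 * q z"
        proof -
          have half: "2 * (s / (2 * d)) = s / d" for s d :: real by simp
          show ?thesis unfolding quadratic_moment[OF p z] q_def half ..
        qed
        then show ?thesis
          by (simp only: mean_add[OF p z tame_add[OF tame_const t(1)] t(2)] mean_add[OF p z tame_const t(1)]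
              mean_const[OF p z] mean_cmult[OF p] mz[OF z])
      qed
      finally show ?thesis by (simp add: c_def)
    qed
    have Ua: "U n a \<le> (SUP z\<in>sphere 0 1. U n z)"
      unfolding U_def by (rule optimal_directions(3)[OF p tv vb e3p a])
    have "1/2 * (U n a + U n (Z n)) + (e n)^2 * f (X n) \<le> v n (X n) + (e n) ^ 3 / 2"
    proof -
      have "X n \<in> \<Omega>" using XB B\<Omega> by blast
      from dpp[OF this, of n] have "v n (X n) = 1/2 * ((SUP z\<in>sphere 0 1. U n z) + (INF z\<in>sphere 0 1. U n z))
        + (e n)^2 * f (X n)" unfolding dpp_at_def U_def .
      with Z(2)[of n] Ua show ?thesis by (simp add: field_simps)
    qed
    with lower[OF a] lower[OF Z(1)[of n]] show ?thesis
      by (simp add: inner_add_left algebra_simps)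
  qed
  have "compact (sphere (0::real^'n) 1)" by simp
  moreover have "\<forall>n. Z n \<in> sphere 0 1" using Z(1) by simp
  ultimately obtain z r where z: "z \<in> sphere 0 1" and r: "strict_mono (r :: nat \<Rightarrow> nat)" and Zr: "(Z \<circ> r) \<longlonglongrightarrow> z"
    unfolding compact_def by blast
  have Xr: "(\<lambda>n. X (r n)) \<longlonglongrightarrow> x0" using LIMSEQ_subseq_LIMSEQ[OF Xlim r] by (simp add: o_def)
  have er: "(\<lambda>n. e (r n)) \<longlonglongrightarrow> 0" using LIMSEQ_subseq_LIMSEQ[OF e(2) r] by (simp add: o_def)
  have Zr: "(\<lambda>n. Z (r n)) \<longlonglongrightarrow> z" using Zr by (simp add: o_def)
  have fr: "(\<lambda>n. f (X (r n))) \<longlonglongrightarrow> f x0" using isCont_tendsto_compose[OF f Xr] .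
  have Gr: "(\<lambda>n. Gn (r n)) \<longlonglongrightarrow> G x0"
  proof -
    have "(\<lambda>n. G (X (r n)) - (2 * \<eta>) *\<^sub>R (X (r n) - x0)) \<longlonglongrightarrow> G x0 - (2 * \<eta>) *\<^sub>R (x0 - x0)"
      by (intro tendsto_intros Xr isCont_tendsto_compose[OF G Xr])
    then show ?thesis by (simp add: Gn_def)
  qed
  have "isCont q z"
  proof -
    have "continuous_on UNIV q" unfolding q_def using p by (intro continuous_intros) auto
    then show ?thesis by (simp add: continuous_on_eq_continuous_at)
  qed
  then have qr: "(\<lambda>n. q (Z (r n))) \<longlonglongrightarrow> q z" using isCont_tendsto_compose Zr by blast
  have evr: "\<forall>\<^sub>F n in sequentially. N0 \<le> r n \<and> dist (X (r n)) x0 < \<rho> / 2 \<and> e (r n) < \<rho> / 2"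
    using eventually_subseq[OF r ev] .
  have qm: "q (- a) = q a" for a by (simp add: q_def linear_neg[OF matrix_vector_mul_linear])
  \<comment> \<open>For \<open>a = - Z n\<close> the first order term is zero, not merely small, and
    \<open>q\<close> is even; this permits division by \<open>(e n)^2\<close>.\<close>
  have "q z + f x0 \<le> 2 * \<eta>"
  proof (rule tendsto_le[OF sequentially_bot])
    have "(\<lambda>n. 2 * \<eta> + 3/2 * e (r n)) \<longlonglongrightarrow> 2 * \<eta> + 3/2 * 0" by (intro tendsto_intros er)
    then show "(\<lambda>n. 2 * \<eta> + 3/2 * e (r n)) \<longlonglongrightarrow> 2 * \<eta>" by simp
    show "(\<lambda>n. q (Z (r n)) + f (X (r n))) \<longlonglongrightarrow> q z + f x0" by (intro tendsto_intros qr fr)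
    show "\<forall>\<^sub>F n in sequentially. q (Z (r n)) + f (X (r n)) \<le> 2 * \<eta> + 3/2 * e (r n)"
      using evr
    proof eventually_elim
      case (elim n)
      have "(e (r n))^2 * (q (Z (r n)) - 2 * \<eta> + f (X (r n))) \<le> (e (r n))^2 * (3/2 * e (r n))"
        using main[OF elim, of "- Z (r n)"] Z(1)[of "r n"] by (simp add: qm power2_eq_square power3_eq_cube)
      then have "q (Z (r n)) - 2 * \<eta> + f (X (r n)) \<le> 3/2 * e (r n)"
        using e(1)[of "r n"] by (subst (asm) mult_le_cancel_left_pos) auto
      then show ?case by simp
    qed
  qed
  moreover have "G x0 \<bullet> z \<le> - norm (G x0)"
  proof (cases "G x0 = 0")
    case False
    define a where "a = (1 / norm (G x0)) *\<^sub>R G x0"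
    have a: "norm a = 1" using False by (simp add: a_def)
    have aG: "a \<bullet> G x0 = norm (G x0)"
      using False by (simp add: a_def power2_norm_eq_inner[symmetric] power2_eq_square)
    have "1/2 * c1 * ((a + z) \<bullet> G x0) + 0 * (1/2 * (q a + q z) - 2 * \<eta> + f x0) \<le> 3/2 * 0^2"
    proof (rule tendsto_le[OF sequentially_bot])
      show "(\<lambda>n. 3/2 * (e (r n))^2) \<longlonglongrightarrow> 3/2 * 0^2" by (intro tendsto_intros er)
      show "(\<lambda>n. 1/2 * c1 * ((a + Z (r n)) \<bullet> Gn (r n)) + e (r n) * (1/2 * (q a + q (Z (r n))) - 2 * \<eta> + f (X (r n))))
        \<longlonglongrightarrow> 1/2 * c1 * ((a + z) \<bullet> G x0) + 0 * (1/2 * (q a + q z) - 2 * \<eta> + f x0)"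
        by (intro tendsto_intros er Zr Gr qr fr)
      show "\<forall>\<^sub>F n in sequentially. 1/2 * c1 * ((a + Z (r n)) \<bullet> Gn (r n))
          + e (r n) * (1/2 * (q a + q (Z (r n))) - 2 * \<eta> + f (X (r n))) \<le> 3/2 * (e (r n))^2"
        using evr
      proof eventually_elim
        case (elim n)
        define t where "t = e (r n)"
        have t: "0 < t" using e(1) by (simp add: t_def)
        have "t * (1/2 * c1 * ((a + Z (r n)) \<bullet> Gn (r n)) + t * (1/2 * (q a + q (Z (r n))) - 2 * \<eta> + f (X (r n))))
            \<le> t * (3/2 * t^2)"
          using main[OF elim a] unfolding t_def[symmetric] by (simp add: power2_eq_square power3_eq_cube algebra_simps)
        then show ?case unfolding t_def[symmetric] using t by (subst (asm) mult_le_cancel_left_pos) auto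
      qed
    qed
    then have "(a + z) \<bullet> G x0 \<le> 0" using c1 by (simp add: mult_le_0_iff)
    then show ?thesis using aG by (simp add: inner_add_left inner_commute[of z "G x0"])
  qed simp
  ultimately show ?thesis using z by (intro exI[of _ z]) (auto simp: q_def)
qed

text \<open>If \<open>g\<close> is nonzero, the condition on \<open>z\<close> is the equality case
  of Cauchy-Schwarz and determines \<open>z\<close>. Otherwise nothing is known of \<open>z\<close>,
  and since \<open>p - 2\<close> is negative the largest eigenvalue gives the bound valid for every
  direction.\<close>

lemma limit_operator_le:
  fixes H :: "real^'n^'n" and g :: "real^'n"
  assumes p: "1 < p" "p < 2" and sym: "\<And>a b. (H *v a) \<bullet> b = (H *v b) \<bullet> a"
    and ex: "\<And>\<eta>. 0 < \<eta> \<Longrightarrow> \<exists>z. norm z = 1 \<and> g \<bullet> z \<le> - norm g \<and>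
      (trace H + (p - 2) * (z \<bullet> (H *v z))) / (2 * (real CARD('n) + p)) + c \<le> 2 * \<eta>"
  shows "g \<noteq> 0 \<Longrightarrow> trace H + (p - 2) * (((H *v g) \<bullet> g) / (norm g)^2) \<le> - (2 * (real CARD('n) + p) * c)"
    and "trace H + (p - 2) * lambda_max H \<le> - (2 * (real CARD('n) + p) * c)"
proof -
  define D where "D = 2 * (real CARD('n) + p)"
  have D: "0 < D" using p by (simp add: D_def add_nonneg_pos)
  have concl: "A \<le> - (D * c)"
    if "\<And>z. norm z = 1 \<Longrightarrow> g \<bullet> z \<le> - norm g \<Longrightarrow> A \<le> trace H + (p - 2) * (z \<bullet> (H *v z))" for A
  proof -
    have "A / D + c \<le> 0 + \<tau>" if \<tau>: "0 < \<tau>" for \<tau>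
    proof -
      obtain z where z: "norm z = 1" "g \<bullet> z \<le> - norm g" "(trace H + (p - 2) * (z \<bullet> (H *v z))) / D + c \<le> 2 * (\<tau> / 2)"
        using ex[OF half_gt_zero[OF \<tau>], folded D_def] by blast
      have "A / D \<le> (trace H + (p - 2) * (z \<bullet> (H *v z))) / D"
        using \<open>\<And>z. norm z = 1 \<Longrightarrow> g \<bullet> z \<le> - norm g \<Longrightarrow> A \<le> trace H + (p - 2) * (z \<bullet> (H *v z))\<close>[OF z(1,2)] D
        by (intro divide_right_mono) auto
      then show ?thesis using z(3) by simp
    qed
    then have "A / D + c \<le> 0" by (rule field_le_epsilon)
    then show ?thesis using D by (simp add: field_simps)
  qed
  have "trace H + (p - 2) * lambda_max H \<le> - (D * c)"
  proof (rule concl)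
    fix z :: "real^'n" assume "norm z = 1"
    then have "z \<bullet> (H *v z) \<le> lambda_max H" by (rule quadratic_form_le_lambda_max[OF sym])
    then show "trace H + (p - 2) * lambda_max H \<le> trace H + (p - 2) * (z \<bullet> (H *v z))"
      using p by (intro add_left_mono mult_left_mono_neg) auto
  qed
  then show "trace H + (p - 2) * lambda_max H \<le> - (2 * (real CARD('n) + p) * c)" by (simp only: D_def)
  assume g: "g \<noteq> 0"
  have "trace H + (p - 2) * (((H *v g) \<bullet> g) / (norm g)^2) \<le> - (D * c)"
  proof (rule concl)
    fix z assume z: "norm z = 1" "g \<bullet> z \<le> - norm g"
    define a where "a = (1 / norm g) *\<^sub>R g"
    have na: "norm a = 1" using g by (simp add: a_def)
    have "a \<bullet> z \<le> - 1" using z(2) g by (simp add: a_def pos_divide_le_eq)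
    have "z \<bullet> z = 1" "a \<bullet> a = 1" using z(1) na by (auto simp: norm_eq_1)
    then have "(norm (z + a))^2 \<le> 0"
      using \<open>a \<bullet> z \<le> - 1\<close> unfolding power2_norm_eq_inner
      by (simp add: inner_add_left inner_add_right inner_commute[of z a])
    then have "z + a = 0" by simp
    then have za: "z = (- (1 / norm g)) *\<^sub>R g" by (simp add: a_def add_eq_0_iff2)
    have "z \<bullet> (H *v z) = ((H *v g) \<bullet> g) / (norm g)^2"
      unfolding za by (simp add: matrix_vector_mult_scaleR inner_commute power2_eq_square linear_neg[OF matrix_vector_mul_linear])
    then show "trace H + (p - 2) * (((H *v g) \<bullet> g) / (norm g)^2) \<le> trace H + (p - 2) * (z \<bullet> (H *v z))" by simp
  qed
  then show "trace H + (p - 2) * (((H *v g) \<bullet> g) / (norm g)^2) \<le> - (2 * (real CARD('n) + p) * c)"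
    by (simp only: D_def)
qed

lemma local_min_at_open:
  fixes x0 :: "'a::metric_space"
  assumes "open \<Omega>" "local_min_at \<Omega> g x0"
  shows "\<exists>\<rho>>0. \<forall>x\<in>ball x0 \<rho>. g x0 \<le> g x"
proof -
  have "\<forall>\<^sub>F y in at x0. g x0 \<le> g y"
    using assms at_within_open[of x0 \<Omega>] by (simp add: local_min_at_def)
  then obtain d where "0 < d" "\<And>x. x \<noteq> x0 \<Longrightarrow> dist x x0 < d \<Longrightarrow> g x0 \<le> g x"
    unfolding eventually_at by auto
  then show ?thesis by (intro exI[of _ d]) (metis dist_commute mem_ball order_refl)
qed

text \<open>The assumptions are invariant under negation of \<open>v\<close>, \<open>u\<close> and
  \<open>f\<close>, which lets subsolutions be treated by the argument for supersolutions.\<close>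

locale dpp_limit =
  fixes p M :: real and e :: "nat \<Rightarrow> real" and v :: "nat \<Rightarrow> real^'n \<Rightarrow> real" and u f :: "real^'n \<Rightarrow> real"
    and \<Omega> :: "(real^'n) set"
  assumes p: "1 < p" "p < 2" and e: "\<And>n. 0 < e n" "e \<longlonglongrightarrow> 0"
    and v: "\<And>n. v n \<in> borel_measurable borel" "\<And>n x. \<bar>v n x\<bar> \<le> M"
    and dpp: "\<And>n x. x \<in> \<Omega> \<Longrightarrow> dpp_at p (e n) f (v n) x"
    and limit: "\<And>K. compact K \<Longrightarrow> K \<subseteq> \<Omega> \<Longrightarrow> uniform_limit K v u sequentially"
    and \<Omega>: "open \<Omega>" and f: "continuous_on \<Omega> f" and u: "continuous_on \<Omega> u"
begin

lemma supersolution: "viscosity_supersolution p (\<lambda>x. 2 * (real CARD('n) + p) * f x) \<Omega> u"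
  unfolding viscosity_supersolution_def
proof (intro conjI ballI allI impI)
  show "lsc_on \<Omega> u"
    using u by (auto simp: lsc_on_def continuous_on_def dest: order_tendstoD)
  fix x0 \<phi>
  assume x0: "x0 \<in> \<Omega>" and C2: "C2_on \<Omega> \<phi>" and min: "local_min_at \<Omega> (\<lambda>x. u x - \<phi> x) x0"
  have fc: "isCont f x0" using f x0 \<Omega> by (simp add: continuous_on_eq_continuous_at)
  have sym: "(hess \<phi> x0 *v a) \<bullet> b = (hess \<phi> x0 *v b) \<bullet> a" for a b by (rule hess_symmetric[OF C2 \<Omega> x0])
  note touching = viscosity_touching[OF p e v dpp limit \<Omega> x0 fc C2_on_isCont_grad[OF C2 x0]
      C2_on_taylor[OF C2 \<Omega> x0] local_min_at_open[OF \<Omega> min]]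
  note le = limit_operator_le[OF p sym touching]
  show "normalized_p_laplacian p \<phi> x0 \<le> - (2 * (real CARD('n) + p) * f x0)" if "grad \<phi> x0 \<noteq> 0"
    using le(1) that unfolding normalized_p_laplacian_def laplacian_def by blast
  show "laplacian \<phi> x0 + (p - 2) * lambda_max (hess \<phi> x0) \<le> - (2 * (real CARD('n) + p) * f x0)"
    using le(2) unfolding laplacian_def by blast
qed

text \<open>Negation exchanges supremum and infimum, of which the equation contains only the sum;
  \<open>Inf_real_def\<close> expresses the exchange.\<close>

lemma reflect: "dpp_limit p M e (\<lambda>n x. - v n x) (\<lambda>x. - u x) (\<lambda>x. - f x) \<Omega>"
proof
  fix n x assume "x \<in> \<Omega>"
  from dpp[OF this, of n] show "dpp_at p (e n) (\<lambda>x. - f x) (\<lambda>x. - v n x) x"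
    by (simp add: dpp_at_def mean_uminus[OF p] Inf_real_def image_image field_simps)
qed (use p e v limit \<Omega> f u in \<open>auto intro: uniform_limit_uminus continuous_on_minus\<close>)

text \<open>\<open>viscosity_touching\<close> is applied to the negated family with
  \<open>- grad \<phi>\<close> and \<open>- H\<close>, the data of \<open>- \<phi>\<close>; negating
  the outcome turns \<open>lambda_max\<close> into \<open>lambda_min\<close>.\<close>

lemma subsolution: "viscosity_subsolution p (\<lambda>x. 2 * (real CARD('n) + p) * f x) \<Omega> u"
  unfolding viscosity_subsolution_def
proof (intro conjI ballI allI impI)
  show "usc_on \<Omega> u"
    using u by (auto simp: usc_on_def continuous_on_def dest: order_tendstoD)
  interpret neg: dpp_limit p M e "\<lambda>n x. - v n x" "\<lambda>x. - u x" "\<lambda>x. - f x" \<Omega> by (rule reflect)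
  fix x0 \<phi>
  assume x0: "x0 \<in> \<Omega>" and C2: "C2_on \<Omega> \<phi>" and max: "local_max_at \<Omega> (\<lambda>x. u x - \<phi> x) x0"
  have fc: "isCont (\<lambda>x. - f x) x0" using neg.f x0 \<Omega> by (simp only: continuous_on_eq_continuous_at)
  define H where "H = hess \<phi> x0"
  have mv: "(- H) *v a = - (H *v a)" for a
    using matrix_vector_mult_diff_rdistrib[of 0 H a] by simp
  have sym: "(H *v a) \<bullet> b = (H *v b) \<bullet> a" for a b unfolding H_def by (rule hess_symmetric[OF C2 \<Omega> x0])
  then have sym': "((- H) *v a) \<bullet> b = ((- H) *v b) \<bullet> a" for a b by (simp add: mv)
  have taylor: "\<exists>\<rho>>0. \<forall>x\<in>ball x0 \<rho>. \<forall>k. norm k < \<rho> \<longrightarrow>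
      \<bar>- \<phi> (x + k) - - \<phi> x - (- grad \<phi> x) \<bullet> k - (k \<bullet> ((- H) *v k)) / 2\<bar> \<le> \<eta> * (norm k)^2"
    if "0 < \<eta>" for \<eta>
  proof -
    have eq: "\<bar>- \<phi> (x + k) - - \<phi> x - (- grad \<phi> x) \<bullet> k - (k \<bullet> ((- H) *v k)) / 2\<bar>
        = \<bar>\<phi> (x + k) - \<phi> x - grad \<phi> x \<bullet> k - (k \<bullet> (H *v k)) / 2\<bar>" for x k
      by (subst abs_minus_cancel[symmetric]) (simp add: mv)
    show ?thesis unfolding eq unfolding H_def by (rule C2_on_taylor[OF C2 \<Omega> x0 that])
  qed
  have "local_min_at \<Omega> (\<lambda>x. - u x - - \<phi> x) x0"
    using max by (simp add: local_max_at_def local_min_at_def algebra_simps)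
  from local_min_at_open[OF \<Omega> this]
  have touch: "\<exists>\<rho>>0. \<forall>x\<in>ball x0 \<rho>. - u x0 - - \<phi> x0 \<le> - u x - - \<phi> x" .
  have Gc: "isCont (\<lambda>x. - grad \<phi> x) x0" by (intro continuous_minus C2_on_isCont_grad[OF C2 x0])
  note touching = viscosity_touching[OF p e neg.v neg.dpp neg.limit \<Omega> x0 fc Gc taylor touch]
  note le = limit_operator_le[OF p sym' touching]
  have tr: "trace (- H) = - trace H" by (simp add: trace_def sum_negf)
  show "normalized_p_laplacian p \<phi> x0 \<ge> - (2 * (real CARD('n) + p) * f x0)" if "grad \<phi> x0 \<noteq> 0"
  proof -
    have "trace (- H) + (p - 2) * (((- H *v - grad \<phi> x0) \<bullet> - grad \<phi> x0) / (norm (- grad \<phi> x0))^2)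
        \<le> - (2 * (real CARD('n) + p) * - f x0)"
      using le(1) that by simp
    then show ?thesis
      unfolding normalized_p_laplacian_def laplacian_def H_def[symmetric]
      by (simp add: tr mv linear_neg[OF matrix_vector_mul_linear])
  qed
  show "laplacian \<phi> x0 + (p - 2) * lambda_min (hess \<phi> x0) \<ge> - (2 * (real CARD('n) + p) * f x0)"
    using le(2) unfolding laplacian_def H_def[symmetric] tr lambda_max_uminus[OF sym] by simp
qed

end

theorem theorem5p3:
  fixes p \<epsilon>\<^sub>0 :: real
    and \<Omega> :: "(real^'n) set"
    and f :: "real^'n \<Rightarrow> real"
    and u\<^sub>\<epsilon> :: "real \<Rightarrow> real^'n \<Rightarrow> real"
  assumes "1 < p" and "p < 2"
    and "open \<Omega>" and "connected \<Omega>" and "\<Omega> \<noteq> {}" and "bounded \<Omega>"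
    and "continuous_on (closure \<Omega>) f"
    and "0 < \<epsilon>\<^sub>0"
    and "\<And>\<epsilon>. 0 < \<epsilon> \<Longrightarrow> \<epsilon> < \<epsilon>\<^sub>0 \<Longrightarrow>
           u\<^sub>\<epsilon> \<epsilon> \<in> borel_measurable (restrict_space borel (eps_nbhd \<epsilon> \<Omega>))"
    and "\<exists>M. \<forall>\<epsilon>. 0 < \<epsilon> \<and> \<epsilon> < \<epsilon>\<^sub>0 \<longrightarrow> (\<forall>x\<in>eps_nbhd \<epsilon> \<Omega>. \<bar>u\<^sub>\<epsilon> \<epsilon> x\<bar> \<le> M)"
    and "\<And>\<epsilon>. 0 < \<epsilon> \<Longrightarrow> \<epsilon> < \<epsilon>\<^sub>0 \<Longrightarrow> solves_DPP p \<epsilon> \<Omega> f (u\<^sub>\<epsilon> \<epsilon>)"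
  shows "\<exists>(e :: nat \<Rightarrow> real) (u :: real^'n \<Rightarrow> real).
           (\<forall>n. 0 < e n \<and> e n < \<epsilon>\<^sub>0) \<and> e \<longlonglongrightarrow> 0 \<and>
           Hoelder_continuous_in \<Omega> u \<and>
           locally_uniform_limit \<Omega> (\<lambda>n. u\<^sub>\<epsilon> (e n)) u \<and>
           viscosity_solution p (\<lambda>x. 2 * (real CARD('n) + p) * f x) \<Omega> u"
proof -
  note p = assms(1,2) and \<Omega> = assms(3)
  obtain M0 where M0: "\<And>\<epsilon> x. 0 < \<epsilon> \<Longrightarrow> \<epsilon> < \<epsilon>\<^sub>0 \<Longrightarrow> x \<in> eps_nbhd \<epsilon> \<Omega> \<Longrightarrow> \<bar>u\<^sub>\<epsilon> \<epsilon> x\<bar> \<le> M0"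
    using assms(10) by blast
  define M where "M = \<bar>M0\<bar>"
  have M: "0 \<le> M" "\<And>\<epsilon> x. 0 < \<epsilon> \<Longrightarrow> \<epsilon> < \<epsilon>\<^sub>0 \<Longrightarrow> x \<in> eps_nbhd \<epsilon> \<Omega> \<Longrightarrow> \<bar>u\<^sub>\<epsilon> \<epsilon> x\<bar> \<le> M"
    using M0 unfolding M_def by (auto intro: order_trans[OF _ abs_ge_self])
  have "bounded (f ` closure \<Omega>)"
    using assms(6,7) by (intro compact_imp_bounded compact_continuous_image) (auto simp: compact_closure)
  then obtain Mf where Mf: "0 < Mf" "\<And>x. x \<in> \<Omega> \<Longrightarrow> \<bar>f x\<bar> \<le> Mf"
    unfolding bounded_pos using closure_subset by fastforce
  \<comment> \<open>The shift by two keeps \<open>d n\<close> strictly below both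
    \<open>\<epsilon>\<^sub>0\<close> and 1, the latter being a condition of
    \<open>dpp_ball\<close>.\<close>
  define d where "d n = min \<epsilon>\<^sub>0 1 * inverse (real (Suc (Suc n)))" for n
  have d: "0 < d n" "d n < \<epsilon>\<^sub>0" "d n < 1" for n
  proof -
    have i: "0 < inverse (real (Suc (Suc n)))" "inverse (real (Suc (Suc n))) < 1"
      by (simp_all add: inverse_less_1_iff)
    have m: "0 < min \<epsilon>\<^sub>0 1" using assms(8) by simp
    show "0 < d n" unfolding d_def using m i(1) by (rule mult_pos_pos)
    have "d n < min \<epsilon>\<^sub>0 1 * 1" unfolding d_def using m i(2) by (rule mult_strict_left_mono[rotated])
    then show "d n < \<epsilon>\<^sub>0" "d n < 1" by auto
  qed
  have d0: "d \<longlonglongrightarrow> 0"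
  proof -
    have "(\<lambda>n. inverse (real (Suc (Suc n)))) \<longlonglongrightarrow> 0"
      using LIMSEQ_Suc[OF LIMSEQ_inverse_real_of_nat] .
    from tendsto_mult_left[OF this, of "min \<epsilon>\<^sub>0 1"] show ?thesis by (simp add: d_def[abs_def])
  qed
  define v where "v n = zero_extension (eps_nbhd (d n) \<Omega>) (u\<^sub>\<epsilon> (d n))" for n
  have vm: "v n \<in> borel_measurable borel" for n
    unfolding v_def using d by (intro zero_extension_measurable assms(9))
  have vb: "\<bar>v n x\<bar> \<le> M" for n x
    using M(1) M(2)[OF d(1,2)] by (simp add: v_def zero_extension_def indicator_def)
  have vu: "v n x = u\<^sub>\<epsilon> (d n) x" if "x \<in> \<Omega>" for n x
    unfolding v_def using that d(1) by (rule zero_extension_eq)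
  have vdpp: "dpp_at p (d n) f (v n) x" if "x \<in> \<Omega>" for n x
    unfolding v_def by (rule dpp_at_zero_extension[OF p d(1) assms(11)[OF d(1,2)] that])
  have modulus: "\<exists>L\<ge>0. \<forall>n. \<forall>x\<in>K. \<forall>y\<in>\<Omega>. \<bar>v n x - v n y\<bar> \<le> L * (sqrt (d n) + sqrt (dist x y))"
    if K: "compact K" "K \<subseteq> \<Omega>" for K
  proof -
    \<comment> \<open>By compactness balls of one radius about the points of \<open>K\<close> stay
      in \<open>\<Omega>\<close>, so one constant serves all of \<open>K\<close>; it depends on
      \<open>K\<close> only through this radius.\<close>
    obtain R0 where R0: "0 < R0" "(\<Union>x\<in>K. ball x R0) \<subseteq> \<Omega>"
      using compact_subset_open_imp_ball_epsilon_subset[OF K(1) \<Omega> K(2)] by blast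
    define R where "R = min R0 1"
    have R: "0 < R" "R \<le> 1" using R0 by (auto simp: R_def)
    have RK: "ball x R \<subseteq> \<Omega>" if "x \<in> K" for x
    proof -
      have "ball x R \<subseteq> ball x R0" by (rule subset_ball) (simp add: R_def)
      then show ?thesis using R0(2) that by blast
    qed
    obtain L where L: "0 \<le> L" "\<And>\<epsilon> w f (x0::real^'n) y. dpp_ball p \<epsilon> R M Mf w f x0 \<Longrightarrow>
        \<bar>w x0 - w y\<bar> \<le> L * (sqrt \<epsilon> + sqrt (dist x0 y))"
      using dpp_ball_modulus[OF p R(1,2) M(1) less_imp_le[OF Mf(1)]] by blast
    have "dpp_ball p (d n) R M Mf (v n) f x" if "x \<in> K" for n x
      unfolding v_def
      by (rule dpp_ball_zero_extension[OF p R(1,2) d(1,3) assms(9)[OF d(1,2)] M(2)[OF d(1,2)] M(1) Mf(2)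
            assms(11)[OF d(1,2)] RK[OF that]])
    then show ?thesis using L by blast
  qed
  obtain k u where k: "strict_mono (k :: nat \<Rightarrow> nat)"
    and lim: "\<And>K. compact K \<Longrightarrow> K \<subseteq> \<Omega> \<Longrightarrow> uniform_limit K (\<lambda>n. v (k n)) u sequentially"
    and mod: "\<And>K. compact K \<Longrightarrow> K \<subseteq> \<Omega> \<Longrightarrow> \<exists>L\<ge>0. \<forall>x\<in>K. \<forall>y\<in>\<Omega>. \<bar>u x - u y\<bar> \<le> L * sqrt (dist x y)"
    using asymptotic_Arzela_Ascoli[OF d0 vb modulus] by blast
  define e where "e n = d (k n)" for n
  have e0: "e \<longlonglongrightarrow> 0" using LIMSEQ_subseq_LIMSEQ[OF d0 k] by (simp add: o_def e_def[abs_def])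
  have cont: "continuous_on \<Omega> u"
  proof (rule continuous_at_imp_continuous_on, rule ballI)
    fix x assume x: "x \<in> \<Omega>"
    then obtain L where L: "\<And>y. y \<in> \<Omega> \<Longrightarrow> \<bar>u x - u y\<bar> \<le> L * sqrt (dist x y)"
      using mod[of "{x}"] by auto
    have "\<forall>\<^sub>F y in at x. y \<in> \<Omega>" using \<Omega> x by (simp add: eventually_at_in_open')
    then have ev: "\<forall>\<^sub>F y in at x. norm (u y - u x) \<le> L * sqrt (dist x y)"
      by eventually_elim (use L in \<open>simp add: abs_minus_commute\<close>)
    have "((\<lambda>y. L * sqrt (dist x y)) \<longlongrightarrow> L * sqrt (dist x x)) (at x)" by (intro tendsto_intros)
    then have "((\<lambda>y. L * sqrt (dist x y)) \<longlongrightarrow> 0) (at x)" by simp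
    from Lim_null_comparison[OF ev this] show "isCont u x"
      unfolding isCont_def by (rule LIM_zero_cancel)
  qed
  interpret dpp_limit p M e "\<lambda>n. v (k n)" u f \<Omega>
    using p d(1) e0 vm vb vdpp lim \<Omega> cont continuous_on_subset[OF assms(7) closure_subset]
    by unfold_locales (auto simp: e_def)
  have "viscosity_solution p (\<lambda>x. 2 * (real CARD('n) + p) * f x) \<Omega> u"
    unfolding viscosity_solution_def using subsolution supersolution by blast
  moreover have "\<exists>C. \<forall>x\<in>K. \<forall>y\<in>K. \<bar>u x - u y\<bar> \<le> C * dist x y powr (1/2)"
    if K: "compact K \<and> K \<subseteq> \<Omega>" for K
  proof -
    obtain L where "\<And>x y. x \<in> K \<Longrightarrow> y \<in> \<Omega> \<Longrightarrow> \<bar>u x - u y\<bar> \<le> L * sqrt (dist x y)"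
      using mod K by metis
    then show ?thesis using K by (intro exI[of _ L]) (auto simp: powr_half_sqrt)
  qed
  then have "Hoelder_continuous_in \<Omega> u"
    unfolding Hoelder_continuous_in_def by (intro exI[of _ "1/2"]) auto
  moreover have "locally_uniform_limit \<Omega> (\<lambda>n. u\<^sub>\<epsilon> (e n)) u"
    unfolding locally_uniform_limit_def
  proof (intro allI impI)
    fix K assume K: "compact K \<and> K \<subseteq> \<Omega>"
    have "v (k n) x = u\<^sub>\<epsilon> (e n) x" if "x \<in> K" for n x using vu K that by (auto simp: e_def)
    then show "uniform_limit K (\<lambda>n. u\<^sub>\<epsilon> (e n)) u sequentially"
      using lim K by (subst uniform_limit_cong'[where g = "\<lambda>n. v (k n)" and i = u]) auto
  qed
  ultimately show ?thesis using d e0 by (intro exI[of _ e] exI[of _ u]) (auto simp: e_def)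
qed

end
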